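(* Let constants $a,b>0$ satisfy $a+b<\tfrac12$. Then there is a constant $\varepsilon=\varepsilon(a,b)>0$ such that the following holds whenever $\boldsymbol{t}\in I_m^n$ is $\varepsilon$-regular and $(m,n,\lambda_m(\boldsymbol{t}))$ is $(a,\varepsilon)$-acceptable. Let $(\mathcal{D},\mathcal{D}')$ be a pair of probability spaces on $I_n^m$ in one of the cases: (a) $(\mathcal{D},\mathcal{D}')=(\mathcal{G}_{\boldsymbol{t}},\mathcal{B}_{\boldsymbol{t}})$; (b) $m=n$ and $(\mathcal{D},\mathcal{D}')=(\vec{\mathcal{G}}_{\boldsymbol{t}},\vec{\mathcal{B}}_{\boldsymbol{t}})$. Then there is an event $B=B(\mathcal{D})\subseteq I_n^m$ with $\operatorname{Prob}_{\mathcal{D}}(B)=\tilde{o}(1)$ such that, uniformly for $\boldsymbol{s}\in I_n^m\setminus B$, \[ \operatorname{Prob}_{\mathcal{D}}(\boldsymbol{S}=\boldsymbol{s})=\bigl(1+O(n^{-b})\bigr)\operatorname{Prob}_{\mathcal{D}'}(\boldsymbol{S}=\boldsymbol{s}). \] Moreover, for any random variable $X:I_n^m\to\mathbb{R}$ and any event $E\subseteq I_n^m$, \begin{align*} \operatorname{Prob}_{\mathcal{D}}(E)&=\bigl(1+O(n^{-b})\bigr)\operatorname{Prob}_{\mathcal{D}'}(E)+\tilde{o}(1),\\ \mathbb{E}_{\mathcal{D}}(X)&=\mathbb{E}_{\mathcal{D}'}(X)+O(n^{-b})\,\mathbb{E}_{\mathcal{D}'}(|X|)+\tilde{o}(1)\max_{\boldsymbol{s}\in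 I_n^m}|X|,\\ \operatorname{Var}_{\mathcal{D}}(X)&=\bigl(1+O(n^{-b})\bigr)\operatorname{Var}_{\mathcal{D}'}(X)+\tilde{o}(1)\max_{\boldsymbol{s}\in I_n^m}X^2. \end{align*}
   Context: Asymptotics: $m,n,\boldsymbol{t}$ are functions of an index $\ell\to\infty$; $O,o$ refer to $\ell\to\infty$. $\tilde{o}(1)$ denotes any quantity of magnitude $O(e^{-n^c})$ for some constant $c>0$. $U=\{u_1,\dots,u_m\}$, $V=\{v_1,\dots,v_n\}$; for a bipartite graph on $U\cup V$, $S_i=\deg u_i$. $I_n=\{0,\dots,n\}$. $\mathcal{G}_{\boldsymbol{t}}$ (for $\boldsymbol{t}\in I_m^n$): the distribution on $I_n^m$ of $\boldsymbol{S}=(S_1,\dots,S_m)$ for a uniformly random bipartite graph on $U\cup V$ with $\deg v_j=t_j$ for all $j$. $\vec{\mathcal{G}}_{\boldsymbol{t}}$ ($m=n$): same, uniformly over such graphs containing no edge $u_iv_i$. $\mathcal{B}_{\boldsymbol{t}}$: with $k=\sum_jt_j$, $\operatorname{Prob}(\boldsymbol{S}=\boldsymbol{s})=\binom{mn}{k}^{-1}\prod_{i=1}^m\binom{n}{s_i}$ if $\sum_is_i=k$ and $0$ otherwise. $\vec{\mathcal{B}}_{\boldsymbol{t}}$ ($m=n$): $\operatorname{Prob}(\boldsymbol{S}=\boldsymbol{s})=\binom{n^2-n}{k}^{-1}\prod_{i=1}^n\binom{n-1}{s_i}$ if $\sum_is_i=k$ and $0$ otherwise. $\lambda_m(\boldsymbol{t})=(mn)^{-1}\sum_{j=1}^nt_j$.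 A vector $(x_1,\dots,x_N)$ is $\varepsilon$-regular if $x_i-\frac1N\sum_{j=1}^Nx_j=O(N^{1/2+\varepsilon})$ uniformly in $i$. $(m,n,x)$, $x\in(0,1)$, is $(a,\varepsilon)$-acceptable if $m,n\to\infty$ with $m=o(n^{1+\varepsilon})$, $n=o(m^{1+\varepsilon})$, and $\frac{(1-2x)^2}{4x(1-x)}\bigl(1+\frac{5m}{6n}+\frac{5n}{6m}\bigr)<a\log n$. *)

theory Defs
  imports "HOL-Probability.Probability" "HOL-Library.Landau_Symbols"
    "HOL-Computational_Algebra.Polynomial"
begin

text \<open>Vectors of length \<open>N\<close> are functions on \<open>{..<N}\<close>, so all indices start at 0.
  \<open>int_vecs n m\<close> is $I_n^m$: length \<open>m\<close>, entries in \<open>{0..n}\<close>.\<close>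

definition int_vecs :: "nat \<Rightarrow> nat \<Rightarrow> (nat \<Rightarrow> nat) set" where
  "int_vecs n m = {..<m} \<rightarrow>\<^sub>E {0..n}"

text \<open>A bipartite graph on $U \cup V$ is given by its edge set: the pair \<open>(i, j)\<close> stands for
  the edge $u_i v_j$.\<close>

definition bip_graphs :: "nat \<Rightarrow> nat \<Rightarrow> (nat \<Rightarrow> nat) \<Rightarrow> (nat \<times> nat) set set" where
  "bip_graphs m n t =
     {G. G \<subseteq> {..<m} \<times> {..<n} \<and> (\<forall>j<n. card {i. (i, j) \<in> G} = t j)}"

definition bip_digraphs :: "nat \<Rightarrow> (nat \<Rightarrow> nat) \<Rightarrow> (nat \<times> nat) set set" where
  "bip_digraphs n t = {G \<in> bip_graphs n n t. \<forall>i<n. (i, i) \<notin> G}"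

definition U_degrees :: "nat \<Rightarrow> (nat \<times> nat) set \<Rightarrow> nat \<Rightarrow> nat" where
  "U_degrees m G = (\<lambda>i\<in>{..<m}. card {j. (i, j) \<in> G})"

definition G_dist :: "nat \<Rightarrow> nat \<Rightarrow> (nat \<Rightarrow> nat) \<Rightarrow> (nat \<Rightarrow> nat) pmf" where
  "G_dist m n t = map_pmf (U_degrees m) (pmf_of_set (bip_graphs m n t))"

text \<open>Only meaningful if \<open>bip_digraphs n t\<close> is nonempty, i.e. if \<open>t j < n\<close> for all \<open>j < n\<close>.\<close>

definition G_dist_vec :: "nat \<Rightarrow> (nat \<Rightarrow> nat) \<Rightarrow> (nat \<Rightarrow> nat) pmf" where
  "G_dist_vec n t = map_pmf (U_degrees n) (pmf_of_set (bip_digraphs n t))"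

definition B_mass :: "nat \<Rightarrow> nat \<Rightarrow> (nat \<Rightarrow> nat) \<Rightarrow> (nat \<Rightarrow> nat) \<Rightarrow> real" where
  "B_mass m n t s =
     (if s \<in> int_vecs n m \<and> (\<Sum>i<m. s i) = (\<Sum>j<n. t j)
      then (\<Prod>i<m. real (n choose s i)) / real ((m * n) choose (\<Sum>j<n. t j)) else 0)"

definition B_mass_vec :: "nat \<Rightarrow> (nat \<Rightarrow> nat) \<Rightarrow> (nat \<Rightarrow> nat) \<Rightarrow> real" where
  "B_mass_vec n t s =
     (if s \<in> int_vecs n n \<and> (\<Sum>i<n. s i) = (\<Sum>j<n. t j)
      then (\<Prod>i<n. real ((n - 1) choose s i)) / real ((n\<^sup>2 - n) choose (\<Sum>j<n. t j)) else 0)"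

definition B_dist :: "nat \<Rightarrow> nat \<Rightarrow> (nat \<Rightarrow> nat) \<Rightarrow> (nat \<Rightarrow> nat) pmf" where
  "B_dist m n t = embed_pmf (B_mass m n t)"

definition B_dist_vec :: "nat \<Rightarrow> (nat \<Rightarrow> nat) \<Rightarrow> (nat \<Rightarrow> nat) pmf" where
  "B_dist_vec n t = embed_pmf (B_mass_vec n t)"

definition edge_density :: "nat \<Rightarrow> nat \<Rightarrow> (nat \<Rightarrow> nat) \<Rightarrow> real" where
  "edge_density m n t = (\<Sum>j<n. real (t j)) / (real m * real n)"

text \<open>In the asymptotic notions the first argument of every sequence is the index \<open>l\<close>,
  which tends to infinity.  The implied constant of \<open>unif_bigo\<close> does not depend on
  \<open>x \<in> A l\<close>.\<close>

definition unif_bigo :: "(nat \<Rightarrow> 'a set) \<Rightarrow> (nat \<Rightarrow> 'a \<Rightarrow> real) \<Rightarrow> (nat \<Rightarrow> real) \<Rightarrow> bool" where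
  "unif_bigo A f g \<longleftrightarrow>
     (\<exists>K. \<forall>\<^sub>F l in sequentially. \<forall>x\<in>A l. \<bar>f l x\<bar> \<le> K * \<bar>g l\<bar>)"

definition otilde :: "(nat \<Rightarrow> nat) \<Rightarrow> (nat \<Rightarrow> real) \<Rightarrow> bool" where
  "otilde n f \<longleftrightarrow> (\<exists>c>0. f \<in> O(\<lambda>l. exp (- (real (n l) powr c))))"

definition unif_otilde :: "(nat \<Rightarrow> nat) \<Rightarrow> (nat \<Rightarrow> 'a set) \<Rightarrow> (nat \<Rightarrow> 'a \<Rightarrow> real) \<Rightarrow> bool" where
  "unif_otilde n A f \<longleftrightarrow> (\<exists>c>0. unif_bigo A f (\<lambda>l. exp (- (real (n l) powr c))))"

definition eps_regular :: "real \<Rightarrow> (nat \<Rightarrow> nat) \<Rightarrow> (nat \<Rightarrow> nat \<Rightarrow> real) \<Rightarrow> bool" where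
  "eps_regular \<epsilon> N x \<longleftrightarrow>
     unif_bigo (\<lambda>l. {..<N l}) (\<lambda>l i. x l i - (\<Sum>j<N l. x l j) / real (N l))
       (\<lambda>l. real (N l) powr (1/2 + \<epsilon>))"

definition acceptable ::
    "real \<Rightarrow> real \<Rightarrow> (nat \<Rightarrow> nat) \<Rightarrow> (nat \<Rightarrow> nat) \<Rightarrow> (nat \<Rightarrow> real) \<Rightarrow> bool" where
  "acceptable a \<epsilon> m n x \<longleftrightarrow>
     filterlim m at_top sequentially \<and> filterlim n at_top sequentially \<and>
     (\<lambda>l. real (m l)) \<in> o(\<lambda>l. real (n l) powr (1 + \<epsilon>)) \<and>
     (\<lambda>l. real (n l)) \<in> o(\<lambda>l. real (m l) powr (1 + \<epsilon>)) \<and>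
     (\<forall>\<^sub>F l in sequentially. 0 < x l \<and> x l < 1 \<and>
        (1 - 2 * x l)\<^sup>2 / (4 * x l * (1 - x l)) *
          (1 + 5 * real (m l) / (6 * real (n l)) + 5 * real (n l) / (6 * real (m l)))
        < a * ln (real (n l)))"

text \<open>The mass functions sum to 1 (Vandermonde), so that the two binomial models have the
  intended point probabilities.\<close>

lemma finite_int_vecs: "finite (int_vecs n m)"
  by (simp add: int_vecs_def finite_PiE)

lemma monom_sum_prod:
  "finite A \<Longrightarrow> (\<Prod>i\<in>A. monom (c i) (s i)) = monom (\<Prod>i\<in>A. c i :: nat) (\<Sum>i\<in>A. s i)"
  by (induction A rule: finite_induct) (auto simp: mult_monom simp flip: monom_eq_1)

lemma binomial_gf:
  assumes "r \<le> N"
  shows "(\<Sum>y\<in>{0..N}. monom (r choose y) y) = (monom 1 1 + 1 :: nat poly) ^ r"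
proof -
  have "(monom 1 1 + 1 :: nat poly) ^ r = (\<Sum>k\<le>r. of_nat (r choose k) * monom 1 1 ^ k * 1 ^ (r - k))"
    by (rule binomial_ring)
  also have "\<dots> = (\<Sum>k\<le>r. monom (r choose k) k)"
    by (intro sum.cong refl) (simp add: monom_power of_nat_monom mult_monom)
  also have "\<dots> = (\<Sum>y\<in>{0..N}. monom (r choose y) y)"
    using assms by (intro sum.mono_neutral_left) auto
  finally show ?thesis by simp
qed

lemma vandermonde_int_vecs:
  assumes "r \<le> N"
  shows "(\<Sum>s | s \<in> int_vecs N m \<and> (\<Sum>i<m. s i) = k. \<Prod>i<m. r choose s i) = (m * r) choose k"
proof -
  have "(\<Sum>s\<in>int_vecs N m. \<Prod>i<m. monom (r choose s i) (s i)) =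
        (\<Prod>i<m. \<Sum>y\<in>{0..N}. monom (r choose y) y)"
    unfolding int_vecs_def by (subst prod_sum_PiE) auto
  also have "\<dots> = (monom 1 1 + 1 :: nat poly) ^ (m * r)"
    by (simp add: binomial_gf[OF assms] flip: power_mult) (simp add: mult.commute)
  also have "\<dots> = (\<Sum>y\<in>{0..m * r + k}. monom ((m * r) choose y) y)"
    by (rule binomial_gf[symmetric]) simp
  finally have "coeff (\<Sum>s\<in>int_vecs N m. \<Prod>i<m. monom (r choose s i) (s i)) k = (m * r) choose k"
    by (simp add: coeff_sum)
  also have "coeff (\<Sum>s\<in>int_vecs N m. \<Prod>i<m. monom (r choose s i) (s i)) k =
     (\<Sum>s\<in>int_vecs N m. if (\<Sum>i<m. s i) = k then \<Prod>i<m. r choose s i else 0)"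
    by (simp add: coeff_sum monom_sum_prod)
  also have "\<dots> = (\<Sum>s | s \<in> int_vecs N m \<and> (\<Sum>i<m. s i) = k. \<Prod>i<m. r choose s i)"
    by (simp add: sum.inter_filter[OF finite_int_vecs])
  finally show ?thesis .
qed

lemma pmf_embed_binomial:
  assumes "r \<le> N" "k \<le> m * r"
    and f: "f = (\<lambda>s. if s \<in> int_vecs N m \<and> (\<Sum>i<m. s i) = k
                     then (\<Prod>i<m. real (r choose s i)) / real ((m * r) choose k) else 0)"
  shows "pmf (embed_pmf f) s = f s"
proof (rule pmf_embed_pmf)
  show nn: "0 \<le> f s" for s by (simp add: f prod_nonneg)
  let ?A = "{s. s \<in> int_vecs N m \<and> (\<Sum>i<m. s i) = k}"
  have fin: "finite ?A" by (rule finite_subset[OF _ finite_int_vecs]) auto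
  have "(\<Sum>s\<in>?A. f s) = real (\<Sum>s\<in>?A. \<Prod>i<m. r choose s i) / real ((m * r) choose k)"
    by (simp add: f sum_divide_distrib)
  also have "\<dots> = 1"
    using assms(2) by (simp add: vandermonde_int_vecs[OF assms(1)])
  finally have sum: "(\<Sum>s\<in>?A. f s) = 1" .
  have "(\<integral>\<^sup>+s. ennreal (f s) \<partial>count_space UNIV) = (\<Sum>s\<in>?A. ennreal (f s))"
    using fin by (intro nn_integral_count_space') (auto simp: f)
  also have "\<dots> = 1" by (simp add: sum_ennreal nn sum)
  finally show "(\<integral>\<^sup>+s. ennreal (f s) \<partial>count_space UNIV) = 1" .
qed

lemma pmf_B_dist:
  assumes "t \<in> int_vecs m n"
  shows "pmf (B_dist m n t) s = B_mass m n t s"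
proof -
  have "(\<Sum>j<n. t j) \<le> (\<Sum>j<n. m)"
    using assms by (intro sum_mono) (auto simp: int_vecs_def PiE_iff)
  then show ?thesis
    unfolding B_dist_def
    by (intro pmf_embed_binomial[of n n "\<Sum>j<n. t j" m])
       (auto simp: B_mass_def fun_eq_iff mult.commute)
qed

lemma pmf_B_dist_vec:
  assumes "(\<Sum>j<n. t j) \<le> n\<^sup>2 - n"
  shows "pmf (B_dist_vec n t) s = B_mass_vec n t s"
proof -
  have "n\<^sup>2 - n = n * (n - 1)" by (simp add: power2_eq_square algebra_simps)
  with assms show ?thesis
    unfolding B_dist_vec_def
    by (intro pmf_embed_binomial[of "n - 1" n "\<Sum>j<n. t j" n])
       (auto simp: B_mass_vec_def fun_eq_iff)
qed

end

theory Submission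
  imports Defs
begin

text \<open>
  Let \<open>P\<close> be the law of the row degrees of a random graph with column degrees \<open>t\<close>, let \<open>P'\<close> be
  the binomial model, i.e. the law of the row degrees of a uniformly random set of edges of the
  same size, and let \<open>f = P / P'\<close>.

  Moving one edge from row \<open>b\<close> to row \<open>a\<close> inside its column relates \<open>P\<close> at two neighbouring
  degree sequences through the codegree of the two rows in a random graph with given row and
  column degrees.  Under \<open>P\<close> the columns are independent, so Hoeffding's inequality and Markov's
  inequality show that, outside a set of degree sequences of exponentially small \<open>P\<close>-mass, a
  random graph with the given row degrees has all the expected first-order statistics.  Together
  with the exchange symmetry of two rows, this determines the expected codegree up to
  \<open>n powr o(1)\<close>, hence \<open>f\<close> changes by a factor \<open>1 + O(n powr (- 3/2 + o(1)))\<close> in one step.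

  The Poincare inequality for the uniform measure on edge sets of fixed size, whose spectral gap is
  of order \<open>1 / n\<^sup>2\<close>, then shows that \<open>sqrt f\<close> has standard deviation \<open>n powr (- 1/2 + o(1))\<close>
  under \<open>P'\<close>.  Applied to truncations of \<open>sqrt f\<close> at successive levels it upgrades this to
  exponentially small tails under both \<open>P\<close> and \<open>P'\<close>.  Digraphs are treated by forbidding the
  diagonal cells.\<close>

section \<open>The Poincare inequality on slices\<close>

text \<open>Chaining one-step ratios is too weak: two typical degree sequences are about n^(3/2)
  moves apart, so factors 1 + O(n^(-3/2)) leave only a bounded ratio, even before powers n^o(1) are
  counted. The Poincare inequality recovers this loss. With about n^2 cells it bounds the variance
  by n^2 times the squared relative step, hence by 1/n, and this is where the threshold b < 1/2
  comes from. The step must therefore really be accurate to n^(-3/2). The switching ratio is about 1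
  + d/x with d of order n^(1/2) and x of order n. Concentration alone locates x within n^(1/2),
  which gives an error 1/n in the step and a variance bound of order 1. At this order only the mean
  of x matters, so the exchange argument is used to find that mean to within n^o(1). Lower bounds on
  the ratio suffice throughout: a swap can be read in either direction, and the larger end can be
  taken as its start. Acceptability enters through the density: lam * (1 - lam) is at least of order
  1 / log n. Each truncation level halves the remaining mass, and about Q levels, with Q a small
  power of n, give the tail exp (- Q / 2).\<close>

definition slice :: "'a set \<Rightarrow> nat \<Rightarrow> 'a set set" where
  "slice X k = {A. A \<subseteq> X \<and> card A = k}"

definition swaps :: "'a set \<Rightarrow> nat \<Rightarrow> ('a set \<times> 'a \<times> 'a) set" where
  "swaps X k = (SIGMA A : slice X k. A \<times> (X - A))"

text \<open>The unnormalised Dirichlet form of the Bernoulli--Laplace chain. Every unordered pair of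
  neighbouring sets occurs twice, once from each end.\<close>

definition swap_energy :: "'a set \<Rightarrow> nat \<Rightarrow> ('a set \<Rightarrow> real) \<Rightarrow> real" where
  "swap_energy X k H = (\<Sum>(A, x, y) \<in> swaps X k. (H A - H (insert y (A - {x})))\<^sup>2)"

text \<open>This is \<open>card S\<close> times the variance of \<open>H\<close> under the uniform
  law on \<open>S\<close>. Without the normalisation it is additive over a partition, up to a term
  between the blocks.\<close>

definition sum_sq_dev :: "'a set \<Rightarrow> ('a \<Rightarrow> real) \<Rightarrow> real" where
  "sum_sq_dev S H = (\<Sum>A\<in>S. (H A)\<^sup>2) - (\<Sum>A\<in>S. H A)\<^sup>2 / real (card S)"

lemma finite_slice [simp]: "finite X \<Longrightarrow> finite (slice X k)"
  by (rule finite_subset[of _ "Pow X"]) (auto simp: slice_def)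

lemma finite_swaps [simp]: "finite X \<Longrightarrow> finite (swaps X k)"
  unfolding swaps_def by (intro finite_SigmaI) (auto simp: slice_def intro: finite_subset)

lemma card_slice: "finite X \<Longrightarrow> card (slice X k) = card X choose k"
  unfolding slice_def by (rule n_subsets)

lemma swap_in_slice:
  assumes "finite X" "A \<in> slice X k" "x \<in> A" "y \<in> X - A"
  shows "insert y (A - {x}) \<in> slice X k"
proof -
  have "finite A" using assms by (auto simp: slice_def intro: finite_subset)
  then have "card (insert y (A - {x})) = Suc (card A - 1)"
    using assms by (subst card_insert_disjoint) auto
  moreover have "card A > 0" using \<open>finite A\<close> assms(3) by (auto simp: card_gt_0_iff)
  ultimately show ?thesis using assms by (auto simp: slice_def)
qed

text \<open>Undoing a swap is an involution on \<open>swaps X k\<close>; this is the reversibility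
  of the chain.\<close>

lemma sum_swaps_sym:
  assumes "finite X"
  shows "(\<Sum>(A, x, y) \<in> swaps X k. g A (insert y (A - {x}))) =
         (\<Sum>(A, x, y) \<in> swaps X k. g (insert y (A - {x})) A)"
proof (rule sum.reindex_bij_witness[where i = "\<lambda>(A, x, y). (insert y (A - {x}), y, x)"
      and j = "\<lambda>(A, x, y). (insert y (A - {x}), y, x)"], goal_cases)
  case (1 a)
  then show ?case by (auto simp: swaps_def)
next
  case (2 a)
  then show ?case using swap_in_slice[OF assms] by (auto simp: swaps_def slice_def)
next
  case (3 a)
  then show ?case by (auto simp: swaps_def)
next
  case (4 a)
  then show ?case using swap_in_slice[OF assms] by (auto simp: swaps_def slice_def)
next
  case (5 a)
  then have "insert (fst (snd a)) (insert (snd (snd a)) (fst a - {fst (snd a)}) - {snd (snd a)}) = fst a"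
    by (auto simp: swaps_def)
  then show ?case by (auto simp: split_beta)
qed

text \<open>The law of total variance for two blocks; the last term is the variance between the
  block means.\<close>

lemma sum_sq_dev_Un:
  assumes "finite S" "finite T" "S \<inter> T = {}" "S \<noteq> {}" "T \<noteq> {}"
  shows "sum_sq_dev (S \<union> T) H = sum_sq_dev S H + sum_sq_dev T H +
    real (card S) * real (card T) / real (card S + card T) *
      ((\<Sum>A\<in>S. H A) / real (card S) - (\<Sum>A\<in>T. H A) / real (card T))\<^sup>2"
proof -
  have pos: "real (card S) > 0" "real (card T) > 0" using assms by (auto simp: card_gt_0_iff)
  have alg: "(a + b) - (u + v)\<^sup>2 / (p + q) = (a - u\<^sup>2 / p) + (b - v\<^sup>2 / q) + p * q / (p + q) * (u / p - v / q)\<^sup>2"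
    if "p > 0" "q > 0" for a b u v p q :: real
  proof -
    have "p + q > 0" using that by simp
    have "u\<^sup>2 / p + v\<^sup>2 / q - p * q / (p + q) * (u / p - v / q)\<^sup>2 = (u + v)\<^sup>2 / (p + q)"
      using that \<open>p + q > 0\<close> by (simp add: divide_simps power2_eq_square) algebra
    then show ?thesis by linarith
  qed
  show ?thesis
    unfolding sum_sq_dev_def using assms pos
    by (simp add: sum.union_disjoint card_Un_disjoint alg)
qed

lemma sum_sq_dev_image:
  "inj_on g S \<Longrightarrow> sum_sq_dev (g ` S) H = sum_sq_dev S (H \<circ> g)"
  by (simp add: sum_sq_dev_def sum.reindex card_image)

lemma sum_sq_dev_singleton: "card S \<le> 1 \<Longrightarrow> finite S \<Longrightarrow> sum_sq_dev S H = 0"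
  by (cases "S = {}") (auto simp: sum_sq_dev_def card_le_Suc0_iff_eq dest: card_1_singletonE
      elim!: is_singletonE simp: is_singleton_altdef le_Suc_eq card_1_singleton_iff)

lemma swap_energy_nonneg: "swap_energy X k H \<ge> 0"
  unfolding swap_energy_def by (intro sum_nonneg) auto

text \<open>Conditioning on whether \<open>x\<close> is chosen turns each half into a slice of the
  smaller ground set, to which an induction hypothesis applies.\<close>

lemma slice_remove_split:
  assumes "finite X" "x \<in> X" "0 < k"
  shows "slice X k = insert x ` slice (X - {x}) (k - 1) \<union> slice (X - {x}) k"
    and "insert x ` slice (X - {x}) (k - 1) = {A \<in> slice X k. x \<in> A}"
    and "slice (X - {x}) k = {A \<in> slice X k. x \<notin> A}"
    and "inj_on (insert x) (slice (X - {x}) (k - 1))"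
proof -
  show inj: "inj_on (insert x) (slice (X - {x}) (k - 1))"
    by (auto simp: inj_on_def slice_def)
  show 2: "insert x ` slice (X - {x}) (k - 1) = {A \<in> slice X k. x \<in> A}"
  proof (intro equalityI subsetI)
    fix A assume "A \<in> insert x ` slice (X - {x}) (k - 1)"
    then obtain A' where A': "A = insert x A'" "A' \<subseteq> X - {x}" "card A' = k - 1"
      by (auto simp: slice_def)
    then have "finite A'" "x \<notin> A'" using assms by (auto intro: finite_subset)
    then show "A \<in> {A \<in> slice X k. x \<in> A}" using A' assms by (auto simp: slice_def)
  next
    fix A assume A: "A \<in> {A \<in> slice X k. x \<in> A}"
    then have "A = insert x (A - {x})" "A - {x} \<in> slice (X - {x}) (k - 1)"
      using assms by (auto simp: slice_def)
    then show "A \<in> insert x ` slice (X - {x}) (k - 1)" by blast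
  qed
  show 3: "slice (X - {x}) k = {A \<in> slice X k. x \<notin> A}"
    by (auto simp: slice_def)
  show "slice X k = insert x ` slice (X - {x}) (k - 1) \<union> slice (X - {x}) k"
    unfolding 2 3 by auto
qed

text \<open>The Poincare inequality for the Bernoulli--Laplace chain, by induction on the ground
  set: split according to whether \<open>x\<close> is chosen, and average over \<open>x\<close>.\<close>

lemma poincare_slice:
  assumes "finite X"
  shows "real (card X) * sum_sq_dev (slice X k) H \<le> 2 * swap_energy X k H"
  using assms
proof (induction "card X" arbitrary: X k H)
  case 0
  then show ?case by (simp add: swap_energy_nonneg)
next
  case (Suc M0)
  define M where "M = card X"
  have M: "M = Suc M0" using Suc by (simp add: M_def)
  have fin: "finite X" by fact
  show ?case
  proof (cases "k = 0 \<or> k \<ge> M")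
    case True
    then have "card (slice X k) \<le> 1"
      using fin by (auto simp: card_slice M_def binomial_eq_0 le_less)
    then show ?thesis
      using fin by (simp add: sum_sq_dev_singleton swap_energy_nonneg)
  next
    case False
    then have k: "0 < k" "k < M" by auto
    then have M2: "M \<ge> 2" by simp
    let ?D = "\<lambda>(A, u, y). (H A - H (insert y (A - {u})))\<^sup>2"
    let ?P = "swaps X k"
    let ?V = "sum_sq_dev (slice X k) H"
    \<comment> \<open>\<open>e x\<close> collects the swaps that do not move \<open>x\<close>; they
      stay inside one of the two halves and are covered by induction. \<open>c x\<close> collects
      the swaps that remove \<open>x\<close>; they link the halves. Over all \<open>x\<close>, each
      swap is counted M - 2 times by \<open>e\<close> and once by \<open>c\<close>.\<close>
    define e where "e x = (\<Sum>p\<in>?P. if x \<noteq> fst (snd p) \<and> x \<noteq> snd (snd p) then ?D p else 0)" for x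
    define c where "c x = (\<Sum>p\<in>?P. if x = fst (snd p) then ?D p else 0)" for x
    have sum_e: "(\<Sum>x\<in>X. e x) = (real M - 2) * swap_energy X k H"
    proof -
      have "(\<Sum>x\<in>X. e x) = (\<Sum>p\<in>?P. \<Sum>x\<in>X. if x \<noteq> fst (snd p) \<and> x \<noteq> snd (snd p) then ?D p else 0)"
        unfolding e_def by (rule sum.swap)
      also have "\<dots> = (\<Sum>p\<in>?P. (real M - 2) * ?D p)"
      proof (intro sum.cong refl, goal_cases)
        case (1 p)
        then obtain A u y where p: "p = (A, u, y)" "A \<in> slice X k" "u \<in> A" "y \<in> X - A"
          by (auto simp: swaps_def)
        then have uy: "u \<in> X" "y \<in> X" "u \<noteq> y" by (auto simp: slice_def)
        have "(\<Sum>x\<in>X. if x \<noteq> u \<and> x \<noteq> y then ?D p else 0) = (\<Sum>x\<in>X - {u, y}. ?D p)"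
          using fin by (intro sum.mono_neutral_cong_right) auto
        also have "\<dots> = real (card (X - {u, y})) * ?D p" by simp
        also have "card (X - {u, y}) = M - 2"
          using uy fin by (subst card_Diff_subset) (auto simp: M_def)
        also have "real (M - 2) = real M - 2" using M2 by simp
        finally show ?case by (simp add: p)
      qed
      finally show ?thesis
        by (simp add: swap_energy_def sum_distrib_left split_beta)
    qed
    have sum_c: "(\<Sum>x\<in>X. c x) = swap_energy X k H"
    proof -
      have "(\<Sum>x\<in>X. c x) = (\<Sum>p\<in>?P. \<Sum>x\<in>X. if x = fst (snd p) then ?D p else 0)"
        unfolding c_def by (rule sum.swap)
      also have "\<dots> = (\<Sum>p\<in>?P. ?D p)"
      proof (intro sum.cong refl, goal_cases)
        case (1 p)
        then have "fst (snd p) \<in> X" by (auto simp: swaps_def slice_def)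
        then show ?case using fin by simp
      qed
      finally show ?thesis by (simp add: swap_energy_def split_beta)
    qed
    have main: "?V \<le> 2 * e x / (real M - 1) + c x / real M" if x: "x \<in> X" for x
    proof -
      let ?S1 = "{A \<in> slice X k. x \<in> A}" and ?S0 = "{A \<in> slice X k. x \<notin> A}"
      note sp = slice_remove_split[OF fin x k(1)]
      have cX: "card (X - {x}) = M0" using fin x M by (simp add: M_def)
      define N1 N0 where "N1 = real (card ?S1)" and "N0 = real (card ?S0)"
      have S1ne: "?S1 \<noteq> {}"
      proof -
        have "card (slice (X - {x}) (k - 1)) > 0" using fin k M by (simp add: card_slice cX)
        then show ?thesis unfolding sp(2)[symmetric] by auto
      qed
      have S0ne: "?S0 \<noteq> {}"
      proof -
        have "card (slice (X - {x}) k) > 0" using fin k M by (simp add: card_slice cX)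
        then show ?thesis unfolding sp(3)[symmetric] by auto
      qed
      have pos: "N1 > 0" "N0 > 0" using S1ne S0ne fin by (auto simp: N1_def N0_def card_gt_0_iff)
      define \<mu>1 \<mu>0 where "\<mu>1 = (\<Sum>A\<in>?S1. H A) / N1" and "\<mu>0 = (\<Sum>A\<in>?S0. H A) / N0"
      have "slice X k = ?S1 \<union> ?S0" by auto
      moreover have "?S1 \<inter> ?S0 = {}" by auto
      ultimately have V: "?V = sum_sq_dev ?S1 H + sum_sq_dev ?S0 H + N1 * N0 / (N1 + N0) * (\<mu>1 - \<mu>0)\<^sup>2"
        using sum_sq_dev_Un[of ?S1 ?S0 H] S1ne S0ne fin
        by (simp add: N1_def N0_def \<mu>1_def \<mu>0_def)
      have IH1: "real M0 * sum_sq_dev ?S1 H \<le> 2 * swap_energy (X - {x}) (k - 1) (H \<circ> insert x)"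
        using Suc.hyps(1)[of "X - {x}" "k - 1" "H \<circ> insert x"] fin cX sum_sq_dev_image[OF sp(4), of H]
        by (simp add: sp(2)[symmetric])
      have IH0: "real M0 * sum_sq_dev ?S0 H \<le> 2 * swap_energy (X - {x}) k H"
        using Suc.hyps(1)[of "X - {x}" k H] fin cX by (simp add: sp(3)[symmetric])
      have E1: "swap_energy (X - {x}) (k - 1) (H \<circ> insert x) =
          (\<Sum>p\<in>{p \<in> ?P. x \<in> fst p \<and> x \<noteq> fst (snd p)}. ?D p)"
        unfolding swap_energy_def
      proof (rule sum.reindex_bij_witness[where i = "\<lambda>(A, u, y). (A - {x}, u, y)"
            and j = "\<lambda>(A, u, y). (insert x A, u, y)"], goal_cases)
        case (1 a)
        then show ?case by (auto simp: swaps_def slice_def)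
      next
        case (2 a)
        then obtain A u y where a: "a = (A, u, y)" "A \<in> slice (X - {x}) (k - 1)" "u \<in> A" "y \<in> X - {x} - A"
          by (auto simp: swaps_def)
        then have "insert x A \<in> ?S1" using sp(2) by blast
        then show ?case using a by (auto simp: swaps_def slice_def)
      next
        case (3 a)
        then show ?case by (auto simp: swaps_def)
      next
        case (4 a)
        then obtain A u y where a: "a = (A, u, y)" "A \<in> slice X k" "u \<in> A" "y \<in> X - A" "x \<in> A" "x \<noteq> u"
          by (auto simp: swaps_def)
        then show ?case using fin x by (auto simp: swaps_def slice_def)
      next
        case (5 a)
        then obtain A u y where a: "a = (A, u, y)" "A \<in> slice (X - {x}) (k - 1)" "u \<in> A" "y \<in> X - {x} - A"
          by (auto simp: swaps_def)
        have "insert y (insert x A - {u}) = insert x (insert y (A - {u}))"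
          using a by (auto simp: slice_def)
        then show ?case using a by (simp add: comp_def)
      qed
      have E0: "swap_energy (X - {x}) k H =
          (\<Sum>p\<in>{p \<in> ?P. x \<notin> fst p \<and> x \<noteq> snd (snd p)}. ?D p)"
        unfolding swap_energy_def
        by (rule sum.cong) (auto simp: swaps_def slice_def)
      have "e x = (\<Sum>p\<in>{p \<in> ?P. x \<noteq> fst (snd p) \<and> x \<noteq> snd (snd p)}. ?D p)"
        unfolding e_def using fin by (simp add: sum.inter_filter)
      also have "{p \<in> ?P. x \<noteq> fst (snd p) \<and> x \<noteq> snd (snd p)} =
          {p \<in> ?P. x \<in> fst p \<and> x \<noteq> fst (snd p)} \<union> {p \<in> ?P. x \<notin> fst p \<and> x \<noteq> snd (snd p)}"
        by (auto simp: swaps_def)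
      also have "(\<Sum>p\<in>\<dots>. ?D p) = swap_energy (X - {x}) (k - 1) (H \<circ> insert x) + swap_energy (X - {x}) k H"
        unfolding E1 E0 using fin by (intro sum.union_disjoint) auto
      finally have ex: "e x = swap_energy (X - {x}) (k - 1) (H \<circ> insert x) + swap_energy (X - {x}) k H" .
      have within: "sum_sq_dev ?S1 H + sum_sq_dev ?S0 H \<le> 2 * e x / (real M - 1)"
      proof -
        have "real M0 * (sum_sq_dev ?S1 H + sum_sq_dev ?S0 H) \<le> 2 * e x"
          using IH1 IH0 by (simp add: ex distrib_left)
        moreover have "real M - 1 = real M0" "M0 > 0" using M M2 by auto
        ultimately show ?thesis by (simp add: field_simps)
      qed
      \<comment> \<open>the difference of the conditional means, through the swap \<open>A \<mapsto> A - x + y\<close>\<close>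
      let ?C = "SIGMA A : ?S1. X - A"
      have finA: "finite A" if "A \<in> slice X k" for A using that fin by (auto simp: slice_def intro: finite_subset)
      have cC: "card (X - A) = M - k" if "A \<in> ?S1" for A
        using that fin by (subst card_Diff_subset) (auto simp: slice_def M_def intro: finite_subset)
      have sum1: "(\<Sum>(A, y)\<in>?C. g A) = real (M - k) * (\<Sum>A\<in>?S1. g A)" for g :: "_ \<Rightarrow> real"
        using fin by (subst sum.Sigma[symmetric]) (auto simp: cC sum_distrib_left)
      \<comment> \<open>A set \<open>A\<close> without \<open>x\<close> is reached from
        \<open>A - {y}\<close> plus \<open>x\<close> for each of the \<open>k\<close> choices of
        \<open>y\<close> in \<open>A\<close>.\<close>
      have sum0: "(\<Sum>(A, y)\<in>?C. g (insert y (A - {x}))) = real k * (\<Sum>A\<in>?S0. g A)" for g :: "_ \<Rightarrow> real"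
      proof -
        have "(\<Sum>(A, y)\<in>?C. g (insert y (A - {x}))) = (\<Sum>(A, y)\<in>(SIGMA A : ?S0. A). g A)"
        proof (rule sum.reindex_bij_witness[where j = "\<lambda>(A, y). (insert y (A - {x}), y)"
              and i = "\<lambda>(A, y). (insert x (A - {y}), y)"], goal_cases)
          case (1 a)
          then show ?case by (auto simp: slice_def)
        next
          case (2 a)
          then show ?case using swap_in_slice[OF fin, of "fst a" k x "snd a"] by (auto simp: slice_def)
        next
          case (3 a)
          then show ?case by (auto simp: slice_def)
        next
          case (4 a)
          then show ?case using swap_in_slice[OF fin, of "fst a" k "snd a" x] x by (auto simp: slice_def)
        next
          case (5 a)
          then show ?case by (auto simp: slice_def)
        qed
        also have "\<dots> = (\<Sum>A\<in>?S0. \<Sum>y\<in>A. g A)"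
          using fin finA by (intro sum.Sigma[symmetric]) auto
        also have "\<dots> = real k * (\<Sum>A\<in>?S0. g A)" by (simp add: slice_def sum_distrib_left)
        finally show ?thesis .
      qed
      have cardC: "real (card ?C) = real (M - k) * N1"
        using sum1[of "\<lambda>_. 1"] by (simp add: N1_def split_beta)
      have cardC': "real (card ?C) = real k * N0"
        using sum0[of "\<lambda>_. 1"] by (simp add: N0_def split_beta)
      have cx: "c x = (\<Sum>(A, y)\<in>?C. (H A - H (insert y (A - {x})))\<^sup>2)"
      proof -
        have "c x = (\<Sum>p\<in>{p \<in> ?P. x = fst (snd p)}. ?D p)"
          unfolding c_def using fin by (simp add: sum.inter_filter)
        also have "\<dots> = (\<Sum>(A, y)\<in>?C. (H A - H (insert y (A - {x})))\<^sup>2)"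
          by (rule sum.reindex_bij_witness[where j = "\<lambda>(A, u, y). (A, y)" and i = "\<lambda>(A, y). (A, x, y)"])
             (auto simp: swaps_def)
        finally show ?thesis .
      qed
      let ?n = "real (card ?C)"
      have Mk: "real (M - k) > 0" using k by simp
      have npos: "?n > 0" unfolding cardC using pos Mk by simp
      have "(\<Sum>(A, y)\<in>?C. H A - H (insert y (A - {x}))) = ?n * (\<mu>1 - \<mu>0)"
      proof -
        have "(\<Sum>(A, y)\<in>?C. H A - H (insert y (A - {x}))) =
            (\<Sum>(A, y)\<in>?C. H A) - (\<Sum>(A, y)\<in>?C. H (insert y (A - {x})))"
          by (simp add: sum_subtractf split_beta)
        also have "(\<Sum>(A, y)\<in>?C. H A) = ?n * \<mu>1"
          unfolding sum1 cardC \<mu>1_def using pos by simp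
        also have "(\<Sum>(A, y)\<in>?C. H (insert y (A - {x}))) = ?n * \<mu>0"
          unfolding sum0 cardC' \<mu>0_def using pos by simp
        finally show ?thesis by (simp add: right_diff_distrib)
      qed
      then have "(?n * (\<mu>1 - \<mu>0))\<^sup>2 \<le> c x * ?n"
        using sum_squared_le_sum_of_squares[of "\<lambda>(A, y). H A - H (insert y (A - {x}))" ?C]
        by (simp add: cx split_beta)
      then have "?n * (?n * (\<mu>1 - \<mu>0)\<^sup>2) \<le> ?n * c x" by (simp add: power2_eq_square mult_ac)
      then have J: "?n * (\<mu>1 - \<mu>0)\<^sup>2 \<le> c x" using npos by simp
      \<comment> \<open>Counting \<open>?C\<close> from both ends gives N1 * (M - k) = N0 * k, so
        the weight N0 / (N1 + N0) equals (M - k) / M.\<close>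
      have N: "(N1 + N0) * real (M - k) = N0 * real M"
        using cardC cardC' k by (simp add: algebra_simps of_nat_diff)
      have "N1 * N0 / (N1 + N0) * (\<mu>1 - \<mu>0)\<^sup>2 = ?n * (\<mu>1 - \<mu>0)\<^sup>2 * (N0 / ((N1 + N0) * real (M - k)))"
        using Mk pos by (simp add: cardC)
      also have "N0 / ((N1 + N0) * real (M - k)) = 1 / real M" using pos unfolding N by simp
      also have "?n * (\<mu>1 - \<mu>0)\<^sup>2 * (1 / real M) \<le> c x / real M"
        using J M by (simp add: divide_right_mono)
      finally show ?thesis using V within by linarith
    qed
    have "real M * ?V = (\<Sum>x\<in>X. ?V)" by (simp add: M_def)
    also have "\<dots> \<le> (\<Sum>x\<in>X. 2 * e x / (real M - 1) + c x / real M)"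
      by (intro sum_mono main)
    also have "\<dots> = 2 * (\<Sum>x\<in>X. e x) / (real M - 1) + (\<Sum>x\<in>X. c x) / real M"
      by (simp add: sum.distrib sum_divide_distrib sum_distrib_left)
    also have "\<dots> = (2 * (real M - 2) / (real M - 1) + 1 / real M) * swap_energy X k H"
      by (simp add: sum_e sum_c algebra_simps)
    \<comment> \<open>The first coefficient is 2 - 2 / (M - 1), and the deficit exceeds 1 / M; so
      the constant 2 reproduces itself in the induction.\<close>
    also have "\<dots> \<le> 2 * swap_energy X k H"
    proof (rule mult_right_mono)
      have "2 * (real M - 2) / (real M - 1) = 2 - 2 / (real M - 1)"
        using M2 by (simp add: field_simps)
      moreover have "1 / real M \<le> 2 / (real M - 1)" using M2 by (simp add: field_simps)
      ultimately show "2 * (real M - 2) / (real M - 1) + 1 / real M \<le> 2" by linarith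
    qed (rule swap_energy_nonneg)
    finally show ?thesis by (simp add: M_def)
  qed
qed

section \<open>Concentration of a slowly varying density\<close>

text \<open>The function \<open>\<phi>\<close> only orients the swaps: a squared difference is
  symmetric, so it is enough to bound it in the direction in which \<open>\<phi>\<close> does not
  increase. The bound is charged to the start of the swap through \<open>u\<close> and to its end
  through \<open>v\<close>. A set takes part in at most (card X)^2 swaps, and the Poincare
  inequality divides by \<open>card X\<close> once.\<close>

lemma sum_sq_dev_slice_le:
  fixes \<phi> :: "'a set \<Rightarrow> real"
  assumes fin: "finite X" and M: "card X > 0"
    and u: "\<And>A. u A \<ge> 0" and v: "\<And>A. v A \<ge> 0"
    and down: "\<And>A x y. A \<in> slice X k \<Longrightarrow> x \<in> A \<Longrightarrow> y \<in> X - A \<Longrightarrow> \<phi> A \<ge> \<phi> (insert y (A - {x})) \<Longrightarrow>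
       (H A - H (insert y (A - {x})))\<^sup>2 \<le> u A + v (insert y (A - {x}))"
  shows "sum_sq_dev (slice X k) H \<le> 4 * real (card X) * (\<Sum>A\<in>slice X k. u A + v A)"
proof -
  let ?P = "swaps X k"
  define g where "g A = u A + v A" for A
  have g: "g A \<ge> 0" for A using u v by (simp add: g_def)
  have "swap_energy X k H \<le> (\<Sum>(A, x, y)\<in>?P. g A + g (insert y (A - {x})))"
    unfolding swap_energy_def
  proof (rule sum_mono, clarsimp)
    fix A x y assume "(A, x, y) \<in> ?P"
    then have *: "A \<in> slice X k" "x \<in> A" "y \<in> X - A" by (auto simp: swaps_def)
    let ?A' = "insert y (A - {x})"
    show "(H A - H ?A')\<^sup>2 \<le> g A + g ?A'"
    proof (cases "\<phi> A \<ge> \<phi> ?A'")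
      case True
      then show ?thesis using down[OF * True] u[of ?A'] v[of A] by (simp add: g_def)
    next
      case False
      have A': "?A' \<in> slice X k" by (rule swap_in_slice[OF fin *])
      have undo: "insert x (?A' - {y}) = A" using * by auto
      have "x \<in> X - ?A'" using * by (auto simp: slice_def)
      from down[OF A' insertI1 this, unfolded undo] False show ?thesis
        using u[of A] v[of ?A'] by (simp add: g_def power2_commute)
    qed
  qed
  also have "\<dots> = (\<Sum>(A, x, y)\<in>?P. g A) + (\<Sum>(A, x, y)\<in>?P. g (insert y (A - {x})))"
    by (simp add: sum.distrib split_beta)
  also have "(\<Sum>(A, x, y)\<in>?P. g (insert y (A - {x}))) = (\<Sum>(A, x, y)\<in>?P. g A)"
    using sum_swaps_sym[OF fin, where g = "\<lambda>A A'. g A'" and k = k] by simp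
  also have "(\<Sum>(A, x, y)\<in>?P. g A) \<le> (\<Sum>(A, x, y)\<in>(SIGMA A : slice X k. X \<times> X). g A)"
    using fin g by (intro sum_mono2) (auto simp: swaps_def slice_def)
  also have "\<dots> = (\<Sum>A\<in>slice X k. \<Sum>p\<in>X \<times> X. g A)"
    using fin by (subst sum.Sigma) (auto simp: split_beta)
  also have "\<dots> = (real (card X))\<^sup>2 * (\<Sum>A\<in>slice X k. g A)"
    by (simp add: sum_distrib_left power2_eq_square card_cartesian_product)
  finally have "swap_energy X k H \<le> 2 * (real (card X))\<^sup>2 * (\<Sum>A\<in>slice X k. g A)" by (simp add: mult_ac)
  with poincare_slice[OF fin, of k H]
  have "real (card X) * sum_sq_dev (slice X k) H \<le> real (card X) * (4 * real (card X) * (\<Sum>A\<in>slice X k. g A))"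
    by (simp add: power2_eq_square mult_ac)
  then show ?thesis using M by (simp add: g_def)
qed

text \<open>2 * \<rho> is the fixed point of the recursion. The alternative
  \<open>\<rho> < 0\<close> covers the base case, where the bound needs a nonnegative
  \<rho>.\<close>

lemma half_iterate:
  fixes W :: "nat \<Rightarrow> real"
  assumes "W 0 \<le> 1" "\<And>i. i < I \<Longrightarrow> W (Suc i) \<le> W i / 2 + \<rho>"
  shows "i \<le> I \<Longrightarrow> W i \<le> (1/2) ^ i + 2 * \<rho> \<or> \<rho> < 0"
proof (induction i)
  case 0
  then show ?case using assms(1) by auto
next
  case (Suc i)
  then have "W i \<le> (1/2) ^ i + 2 * \<rho> \<or> \<rho> < 0" "W (Suc i) \<le> W i / 2 + \<rho>"
    using assms(2)[of i] by auto
  moreover have "(1/2 :: real) ^ Suc i = (1/2) ^ i / 2" by simp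
  ultimately show ?case by linarith
qed

text \<open>\<open>\<phi>\<close> is the square root of a probability density on the slice that can only drop by a
  factor \<open>1 - L\<close> in one swap, except when the swap starts in the bad set \<open>b\<close>.  Since
  \<open>\<phi>\<^sup>2\<close> is the density, a drop starting in \<open>b\<close> costs at most the mass of \<open>b\<close>; this is why
  square roots are used.\<close>

locale slice_density =
  fixes X :: "'a set" and k :: nat and \<phi> :: "'a set \<Rightarrow> real" and b :: "'a set set" and L \<eta> :: real
  assumes fin: "finite X" and card_pos: "card X > 0" and ne: "slice X k \<noteq> {}"
    and nonneg: "\<And>A. \<phi> A \<ge> 0"
    and norm: "(\<Sum>A\<in>slice X k. (\<phi> A)\<^sup>2) = real (card (slice X k))"
    and bad: "(\<Sum>A\<in>slice X k \<inter> b. (\<phi> A)\<^sup>2) \<le> \<eta> * real (card (slice X k))"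
    and L: "0 \<le> L" "L \<le> 1"
    and lower: "\<And>A x y. A \<in> slice X k \<Longrightarrow> A \<notin> b \<Longrightarrow> x \<in> A \<Longrightarrow> y \<in> X - A \<Longrightarrow>
       \<phi> (insert y (A - {x})) \<ge> (1 - L) * \<phi> A"
begin

abbreviation "N \<equiv> real (card (slice X k))"
abbreviation "M \<equiv> real (card X)"

text \<open>High levels are measured by the density itself and low levels
  (\<open>lower_mass\<close>) by the uniform measure. On its own side of 1 each of these is the
  larger of the two masses, so it controls both.\<close>

definition upper_mass :: "real \<Rightarrow> real" where
  "upper_mass a = (\<Sum>A\<in>{A \<in> slice X k. \<phi> A \<ge> a}. (\<phi> A)\<^sup>2) / N"

definition lower_mass :: "real \<Rightarrow> real" where
  "lower_mass c = real (card {A \<in> slice X k. \<phi> A \<le> c}) / N"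

lemma N_pos: "N > 0"
  using fin ne by (simp add: card_gt_0_iff)

lemma bad_sum: "(\<Sum>A\<in>slice X k. if A \<in> b then (\<phi> A)\<^sup>2 else 0) \<le> \<eta> * N"
  using bad fin by (simp add: sum.inter_restrict)

text \<open>By Cauchy--Schwarz on the support, the squared mean accounts for at most half of the
  second moment when \<open>H\<close> vanishes on half of the slice.\<close>

lemma sum_sq_le_of_support:
  assumes S: "real (card {A \<in> slice X k. H A \<noteq> 0}) \<le> N / 2"
  shows "(\<Sum>A\<in>slice X k. (H A)\<^sup>2) \<le> 2 * sum_sq_dev (slice X k) H"
proof -
  let ?S = "{A \<in> slice X k. H A \<noteq> 0}"
  have "(\<Sum>A\<in>slice X k. H A) = (\<Sum>A\<in>?S. H A)"
    using fin by (intro sum.mono_neutral_right) auto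
  then have "(\<Sum>A\<in>slice X k. H A)\<^sup>2 \<le> (\<Sum>A\<in>?S. (H A)\<^sup>2) * real (card ?S)"
    using sum_squared_le_sum_of_squares[of H ?S] by simp
  also have "(\<Sum>A\<in>?S. (H A)\<^sup>2) = (\<Sum>A\<in>slice X k. (H A)\<^sup>2)"
    using fin by (intro sum.mono_neutral_left) auto
  also have "\<dots> * real (card ?S) \<le> \<dots> * (N / 2)"
    by (intro mult_left_mono S sum_nonneg) auto
  finally have "(\<Sum>A\<in>slice X k. H A)\<^sup>2 / N \<le> (\<Sum>A\<in>slice X k. (H A)\<^sup>2) / 2"
    using N_pos by (simp add: field_simps)
  moreover have "x \<le> 2 * (x - y)" if "y \<le> x / 2" for x y :: real using that by simp
  ultimately show ?thesis unfolding sum_sq_dev_def by blast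
qed

text \<open>The truncation max 0 (\<phi> - a) vanishes on half of the slice, so its second moment is
  bounded by its energy. A swap contributes only if its larger end lies above level
  \<open>a\<close>, hence the factor \<open>upper_mass a\<close>. Above level a' the truncation is
  at least \<phi> * (a' - a) / 2, because a' is at most 2. The constant is 32 = 4 * 2 * 4.\<close>

lemma upper_step:
  assumes a: "1 \<le> a" "a < a'" "a' \<le> 2"
    and half: "real (card {A \<in> slice X k. \<phi> A \<ge> a}) \<le> N / 2"
  shows "upper_mass a' \<le> 32 * M / (a' - a)\<^sup>2 * (L\<^sup>2 * upper_mass a + \<eta>)"
proof -
  define H where "H A = max 0 (\<phi> A - a)" for A
  define u where "u A = (if A \<in> b then (\<phi> A)\<^sup>2 else 0) + L\<^sup>2 * (if \<phi> A \<ge> a then (\<phi> A)\<^sup>2 else 0)" for A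
  have u0: "u A \<ge> 0" for A by (simp add: u_def)
  have dev: "sum_sq_dev (slice X k) H \<le> 4 * M * (\<Sum>A\<in>slice X k. u A + 0)"
  proof (rule sum_sq_dev_slice_le[OF fin card_pos u0, where \<phi> = \<phi>])
    fix A x y assume *: "A \<in> slice X k" "x \<in> A" "y \<in> X - A" "\<phi> (insert y (A - {x})) \<le> \<phi> A"
    let ?A' = "insert y (A - {x})"
    show "(H A - H ?A')\<^sup>2 \<le> u A + 0"
    proof (cases "\<phi> A \<ge> a")
      case False
      then show ?thesis using * u0[of A] by (simp add: H_def)
    next
      case True
      have d: "0 \<le> H A - H ?A'" "H A - H ?A' \<le> \<phi> A - \<phi> ?A'"
        using * by (auto simp: H_def max_def)
      show ?thesis
      proof (cases "A \<in> b")
        case True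
        have "(H A - H ?A')\<^sup>2 \<le> (\<phi> A)\<^sup>2"
          using d nonneg[of ?A'] by (intro power_mono) auto
        then show ?thesis using True by (simp add: u_def add_increasing2)
      next
        case False
        have "\<phi> A - \<phi> ?A' \<le> L * \<phi> A"
          using lower[OF *(1) False *(2,3)] by (simp add: algebra_simps)
        then have "(H A - H ?A')\<^sup>2 \<le> (L * \<phi> A)\<^sup>2" using d by (intro power_mono) auto
        then show ?thesis using True False by (simp add: u_def power_mult_distrib)
      qed
    qed
  qed auto
  have "(\<Sum>A\<in>slice X k. u A + 0) \<le> N * (L\<^sup>2 * upper_mass a + \<eta>)"
  proof -
    have "(\<Sum>A\<in>slice X k. if \<phi> A \<ge> a then (\<phi> A)\<^sup>2 else 0) = N * upper_mass a"
      using fin N_pos by (simp add: upper_mass_def sum.inter_filter)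
    then show ?thesis
      using bad_sum by (simp add: u_def sum.distrib sum_distrib_left[symmetric] algebra_simps)
  qed
  then have "sum_sq_dev (slice X k) H \<le> 4 * M * (N * (L\<^sup>2 * upper_mass a + \<eta>))"
    using dev mult_left_mono[of _ _ "4 * M"] by fastforce
  moreover have "(\<Sum>A\<in>slice X k. (H A)\<^sup>2) \<le> 2 * sum_sq_dev (slice X k) H"
  proof (rule sum_sq_le_of_support)
    have "card {A \<in> slice X k. H A \<noteq> 0} \<le> card {A \<in> slice X k. \<phi> A \<ge> a}"
      using fin by (intro card_mono) (auto simp: H_def)
    then show "real (card {A \<in> slice X k. H A \<noteq> 0}) \<le> N / 2" using half by linarith
  qed
  ultimately have H2: "(\<Sum>A\<in>slice X k. (H A)\<^sup>2) \<le> N * (8 * M * (L\<^sup>2 * upper_mass a + \<eta>))"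
    by (simp add: algebra_simps)
  have "N * upper_mass a' = (\<Sum>A\<in>{A \<in> slice X k. \<phi> A \<ge> a'}. (\<phi> A)\<^sup>2)"
    using N_pos by (simp add: upper_mass_def)
  also have "\<dots> \<le> (\<Sum>A\<in>{A \<in> slice X k. \<phi> A \<ge> a'}. 4 / (a' - a)\<^sup>2 * (H A)\<^sup>2)"
  proof (rule sum_mono, clarsimp)
    fix A assume A: "a' \<le> \<phi> A"
    have "\<phi> A * (a' - a) \<le> a' * (\<phi> A - a)" using A a by (simp add: algebra_simps)
    also have "\<dots> \<le> 2 * (\<phi> A - a)" using A a by (intro mult_right_mono) auto
    also have "\<dots> = 2 * H A" using A a by (simp add: H_def)
    finally have "(\<phi> A * (a' - a))\<^sup>2 \<le> (2 * H A)\<^sup>2" using nonneg a by (intro power_mono) auto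
    then show "(\<phi> A)\<^sup>2 \<le> 4 * (H A)\<^sup>2 / (a' - a)\<^sup>2"
      using a unfolding power_mult_distrib by (simp add: pos_le_divide_eq)
  qed
  also have "\<dots> \<le> (\<Sum>A\<in>slice X k. 4 / (a' - a)\<^sup>2 * (H A)\<^sup>2)"
    using fin by (intro sum_mono2) auto
  also have "\<dots> = 4 / (a' - a)\<^sup>2 * (\<Sum>A\<in>slice X k. (H A)\<^sup>2)" by (simp add: sum_distrib_left)
  also have "\<dots> \<le> 4 / (a' - a)\<^sup>2 * (N * (8 * M * (L\<^sup>2 * upper_mass a + \<eta>)))"
    by (intro mult_left_mono H2) auto
  also have "\<dots> = N * (32 * M / (a' - a)\<^sup>2 * (L\<^sup>2 * upper_mass a + \<eta>))" by simp
  finally show ?thesis using N_pos by (rule mult_left_le_imp_le)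
qed

text \<open>The mirror image of \<open>upper_step\<close> with max 0 (c - \<phi>). Here a good swap
  is charged to its lower end, by L^2 per set, so that sets below level \<open>c\<close> are counted
  and not weighted by the density.\<close>

lemma lower_step:
  assumes c: "c' < c" "c \<le> 1"
    and half: "real (card {A \<in> slice X k. \<phi> A \<le> c}) \<le> N / 2"
  shows "lower_mass c' \<le> 8 * M / (c - c')\<^sup>2 * (L\<^sup>2 * lower_mass c + \<eta>)"
proof -
  define H where "H A = max 0 (c - \<phi> A)" for A
  define u where "u A = (if A \<in> b then (\<phi> A)\<^sup>2 else 0)" for A
  define v where "v A = L\<^sup>2 * (if \<phi> A \<le> c then 1 else 0)" for A
  have u0: "u A \<ge> 0" and v0: "v A \<ge> 0" for A by (simp_all add: u_def v_def)
  have dev: "sum_sq_dev (slice X k) H \<le> 4 * M * (\<Sum>A\<in>slice X k. u A + v A)"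
  proof (rule sum_sq_dev_slice_le[OF fin card_pos u0 v0, where \<phi> = \<phi>])
    fix A x y assume *: "A \<in> slice X k" "x \<in> A" "y \<in> X - A" "\<phi> (insert y (A - {x})) \<le> \<phi> A"
    let ?A' = "insert y (A - {x})"
    show "(H A - H ?A')\<^sup>2 \<le> u A + v ?A'"
    proof (cases "\<phi> ?A' \<le> c")
      case False
      then show ?thesis using * u0[of A] v0[of ?A'] by (simp add: H_def)
    next
      case True
      have d: "0 \<le> H ?A' - H A" "H ?A' - H A \<le> \<phi> A - \<phi> ?A'"
        using * by (auto simp: H_def max_def)
      show ?thesis
      proof (cases "A \<in> b")
        case True
        have "(H ?A' - H A)\<^sup>2 \<le> (\<phi> A)\<^sup>2"
          using d nonneg[of ?A'] by (intro power_mono) auto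
        then show ?thesis using True v0[of ?A'] by (simp add: u_def power2_commute)
      next
        case False
        have low: "\<phi> ?A' \<ge> (1 - L) * \<phi> A" by (rule lower[OF *(1) False *(2,3)])
        \<comment> \<open>If the swap starts above level \<open>c\<close>, only its part below
          \<open>c\<close> is seen by \<open>H\<close>, and the new value is still at least (1 - L)
          * c.\<close>
        have "H ?A' - H A \<le> L"
        proof (cases "\<phi> A \<le> c")
          case True
          have "L * \<phi> A \<le> L * 1" using L True c by (intro mult_left_mono) auto
          then show ?thesis using d low by (simp add: algebra_simps)
        next
          case False
          have "(1 - L) * c \<le> (1 - L) * \<phi> A" using L False by (intro mult_left_mono) auto
          then have "(1 - L) * c \<le> \<phi> ?A'" using low by linarith
          moreover have "L * c \<le> L * 1" using L c by (intro mult_left_mono) auto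
          ultimately show ?thesis using \<open>\<phi> ?A' \<le> c\<close> False L
            by (auto simp: H_def max_def algebra_simps)
        qed
        then have "(H ?A' - H A)\<^sup>2 \<le> L\<^sup>2" using d by (intro power_mono) auto
        then show ?thesis using True u0[of A] by (simp add: v_def power2_commute)
      qed
    qed
  qed
  have "(\<Sum>A\<in>slice X k. u A + v A) \<le> N * (L\<^sup>2 * lower_mass c + \<eta>)"
  proof -
    have "(\<Sum>A\<in>slice X k. if \<phi> A \<le> c then 1 else 0) = (\<Sum>A\<in>{A \<in> slice X k. \<phi> A \<le> c}. 1::real)"
      using fin by (simp only: sum.inter_filter finite_slice)
    also have "\<dots> = N * lower_mass c"
      using N_pos by (simp add: lower_mass_def)
    finally have "(\<Sum>A\<in>slice X k. v A) = L\<^sup>2 * (N * lower_mass c)"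
      by (simp add: v_def sum_distrib_left[symmetric])
    then show ?thesis
      using bad_sum by (simp add: u_def sum.distrib algebra_simps)
  qed
  then have "sum_sq_dev (slice X k) H \<le> 4 * M * (N * (L\<^sup>2 * lower_mass c + \<eta>))"
    using dev mult_left_mono[of _ _ "4 * M"] by fastforce
  moreover have "(\<Sum>A\<in>slice X k. (H A)\<^sup>2) \<le> 2 * sum_sq_dev (slice X k) H"
  proof (rule sum_sq_le_of_support)
    have "card {A \<in> slice X k. H A \<noteq> 0} \<le> card {A \<in> slice X k. \<phi> A \<le> c}"
      using fin by (intro card_mono) (auto simp: H_def max_def split: if_splits)
    then show "real (card {A \<in> slice X k. H A \<noteq> 0}) \<le> N / 2" using half by linarith
  qed
  ultimately have H2: "(\<Sum>A\<in>slice X k. (H A)\<^sup>2) \<le> N * (8 * M * (L\<^sup>2 * lower_mass c + \<eta>))"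
    by (simp add: algebra_simps)
  have "(c - c')\<^sup>2 * (N * lower_mass c') = (\<Sum>A\<in>{A \<in> slice X k. \<phi> A \<le> c'}. (c - c')\<^sup>2)"
    using N_pos by (simp add: lower_mass_def)
  also have "\<dots> \<le> (\<Sum>A\<in>{A \<in> slice X k. \<phi> A \<le> c'}. (H A)\<^sup>2)"
    using c by (intro sum_mono power_mono) (auto simp: H_def)
  also have "\<dots> \<le> (\<Sum>A\<in>slice X k. (H A)\<^sup>2)"
    using fin by (intro sum_mono2) auto
  finally have "(c - c')\<^sup>2 * (N * lower_mass c') \<le> N * (8 * M * (L\<^sup>2 * lower_mass c + \<eta>))"
    using H2 by linarith
  then have "N * ((c - c')\<^sup>2 * lower_mass c') \<le> N * (8 * M * (L\<^sup>2 * lower_mass c + \<eta>))"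
    by (simp add: mult_ac)
  then have "(c - c')\<^sup>2 * lower_mass c' \<le> 8 * M * (L\<^sup>2 * lower_mass c + \<eta>)"
    using N_pos by simp
  then show ?thesis using c by (simp add: field_simps)
qed

text \<open>This starts the iteration. Since the second moment of \<phi> is 1, its variance is 1 -
  \<mu>^2, so a small energy forces both \<mu> close to 1 and concentration around \<mu>. Chebyshev
  with deviation \<Gamma> / 2 then leaves at most half of the slice on either side.\<close>

lemma half_mass:
  assumes \<Gamma>: "0 < \<Gamma>" "\<Gamma> \<le> 1/4" and small: "4 * M * (L\<^sup>2 + \<eta>) \<le> \<Gamma>\<^sup>2 / 8"
  shows "real (card {A \<in> slice X k. \<phi> A \<ge> 1 + \<Gamma>}) \<le> N / 2"
    and "real (card {A \<in> slice X k. \<phi> A \<le> 1 - \<Gamma>}) \<le> N / 2"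
proof -
  define u where "u A = (if A \<in> b then (\<phi> A)\<^sup>2 else 0) + L\<^sup>2 * (\<phi> A)\<^sup>2" for A
  have u0: "u A \<ge> 0" for A by (simp add: u_def)
  have dev: "sum_sq_dev (slice X k) \<phi> \<le> 4 * M * (\<Sum>A\<in>slice X k. u A + 0)"
  proof (rule sum_sq_dev_slice_le[OF fin card_pos u0, where \<phi> = \<phi>])
    fix A x y assume *: "A \<in> slice X k" "x \<in> A" "y \<in> X - A" "\<phi> (insert y (A - {x})) \<le> \<phi> A"
    let ?A' = "insert y (A - {x})"
    show "(\<phi> A - \<phi> ?A')\<^sup>2 \<le> u A + 0"
    proof (cases "A \<in> b")
      case True
      have "(\<phi> A - \<phi> ?A')\<^sup>2 \<le> (\<phi> A)\<^sup>2"
        using * nonneg[of ?A'] by (intro power_mono) auto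
      then show ?thesis using True by (simp add: u_def add_increasing2)
    next
      case False
      have "\<phi> A - \<phi> ?A' \<le> L * \<phi> A"
        using lower[OF *(1) False *(2,3)] by (simp add: algebra_simps)
      then have "(\<phi> A - \<phi> ?A')\<^sup>2 \<le> (L * \<phi> A)\<^sup>2" using * by (intro power_mono) auto
      then show ?thesis using False by (simp add: u_def power_mult_distrib)
    qed
  qed auto
  have "(\<Sum>A\<in>slice X k. u A + 0) \<le> N * (L\<^sup>2 + \<eta>)"
    using bad_sum norm by (simp add: u_def sum.distrib sum_distrib_left[symmetric] algebra_simps)
  then have "sum_sq_dev (slice X k) \<phi> \<le> 4 * M * (N * (L\<^sup>2 + \<eta>))"
    using dev mult_left_mono[of _ _ "4 * M"] by fastforce
  also have "\<dots> = N * (4 * M * (L\<^sup>2 + \<eta>))" by simp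
  also have "\<dots> \<le> N * (\<Gamma>\<^sup>2 / 8)" by (intro mult_left_mono small) auto
  finally have dev: "sum_sq_dev (slice X k) \<phi> \<le> N * (\<Gamma>\<^sup>2 / 8)" .
  define \<mu> where "\<mu> = (\<Sum>A\<in>slice X k. \<phi> A) / N"
  have sum_mu: "(\<Sum>A\<in>slice X k. \<phi> A) = N * \<mu>" using N_pos by (simp add: \<mu>_def)
  have dev_eq: "sum_sq_dev (slice X k) \<phi> = N * (1 - \<mu>\<^sup>2)"
    using N_pos norm by (simp add: sum_sq_dev_def sum_mu power2_eq_square algebra_simps)
  have mu0: "\<mu> \<ge> 0" unfolding \<mu>_def by (intro divide_nonneg_nonneg sum_nonneg nonneg) auto
  have mu2: "\<mu>\<^sup>2 \<ge> 1 - \<Gamma>\<^sup>2 / 8" using dev N_pos unfolding dev_eq by simp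
  have dev_eq': "(\<Sum>A\<in>slice X k. (\<phi> A - \<mu>)\<^sup>2) = sum_sq_dev (slice X k) \<phi>"
  proof -
    have "(\<Sum>A\<in>slice X k. (\<phi> A - \<mu>)\<^sup>2) = (\<Sum>A\<in>slice X k. (\<phi> A)\<^sup>2) - 2 * \<mu> * (\<Sum>A\<in>slice X k. \<phi> A) + N * \<mu>\<^sup>2"
      by (simp add: power2_diff sum.distrib sum_subtractf sum_distrib_left mult_ac)
    also have "\<dots> = N * (1 - \<mu>\<^sup>2)" unfolding norm sum_mu by (simp add: power2_eq_square algebra_simps)
    finally show ?thesis by (simp add: dev_eq)
  qed
  have mu1: "\<mu> \<le> 1"
  proof (rule ccontr)
    assume "\<not> \<mu> \<le> 1"
    then have "1 < \<mu>\<^sup>2" by (simp add: one_less_power)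
    then have "N * (1 - \<mu>\<^sup>2) < 0" using N_pos by (simp add: mult_pos_neg)
    moreover have "N * (1 - \<mu>\<^sup>2) \<ge> 0" unfolding dev_eq[symmetric] dev_eq'[symmetric] by (simp add: sum_nonneg)
    ultimately show False by simp
  qed
  have muL: "\<mu> \<ge> 1 - \<Gamma> / 2"
  proof -
    have "\<mu>\<^sup>2 \<le> \<mu>" using mu0 mu1 by (simp add: power2_eq_square mult_left_le)
    moreover have "\<Gamma>\<^sup>2 \<le> \<Gamma>" using \<Gamma> by (simp add: power2_eq_square mult_left_le)
    ultimately show ?thesis using mu2 \<Gamma> by linarith
  qed
  have cheb: "real (card S) \<le> N / 2" if S: "S \<subseteq> slice X k" "\<And>A. A \<in> S \<Longrightarrow> \<bar>\<phi> A - \<mu>\<bar> \<ge> \<Gamma> / 2" for S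
  proof -
    have "real (card S) * (\<Gamma> / 2)\<^sup>2 = (\<Sum>A\<in>S. (\<Gamma> / 2)\<^sup>2)" by simp
    also have "\<dots> \<le> (\<Sum>A\<in>S. (\<phi> A - \<mu>)\<^sup>2)"
    proof (rule sum_mono)
      fix A assume "A \<in> S"
      from power_mono[OF S(2)[OF this], of 2] \<Gamma> show "(\<Gamma> / 2)\<^sup>2 \<le> (\<phi> A - \<mu>)\<^sup>2" by simp
    qed
    also have "\<dots> \<le> (\<Sum>A\<in>slice X k. (\<phi> A - \<mu>)\<^sup>2)"
      using fin S by (intro sum_mono2) auto
    also have "\<dots> \<le> N * (\<Gamma>\<^sup>2 / 8)" using dev by (simp add: dev_eq')
    finally show ?thesis using \<Gamma> by (simp add: power2_eq_square)
  qed
  show "real (card {A \<in> slice X k. \<phi> A \<ge> 1 + \<Gamma>}) \<le> N / 2"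
    using mu1 \<Gamma> by (intro cheb) auto
  show "real (card {A \<in> slice X k. \<phi> A \<le> 1 - \<Gamma>}) \<le> N / 2"
    using muL \<Gamma> by (intro cheb) auto
qed

text \<open>The interval from 1 + \<Gamma> to 1 + 2 * \<Gamma> is cut into \<open>I\<close> levels
  of width \<Gamma> / I, and likewise below 1. Condition \<open>c1\<close> makes each level halve
  the mass, and \<open>c2\<close> bounds by \<rho> what the bad set adds at each level.\<close>

lemma concentration:
  assumes \<Gamma>: "0 < \<Gamma>" "\<Gamma> \<le> 1/4" and I: "I > 0" and \<rho>: "0 \<le> \<rho>" "\<rho> \<le> 1/2" and \<eta>: "0 \<le> \<eta>"
    and c1: "32 * M * L\<^sup>2 * (real I)\<^sup>2 \<le> \<Gamma>\<^sup>2 / 2" and c2: "32 * M * \<eta> * (real I)\<^sup>2 \<le> \<rho> * \<Gamma>\<^sup>2"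
  shows "upper_mass (1 + 2 * \<Gamma>) \<le> (1/2) ^ I + 2 * \<rho>"
    and "lower_mass (1 - 2 * \<Gamma>) \<le> (1/2) ^ I + 2 * \<rho>"
proof -
  define \<gamma> where "\<gamma> = \<Gamma> / real I"
  have \<gamma>: "\<gamma> > 0" using \<Gamma> I by (simp add: \<gamma>_def)
  have I1: "(real I)\<^sup>2 \<ge> 1" using I by simp
  have M0: "M \<ge> 0" by simp
  have "32 * M * L\<^sup>2 * 1 \<le> 32 * M * L\<^sup>2 * (real I)\<^sup>2" using I1 by (intro mult_left_mono) auto
  moreover have "32 * M * \<eta> * 1 \<le> 32 * M * \<eta> * (real I)\<^sup>2" using I1 \<eta> by (intro mult_left_mono) auto
  moreover have "\<rho> * \<Gamma>\<^sup>2 \<le> 1/2 * \<Gamma>\<^sup>2" using \<rho> by (intro mult_right_mono) auto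
  ultimately have small: "4 * M * (L\<^sup>2 + \<eta>) \<le> \<Gamma>\<^sup>2 / 8" using c1 c2 by (simp add: algebra_simps)
  note half = half_mass[OF \<Gamma> small]
  have d1: "32 * M / \<gamma>\<^sup>2 * L\<^sup>2 \<le> 1/2" and d2: "32 * M / \<gamma>\<^sup>2 * \<eta> \<le> \<rho>"
    using c1 c2 I \<Gamma> by (simp_all add: \<gamma>_def power_divide field_simps)
  have Ii: "real i * \<gamma> \<le> \<Gamma>" if "i \<le> I" for i
    using that I \<Gamma> by (simp add: \<gamma>_def field_simps)
  have upper0: "upper_mass a \<ge> 0" and lower0: "lower_mass a \<ge> 0" for a
    by (auto simp: upper_mass_def lower_mass_def intro!: divide_nonneg_nonneg sum_nonneg)
  define W where "W i = upper_mass (1 + \<Gamma> + real i * \<gamma>)" for i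
  have "W I \<le> (1/2) ^ I + 2 * \<rho> \<or> \<rho> < 0"
  proof (rule half_iterate[where I = I])
    have "(\<Sum>A\<in>{A \<in> slice X k. \<phi> A \<ge> 1 + \<Gamma>}. (\<phi> A)\<^sup>2) \<le> N"
      unfolding norm[symmetric] using fin by (intro sum_mono2) auto
    then show "W 0 \<le> 1" using N_pos by (simp add: W_def upper_mass_def)
  next
    fix i assume i: "i < I"
    let ?a = "1 + \<Gamma> + real i * \<gamma>" and ?a' = "1 + \<Gamma> + real (Suc i) * \<gamma>"
    have "W (Suc i) \<le> 32 * M / (?a' - ?a)\<^sup>2 * (L\<^sup>2 * upper_mass ?a + \<eta>)"
      unfolding W_def
    proof (rule upper_step)
      show "1 \<le> ?a" "?a < ?a'" using \<Gamma> \<gamma> by (auto simp: algebra_simps)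
      show "?a' \<le> 2" using Ii[of "Suc i"] i \<Gamma> by auto
      have "card {A \<in> slice X k. ?a \<le> \<phi> A} \<le> card {A \<in> slice X k. 1 + \<Gamma> \<le> \<phi> A}"
      proof (rule card_mono)
        have "0 \<le> real i * \<gamma>" using \<gamma> by simp
        then show "{A \<in> slice X k. ?a \<le> \<phi> A} \<subseteq> {A \<in> slice X k. 1 + \<Gamma> \<le> \<phi> A}" by auto
      qed (use fin in auto)
      then show "real (card {A \<in> slice X k. ?a \<le> \<phi> A}) \<le> N / 2" using half(1) by linarith
    qed
    also have "?a' - ?a = \<gamma>" by (simp add: algebra_simps)
    also have "32 * M / \<gamma>\<^sup>2 * (L\<^sup>2 * upper_mass ?a + \<eta>) =
        32 * M / \<gamma>\<^sup>2 * L\<^sup>2 * upper_mass ?a + 32 * M / \<gamma>\<^sup>2 * \<eta>" by (simp add: distrib_left)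
    also have "\<dots> \<le> 1/2 * upper_mass ?a + \<rho>"
      by (intro add_mono mult_right_mono d1 d2 upper0)
    finally show "W (Suc i) \<le> W i / 2 + \<rho>" by (simp add: W_def)
  qed simp
  then show "upper_mass (1 + 2 * \<Gamma>) \<le> (1/2) ^ I + 2 * \<rho>"
    using \<rho> I by (simp add: W_def \<gamma>_def algebra_simps)
  define V where "V i = lower_mass (1 - \<Gamma> - real i * \<gamma>)" for i
  have "V I \<le> (1/2) ^ I + 2 * \<rho> \<or> \<rho> < 0"
  proof (rule half_iterate[where I = I])
    have "card {A \<in> slice X k. \<phi> A \<le> 1 - \<Gamma>} \<le> card (slice X k)"
      using fin by (intro card_mono) auto
    then show "V 0 \<le> 1" using N_pos by (simp add: V_def lower_mass_def)
  next
    fix i assume i: "i < I"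
    let ?c = "1 - \<Gamma> - real i * \<gamma>" and ?c' = "1 - \<Gamma> - real (Suc i) * \<gamma>"
    have "V (Suc i) \<le> 8 * M / (?c - ?c')\<^sup>2 * (L\<^sup>2 * lower_mass ?c + \<eta>)"
      unfolding V_def
    proof (rule lower_step)
      show "?c' < ?c" using \<gamma> by (auto simp: algebra_simps)
      have i\<gamma>: "0 \<le> real i * \<gamma>" using \<gamma> by simp
      then show "?c \<le> 1" using \<Gamma> by linarith
      have "card {A \<in> slice X k. \<phi> A \<le> ?c} \<le> card {A \<in> slice X k. \<phi> A \<le> 1 - \<Gamma>}"
        using i\<gamma> fin by (intro card_mono) auto
      then show "real (card {A \<in> slice X k. \<phi> A \<le> ?c}) \<le> N / 2" using half(2) by linarith
    qed
    also have "?c - ?c' = \<gamma>" by (simp add: algebra_simps)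
    also have "8 * M / \<gamma>\<^sup>2 * (L\<^sup>2 * lower_mass ?c + \<eta>) \<le> 32 * M / \<gamma>\<^sup>2 * (L\<^sup>2 * lower_mass ?c + \<eta>)"
      using \<eta> lower0 by (intro mult_right_mono divide_right_mono) auto
    also have "\<dots> = 32 * M / \<gamma>\<^sup>2 * L\<^sup>2 * lower_mass ?c + 32 * M / \<gamma>\<^sup>2 * \<eta>" by (simp add: distrib_left)
    also have "\<dots> \<le> 1/2 * lower_mass ?c + \<rho>"
      by (intro add_mono mult_right_mono d1 d2 lower0)
    finally show "V (Suc i) \<le> V i / 2 + \<rho>" by (simp add: V_def)
  qed simp
  then show "lower_mass (1 - 2 * \<Gamma>) \<le> (1/2) ^ I + 2 * \<rho>"
    using \<rho> I by (simp add: V_def \<gamma>_def algebra_simps)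
qed

end

section \<open>Hoeffding's inequality on finite products\<close>

text \<open>For a centred variable the linear term averages to zero, which leaves a sub-Gaussian
  bound on the moment generating function.\<close>

lemma exp_le_add_exp_square: "exp x \<le> x + exp (x\<^sup>2)" for x :: real
proof -
  have sq: "1 + x\<^sup>2 \<le> exp (x\<^sup>2)" by (rule exp_ge_add_one_self)
  consider "x \<ge> 1" | "0 \<le> x" "x \<le> 1" | "x \<le> 0" by linarith
  then show ?thesis
  proof cases
    case 1
    then have "x \<le> x\<^sup>2" by (simp add: power2_eq_square mult_le_cancel_left1)
    then have "exp x \<le> exp (x\<^sup>2)" by simp
    then show ?thesis using 1 by linarith
  next
    case 2
    then show ?thesis using exp_bound[of x] sq by linarith
  next
    case 3
    have "exp x \<le> 1 + x + x\<^sup>2"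
    proof -
      have "1 \<le> (1 + x + x\<^sup>2) * (1 - x + x\<^sup>2 / 2)"
      proof -
        have "(1 + x + x\<^sup>2) * (1 - x + x\<^sup>2 / 2) = 1 + x\<^sup>2 / 2 - x ^ 3 / 2 + x ^ 4 / 2"
          by (simp add: power2_eq_square power3_eq_cube power4_eq_xxxx field_simps)
        moreover have "x ^ 3 \<le> 0" using 3 by (simp add: power3_eq_cube mult_nonneg_nonpos mult_nonneg_nonpos2 mult_nonpos_nonpos)
        moreover have "x\<^sup>2 \<ge> 0" "x ^ 4 \<ge> 0" by simp_all
        ultimately show ?thesis by linarith
      qed
      also have "\<dots> \<le> (1 + x + x\<^sup>2) * exp (- x)"
      proof (rule mult_left_mono)
        show "1 - x + x\<^sup>2 / 2 \<le> exp (- x)" using exp_lower_Taylor_quadratic[of "- x"] 3 by simp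
        have "1 + x + x\<^sup>2 = (x + 1/2)\<^sup>2 + 3/4" by (simp add: power2_eq_square algebra_simps)
        then show "0 \<le> 1 + x + x\<^sup>2" by simp
      qed
      finally show ?thesis by (simp add: exp_minus field_simps)
    qed
    then show ?thesis using sq by linarith
  qed
qed

definition avg :: "'a set \<Rightarrow> ('a \<Rightarrow> real) \<Rightarrow> real" where
  "avg S f = (\<Sum>x\<in>S. f x) / real (card S)"

lemma avg_mgf_le:
  assumes "finite S" "S \<noteq> {}" "avg S y = 0" and y: "\<And>x. x \<in> S \<Longrightarrow> \<bar>y x\<bar> \<le> c"
  shows "(\<Sum>x\<in>S. exp (\<theta> * y x)) \<le> real (card S) * exp (\<theta>\<^sup>2 * c\<^sup>2)"
proof -
  have "(\<Sum>x\<in>S. exp (\<theta> * y x)) \<le> (\<Sum>x\<in>S. \<theta> * y x + exp (\<theta>\<^sup>2 * c\<^sup>2))"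
  proof (rule sum_mono)
    fix x assume "x \<in> S"
    have "(\<theta> * y x)\<^sup>2 \<le> \<theta>\<^sup>2 * c\<^sup>2"
      unfolding power_mult_distrib using power_mono[OF y[OF \<open>x \<in> S\<close>], of 2] by (intro mult_left_mono) auto
    then have "exp ((\<theta> * y x)\<^sup>2) \<le> exp (\<theta>\<^sup>2 * c\<^sup>2)" by simp
    with exp_le_add_exp_square[of "\<theta> * y x"] show "exp (\<theta> * y x) \<le> \<theta> * y x + exp (\<theta>\<^sup>2 * c\<^sup>2)" by linarith
  qed
  also have "\<dots> = real (card S) * exp (\<theta>\<^sup>2 * c\<^sup>2)"
    using assms by (simp add: sum.distrib sum_distrib_left[symmetric] avg_def)
  finally show ?thesis .
qed

lemma hoeffding_PiE_one_sided:
  fixes g :: "'i \<Rightarrow> 'b \<Rightarrow> real"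
  assumes J: "finite J" "J \<noteq> {}" and F: "\<And>j. j \<in> J \<Longrightarrow> finite (F j) \<and> F j \<noteq> {}"
    and zero: "\<And>j. j \<in> J \<Longrightarrow> avg (F j) (g j) = 0"
    and bd: "\<And>j x. j \<in> J \<Longrightarrow> x \<in> F j \<Longrightarrow> \<bar>g j x\<bar> \<le> c" and c: "c > 0" and \<tau>: "\<tau> > 0"
  shows "real (card {\<omega> \<in> PiE J F. (\<Sum>j\<in>J. g j (\<omega> j)) \<ge> \<tau>}) \<le>
     exp (- (\<tau>\<^sup>2 / (4 * real (card J) * c\<^sup>2))) * real (card (PiE J F))"
proof -
  define n where "n = real (card J)"
  have n: "n > 0" using J by (simp add: n_def card_gt_0_iff)
  \<comment> \<open>This value minimises the exponent n * \<theta>^2 * c^2 - \<theta> *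
    \<tau>.\<close>
  define \<theta> where "\<theta> = \<tau> / (2 * n * c\<^sup>2)"
  have \<theta>: "\<theta> > 0" using n c \<tau> by (simp add: \<theta>_def)
  have finP: "finite (PiE J F)" using J F by (intro finite_PiE) auto
  let ?B = "{\<omega> \<in> PiE J F. (\<Sum>j\<in>J. g j (\<omega> j)) \<ge> \<tau>}"
  have "real (card ?B) * exp (\<theta> * \<tau>) = (\<Sum>\<omega>\<in>?B. exp (\<theta> * \<tau>))" by simp
  also have "\<dots> \<le> (\<Sum>\<omega>\<in>?B. exp (\<theta> * (\<Sum>j\<in>J. g j (\<omega> j))))"
    using \<theta> by (intro sum_mono) auto
  also have "\<dots> \<le> (\<Sum>\<omega>\<in>PiE J F. exp (\<theta> * (\<Sum>j\<in>J. g j (\<omega> j))))"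
    using finP by (intro sum_mono2) auto
  also have "\<dots> = (\<Sum>\<omega>\<in>PiE J F. \<Prod>j\<in>J. exp (\<theta> * g j (\<omega> j)))"
    using J by (simp add: exp_sum sum_distrib_left)
  also have "\<dots> = (\<Prod>j\<in>J. \<Sum>x\<in>F j. exp (\<theta> * g j x))"
    using J F by (subst prod_sum_PiE) auto
  also have "\<dots> \<le> (\<Prod>j\<in>J. real (card (F j)) * exp (\<theta>\<^sup>2 * c\<^sup>2))"
    using F zero bd by (intro prod_mono conjI sum_nonneg avg_mgf_le) auto
  also have "\<dots> = real (card (PiE J F)) * exp (n * (\<theta>\<^sup>2 * c\<^sup>2))"
    using J by (simp add: prod.distrib card_PiE n_def exp_of_nat_mult)
  finally have "real (card ?B) \<le> exp (n * (\<theta>\<^sup>2 * c\<^sup>2)) * exp (- (\<theta> * \<tau>)) * real (card (PiE J F))"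
    by (simp add: exp_minus field_simps)
  also have "exp (n * (\<theta>\<^sup>2 * c\<^sup>2)) * exp (- (\<theta> * \<tau>)) = exp (- (\<tau>\<^sup>2 / (4 * n * c\<^sup>2)))"
    unfolding exp_add[symmetric] using n c
    by (simp add: \<theta>_def power_divide power_mult_distrib power2_eq_square field_simps)
  finally show ?thesis by (simp add: n_def)
qed

text \<open>Centring each factor doubles its bound to 2 * c, which turns the 4 of the one-sided
  version into 16.\<close>

lemma hoeffding_PiE:
  fixes g :: "'i \<Rightarrow> 'b \<Rightarrow> real"
  assumes J: "finite J" "J \<noteq> {}" and F: "\<And>j. j \<in> J \<Longrightarrow> finite (F j) \<and> F j \<noteq> {}"
    and bd: "\<And>j x. j \<in> J \<Longrightarrow> x \<in> F j \<Longrightarrow> \<bar>g j x\<bar> \<le> c" and c: "c > 0" and \<tau>: "\<tau> > 0"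
  shows "real (card {\<omega> \<in> PiE J F. \<bar>(\<Sum>j\<in>J. g j (\<omega> j)) - (\<Sum>j\<in>J. avg (F j) (g j))\<bar> \<ge> \<tau>}) \<le>
     2 * exp (- (\<tau>\<^sup>2 / (16 * real (card J) * c\<^sup>2))) * real (card (PiE J F))"
proof -
  let ?m = "\<lambda>j. avg (F j) (g j)"
  have finP: "finite (PiE J F)" using J F by (intro finite_PiE) auto
  have m: "\<bar>?m j\<bar> \<le> c" if j: "j \<in> J" for j
  proof -
    have pos: "real (card (F j)) > 0" using F[OF j] by (simp add: card_gt_0_iff)
    have "\<bar>\<Sum>x\<in>F j. g j x\<bar> \<le> (\<Sum>x\<in>F j. \<bar>g j x\<bar>)" by (rule sum_abs)
    also have "\<dots> \<le> (\<Sum>x\<in>F j. c)" using bd j by (intro sum_mono) auto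
    finally show ?thesis using pos by (simp add: avg_def field_simps)
  qed
  have zero: "avg (F j) (\<lambda>x. g j x - ?m j) = 0" "avg (F j) (\<lambda>x. - (g j x - ?m j)) = 0" if j: "j \<in> J" for j
    using F[OF j] by (simp_all add: avg_def sum_subtractf sum_negf card_gt_0_iff)
  have bd': "\<bar>g j x - ?m j\<bar> \<le> 2 * c" "\<bar>- (g j x - ?m j)\<bar> \<le> 2 * c" if "j \<in> J" "x \<in> F j" for j x
    using bd[OF that] m[OF that(1)] by linarith+
  let ?B1 = "{\<omega> \<in> PiE J F. (\<Sum>j\<in>J. g j (\<omega> j) - ?m j) \<ge> \<tau>}"
  let ?B2 = "{\<omega> \<in> PiE J F. (\<Sum>j\<in>J. - (g j (\<omega> j) - ?m j)) \<ge> \<tau>}"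
  have "{\<omega> \<in> PiE J F. \<bar>(\<Sum>j\<in>J. g j (\<omega> j)) - (\<Sum>j\<in>J. ?m j)\<bar> \<ge> \<tau>} \<subseteq> ?B1 \<union> ?B2"
    by (auto simp: sum_subtractf sum_negf)
  then have "card {\<omega> \<in> PiE J F. \<bar>(\<Sum>j\<in>J. g j (\<omega> j)) - (\<Sum>j\<in>J. ?m j)\<bar> \<ge> \<tau>} \<le> card (?B1 \<union> ?B2)"
    using finP by (intro card_mono) auto
  also have "\<dots> \<le> card ?B1 + card ?B2" by (rule card_Un_le)
  finally have "real (card {\<omega> \<in> PiE J F. \<bar>(\<Sum>j\<in>J. g j (\<omega> j)) - (\<Sum>j\<in>J. ?m j)\<bar> \<ge> \<tau>}) \<le>
      real (card ?B1) + real (card ?B2)" by linarith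
  also have "\<dots> \<le> exp (- (\<tau>\<^sup>2 / (4 * real (card J) * (2 * c)\<^sup>2))) * real (card (PiE J F)) +
      exp (- (\<tau>\<^sup>2 / (4 * real (card J) * (2 * c)\<^sup>2))) * real (card (PiE J F))"
    using c by (intro add_mono hoeffding_PiE_one_sided J F zero bd' \<tau>) auto
  finally show ?thesis by (simp add: power_mult_distrib mult_ac)
qed

section \<open>Switchings\<close>

definition rowset :: "(nat \<times> nat) set \<Rightarrow> nat \<Rightarrow> nat set" where "rowset G i = {j. (i, j) \<in> G}"
definition colset :: "(nat \<times> nat) set \<Rightarrow> nat \<Rightarrow> nat set" where "colset G j = {i. (i, j) \<in> G}"

text \<open>\<open>X\<close> is the set of cells that may be used; rows are indexed by \<open>i < m\<close> and columns by \<open>j < n\<close>.\<close>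

definition col_graphs :: "(nat \<times> nat) set \<Rightarrow> nat \<Rightarrow> (nat \<Rightarrow> nat) \<Rightarrow> (nat \<times> nat) set set" where
  "col_graphs X n t = {G. G \<subseteq> X \<and> (\<forall>j<n. card (colset G j) = t j)}"

definition deg_class ::
    "(nat \<times> nat) set \<Rightarrow> nat \<Rightarrow> (nat \<Rightarrow> nat) \<Rightarrow> nat \<Rightarrow> (nat \<Rightarrow> nat) \<Rightarrow> (nat \<times> nat) set set" where
  "deg_class X n t m s = {G \<in> col_graphs X n t. \<forall>i<m. card (rowset G i) = s i}"

text \<open>These are exactly the columns in which an edge can be moved from row \<open>b\<close> to
  row \<open>a\<close>; columns whose cell in row \<open>a\<close> is forbidden do not
  count.\<close>

definition excl :: "(nat \<times> nat) set \<Rightarrow> (nat \<times> nat) set \<Rightarrow> nat \<Rightarrow> nat \<Rightarrow> nat set" where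
  "excl X G b a = {j. (b, j) \<in> G \<and> (a, j) \<in> X - G}"

definition discord :: "(nat \<times> nat) set \<Rightarrow> (nat \<times> nat) set \<Rightarrow> nat \<Rightarrow> nat \<Rightarrow> nat set" where
  "discord X G b c = {j. (b, j) \<in> X \<and> (c, j) \<in> X \<and> ((b, j) \<in> G) \<noteq> ((c, j) \<in> G)}"

lemma finite_rowset: "finite G \<Longrightarrow> finite (rowset G i)"
  unfolding rowset_def by (rule finite_subset[of _ "snd ` G"]) force+

lemma finite_colset: "finite G \<Longrightarrow> finite (colset G j)"
  unfolding colset_def by (rule finite_subset[of _ "fst ` G"]) force+

lemma finite_excl: "finite X \<Longrightarrow> finite (excl X G b a)"
  unfolding excl_def by (rule finite_subset[of _ "snd ` X"]) force+

lemma finite_discord: "finite X \<Longrightarrow> finite (discord X G b c)"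
  unfolding discord_def by (rule finite_subset[of _ "snd ` X"]) force+

lemma finite_col_graphs: "finite X \<Longrightarrow> finite (col_graphs X n t)"
  unfolding col_graphs_def by (rule finite_subset[of _ "Pow X"]) auto

lemma finite_deg_class: "finite X \<Longrightarrow> finite (deg_class X n t m s)"
  unfolding deg_class_def by (simp add: finite_col_graphs)

lemma card_eq_sum_colset:
  assumes "G \<subseteq> {..<m} \<times> {..<n}"
  shows "card G = (\<Sum>j<n. card (colset G j))"
proof -
  have fin: "finite G" using assms by (rule finite_subset) simp
  have "card G = card ((\<lambda>(i, j). (j, i)) ` G)" by (simp add: card_image inj_on_def split_beta prod_eq_iff)
  also have "(\<lambda>(i, j). (j, i)) ` G = (SIGMA j : {..<n}. colset G j)"
    using assms by (auto simp: colset_def image_iff)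
  also have "card \<dots> = (\<Sum>j<n. card (colset G j))"
    using finite_colset[OF fin] by (subst card_SigmaI) auto
  finally show ?thesis .
qed

lemma card_eq_sum_rowset:
  assumes "G \<subseteq> {..<m} \<times> {..<n}"
  shows "card G = (\<Sum>i<m. card (rowset G i))"
proof -
  have fin: "finite G" using assms by (rule finite_subset) simp
  have "(SIGMA i : {..<m}. rowset G i) = G" using assms by (auto simp: rowset_def)
  then have "card G = card (SIGMA i : {..<m}. rowset G i)" by simp
  also have "\<dots> = (\<Sum>i<m. card (rowset G i))"
    using finite_rowset[OF fin] by (subst card_SigmaI) auto
  finally show ?thesis .
qed

lemma discord_eq_excl:
  "G \<subseteq> X \<Longrightarrow> discord X G b c = excl X G b c \<union> excl X G c b" "excl X G b c \<inter> excl X G c b = {}"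
  by (auto simp: discord_def excl_def)

lemma card_discord:
  assumes "G \<subseteq> X" "finite X"
  shows "card (discord X G b c) = card (excl X G b c) + card (excl X G c b)"
  using assms by (simp add: discord_eq_excl(1) card_Un_disjoint finite_excl discord_eq_excl(2))

text \<open>A move adds precisely its own column to the set of possible reverse moves. This is the
  source of the + 1 in the denominators below.\<close>

lemma switch_mem:
  assumes X: "finite X" "X \<subseteq> {..<m} \<times> {..<n}" and ab: "a \<noteq> b" "a < m" "b < m"
    and G: "G \<in> deg_class X n t m s" and j: "j \<in> excl X G b a"
  shows "insert (a, j) (G - {(b, j)}) \<in> deg_class X n t m (s(a := s a + 1, b := s b - 1))"
    and "excl X (insert (a, j) (G - {(b, j)})) a b = insert j (excl X G a b)"
    and "j \<notin> excl X G a b"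
proof -
  let ?G = "insert (a, j) (G - {(b, j)})"
  have GX: "G \<subseteq> X" and cG: "\<And>j. j < n \<Longrightarrow> card (colset G j) = t j" and rG: "\<And>i. i < m \<Longrightarrow> card (rowset G i) = s i"
    using G by (auto simp: deg_class_def col_graphs_def)
  have finG: "finite G" using X GX by (rule_tac finite_subset)
  have jj: "(b, j) \<in> G" "(a, j) \<in> X" "(a, j) \<notin> G" using j by (auto simp: excl_def)
  have "card (colset ?G l) = card (colset G l)" for l
  proof (cases "l = j")
    case True
    have "colset ?G j = insert a (colset G j - {b})" "b \<in> colset G j" "a \<notin> colset G j"
      using ab jj by (auto simp: colset_def)
    then show ?thesis using finite_colset[OF finG, of j] ab True
      by (simp add: card_Suc_Diff1 del: card_Diff_insert)
  next
    case False
    then have "colset ?G l = colset G l" by (auto simp: colset_def)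
    then show ?thesis by simp
  qed
  moreover have "card (rowset ?G i) = (s(a := s a + 1, b := s b - 1)) i" if i: "i < m" for i
  proof -
    consider "i = a" | "i = b" | "i \<noteq> a" "i \<noteq> b" by blast
    then show ?thesis
    proof cases
      case 1
      have "rowset ?G a = insert j (rowset G a)" "j \<notin> rowset G a" using ab jj by (auto simp: rowset_def)
      then show ?thesis using finite_rowset[OF finG] rG[OF ab(2)] 1 ab by simp
    next
      case 2
      have "rowset ?G b = rowset G b - {j}" "j \<in> rowset G b" using ab jj by (auto simp: rowset_def)
      then show ?thesis using finite_rowset[OF finG] rG[OF ab(3)] 2 ab by simp
    next
      case 3
      then have "rowset ?G i = rowset G i" by (auto simp: rowset_def)
      then show ?thesis using rG[OF i] 3 by simp
    qed
  qed
  ultimately show "?G \<in> deg_class X n t m (s(a := s a + 1, b := s b - 1))"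
    using GX jj cG by (auto simp: deg_class_def col_graphs_def)
  show "excl X ?G a b = insert j (excl X G a b)" "j \<notin> excl X G a b"
    using ab jj GX by (auto simp: excl_def)
qed

text \<open>Moving an edge of column \<open>j\<close> from row \<open>b\<close> to row \<open>a\<close> keeps all column degrees.\<close>

lemma switching_le:
  assumes X: "finite X" "X \<subseteq> {..<m} \<times> {..<n}" and ab: "a \<noteq> b" "a < m" "b < m"
  shows "(\<Sum>G\<in>deg_class X n t m s. real (card (excl X G b a)) / (real (card (excl X G a b)) + 1))
     \<le> real (card (deg_class X n t m (s(a := s a + 1, b := s b - 1))))"
proof -
  let ?C = "deg_class X n t m s" and ?C' = "deg_class X n t m (s(a := s a + 1, b := s b - 1))"
  let ?P = "SIGMA G : ?C. excl X G b a" and ?P' = "SIGMA G : ?C'. excl X G a b"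
  let ?f = "\<lambda>(G, j). (insert (a, j) (G - {(b, j)}), j)"
  have finC: "finite ?C" "finite ?C'" using X by (auto intro: finite_deg_class)
  have fe: "finite (excl X G u v)" for G u v using X by (intro finite_excl)
  have finP: "finite ?P" "finite ?P'" using finC fe by auto
  have inj: "inj_on ?f ?P"
  proof (rule inj_onI, clarsimp)
    fix G1 G2 j assume *: "j \<in> excl X G1 b a" "j \<in> excl X G2 b a"
      and eq: "insert (a, j) (G1 - {(b, j)}) = insert (a, j) (G2 - {(b, j)})"
    have "G1 = insert (b, j) (insert (a, j) (G1 - {(b, j)}) - {(a, j)})"
         "G2 = insert (b, j) (insert (a, j) (G2 - {(b, j)}) - {(a, j)})"
      using * ab by (auto simp: excl_def)
    then show "G1 = G2" using eq by simp
  qed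
  \<comment> \<open>The weight of a move from G is the reciprocal of the number of reverse moves
    available after it. Each target therefore receives total weight at most 1, and nothing has to be
    known about the target class.\<close>
  have "(\<Sum>G\<in>?C. real (card (excl X G b a)) / (real (card (excl X G a b)) + 1))
      = (\<Sum>G\<in>?C. \<Sum>j\<in>excl X G b a. 1 / (real (card (excl X G a b)) + 1))" by simp
  also have "\<dots> = (\<Sum>(G, j)\<in>?P. 1 / (real (card (excl X G a b)) + 1))"
    using finC fe by (subst sum.Sigma) auto
  also have "\<dots> = (\<Sum>p\<in>?P. 1 / real (card (excl X (fst (?f p)) a b)))"
  proof (rule sum.cong, goal_cases)
    case (2 p)
    then obtain G j where p: "p = (G, j)" "G \<in> ?C" "j \<in> excl X G b a" by auto
    show ?case using switch_mem(2,3)[OF X ab p(2,3)] fe by (simp add: p add.commute)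
  qed simp
  also have "\<dots> = (\<Sum>q\<in>?f ` ?P. 1 / real (card (excl X (fst q) a b)))"
    by (simp only: sum.reindex[OF inj] o_def)
  also have "\<dots> \<le> (\<Sum>q\<in>?P'. 1 / real (card (excl X (fst q) a b)))"
  proof (rule sum_mono2)
    show "?f ` ?P \<subseteq> ?P'" using switch_mem[OF X ab] by auto
  qed (use finP in auto)
  also have "\<dots> = (\<Sum>G\<in>?C'. \<Sum>j\<in>excl X G a b. 1 / real (card (excl X G a b)))"
    using finC fe by (subst sum.Sigma) (auto simp: split_beta)
  also have "\<dots> \<le> (\<Sum>G\<in>?C'. 1)"
    by (intro sum_mono) simp
  finally show ?thesis by simp
qed

text \<open>Columns \<open>j\<close> and \<open>j'\<close> are interchanged inside the rows
  \<open>b\<close> and \<open>c\<close> only; all other rows are left alone.\<close>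

definition row_swap :: "nat \<Rightarrow> nat \<Rightarrow> nat \<Rightarrow> nat \<Rightarrow> (nat \<times> nat) set \<Rightarrow> (nat \<times> nat) set" where
  "row_swap b c j j' G = {(i, l). (i, if i = b \<or> i = c then Transposition.transpose j j' l else l) \<in> G}"

text \<open>A discordant column contains exactly one of its cells in the rows \<open>b\<close> and
  \<open>c\<close>, before and after the exchange. So column degrees survive, and row degrees do
  because the rows are merely permuted.\<close>

lemma row_swap_mem:
  assumes X: "finite X" and bc: "b \<noteq> c"
    and G: "G \<in> deg_class X n t m s" and j: "j \<in> discord X G b c" "j' \<in> discord X G b c"
  shows "row_swap b c j j' G \<in> deg_class X n t m s"
proof -
  let ?G = "row_swap b c j j' G" and ?\<tau> = "Transposition.transpose j j'"
  have GX: "G \<subseteq> X" and cG: "\<And>j. j < n \<Longrightarrow> card (colset G j) = t j" and rG: "\<And>i. i < m \<Longrightarrow> card (rowset G i) = s i"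
    using G by (auto simp: deg_class_def col_graphs_def)
  have finG: "finite G" using X GX by (rule_tac finite_subset)
  have sub: "?G \<subseteq> X"
  proof clarify
    fix i l assume "(i, l) \<in> ?G"
    then have *: "(i, if i = b \<or> i = c then ?\<tau> l else l) \<in> G" by (simp add: row_swap_def)
    show "(i, l) \<in> X"
    proof (cases "(i = b \<or> i = c) \<and> (l = j \<or> l = j')")
      case True
      then show ?thesis using j by (auto simp: discord_def)
    next
      case False
      then have "(i, l) \<in> G" using * by (auto simp: transpose_def split: if_splits)
      then show ?thesis using GX by auto
    qed
  qed
  have rows: "card (rowset ?G i) = card (rowset G i)" for i
  proof (cases "i = b \<or> i = c")
    case True
    then have "rowset ?G i = ?\<tau> ` rowset G i"
      by (auto simp: rowset_def row_swap_def image_iff) (metis transpose_involutory)+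
    then show ?thesis by (simp add: card_image inj_on_subset[OF inj_transpose])
  next
    case False
    then have "rowset ?G i = rowset G i" by (auto simp: rowset_def row_swap_def)
    then show ?thesis by simp
  qed
  have cols: "card (colset ?G l) = card (colset G l)" for l
  proof (cases "l = j \<or> l = j'")
    case True
    have finG': "finite ?G" using sub X by (rule finite_subset)
    have one: "card (colset H l \<inter> {b, c}) = 1" if "((b, l) \<in> H) \<noteq> ((c, l) \<in> H)" for H
    proof -
      have "colset H l \<inter> {b, c} = (if (b, l) \<in> H then {b} else {c})" using that by (auto simp: colset_def)
      then show ?thesis by simp
    qed
    have split: "card (colset H l) = card (colset H l - {b, c}) + card (colset H l \<inter> {b, c})" if "finite H" for H
    proof -
      have "colset H l = (colset H l - {b, c}) \<union> (colset H l \<inter> {b, c})" by auto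
      then show ?thesis using finite_colset[OF that, of l] by (metis card_Un_disjoint Diff_disjoint finite_Diff finite_Int
          Int_Diff_disjoint Int_commute Un_commute Int_assoc inf_bot_right)
    qed
    have "colset ?G l - {b, c} = colset G l - {b, c}" by (auto simp: colset_def row_swap_def)
    moreover have "((b, l) \<in> G) \<noteq> ((c, l) \<in> G)" using True j by (auto simp: discord_def)
    moreover have "((b, l) \<in> ?G) \<noteq> ((c, l) \<in> ?G)" using True j by (auto simp: discord_def row_swap_def)
    ultimately show ?thesis using split[OF finG] split[OF finG'] one by simp
  next
    case False
    then have "colset ?G l = colset G l" by (auto simp: colset_def row_swap_def transpose_def)
    then show ?thesis by simp
  qed
  show ?thesis using sub rows cols cG rG by (simp add: deg_class_def col_graphs_def)
qed

lemma row_swap_discord: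
  assumes "j \<in> discord X G b c" "j' \<in> discord X G b c"
  shows "discord X (row_swap b c j j' G) b c = discord X G b c"
proof -
  have "l \<in> discord X (row_swap b c j j' G) b c \<longleftrightarrow> l \<in> discord X G b c" for l
  proof -
    consider "l = j" | "l = j'" | "l \<noteq> j" "l \<noteq> j'" by blast
    then show ?thesis
      by cases (use assms in \<open>simp_all add: discord_def row_swap_def\<close>)
  qed
  then show ?thesis by blast
qed

lemma row_swap_row_swap: "row_swap b c j j' (row_swap b c j j' G) = G"
  by (auto simp: row_swap_def)

text \<open>Given the other rows and \<open>T = discord X G b c\<close>, row \<open>b\<close> takes a uniformly random subset
  of \<open>T\<close> of its prescribed size; here in averaged form.\<close>

lemma exchange_identity:
  assumes X: "finite X" and bc: "b \<noteq> c"
    and h: "\<And>G G'. (\<And>i j. i \<noteq> b \<Longrightarrow> i \<noteq> c \<Longrightarrow> (i, j) \<in> G \<longleftrightarrow> (i, j) \<in> G') \<Longrightarrow> h G = h G'"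
  shows "(\<Sum>G\<in>deg_class X n t m s. \<Sum>j\<in>discord X G b c. h G j * of_bool ((b, j) \<in> G)) =
     (\<Sum>G\<in>deg_class X n t m s. (\<Sum>j\<in>discord X G b c. h G j) *
        (real (card (excl X G b c)) / real (card (discord X G b c))) :: real)"
proof -
  let ?C = "deg_class X n t m s" and ?T = "\<lambda>G. discord X G b c"
  let ?P = "SIGMA G : ?C. ?T G \<times> ?T G"
  have finC: "finite ?C" using X by (rule finite_deg_class)
  have finT: "finite (?T G)" for G using X by (rule finite_discord)
  let ?w = "\<lambda>G. 1 / real (card (?T G))"
  \<comment> \<open>The involution \<open>row_swap\<close> carries the event that (b, j) is an edge
    to the event that (b, j') is one, and fixes \<open>h\<close> and the discordant set. Summing out
    \<open>j'\<close> on one side and counting it on the other gives the two sides of the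
    identity.\<close>
  have "(\<Sum>(G, j, j')\<in>?P. ?w G * h G j * of_bool ((b, j) \<in> G)) =
        (\<Sum>(G, j, j')\<in>?P. ?w G * h G j * of_bool ((b, j') \<in> G))"
  proof (rule sum.reindex_bij_witness[where i = "\<lambda>(G, j, j'). (row_swap b c j j' G, j, j')"
        and j = "\<lambda>(G, j, j'). (row_swap b c j j' G, j, j')"], goal_cases)
    case (1 a)
    then show ?case by (auto simp: row_swap_row_swap)
  next
    case (2 a)
    then show ?case using row_swap_mem[OF X bc] row_swap_discord by auto
  next
    case (3 a)
    then show ?case by (auto simp: row_swap_row_swap)
  next
    case (4 a)
    then show ?case using row_swap_mem[OF X bc] row_swap_discord by auto
  next
    case (5 a)
    then obtain G j j' where a: "a = (G, j, j')" "G \<in> ?C" "j \<in> ?T G" "j' \<in> ?T G" by auto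
    have "h (row_swap b c j j' G) = h G" by (rule h) (auto simp: row_swap_def)
    moreover have "((b, j') \<in> row_swap b c j j' G) = ((b, j) \<in> G)" by (simp add: row_swap_def)
    ultimately show ?case using row_swap_discord[OF a(3,4)] by (simp add: a(1))
  qed
  moreover have "(\<Sum>(G, j, j')\<in>?P. ?w G * h G j * of_bool ((b, j) \<in> G)) =
      (\<Sum>G\<in>?C. \<Sum>j\<in>?T G. h G j * of_bool ((b, j) \<in> G))"
  proof -
    have "(\<Sum>(G, j, j')\<in>?P. ?w G * h G j * of_bool ((b, j) \<in> G)) =
       (\<Sum>G\<in>?C. \<Sum>j\<in>?T G. \<Sum>j'\<in>?T G. ?w G * h G j * of_bool ((b, j) \<in> G))"
      unfolding sum.cartesian_product using finC finT by (subst sum.Sigma[symmetric]) auto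
    also have "\<dots> = (\<Sum>G\<in>?C. \<Sum>j\<in>?T G. h G j * of_bool ((b, j) \<in> G))"
    proof (intro sum.cong refl, goal_cases)
      case (1 G j)
      then have "card (?T G) > 0" using finT by (auto simp: card_gt_0_iff)
      then show ?case by simp
    qed
    finally show ?thesis .
  qed
  moreover have "(\<Sum>(G, j, j')\<in>?P. ?w G * h G j * of_bool ((b, j') \<in> G)) =
      (\<Sum>G\<in>?C. (\<Sum>j\<in>?T G. h G j) * (real (card (excl X G b c)) / real (card (?T G))))"
  proof -
    have "(\<Sum>(G, j, j')\<in>?P. ?w G * h G j * of_bool ((b, j') \<in> G)) =
       (\<Sum>G\<in>?C. \<Sum>j\<in>?T G. \<Sum>j'\<in>?T G. ?w G * h G j * of_bool ((b, j') \<in> G))"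
      unfolding sum.cartesian_product using finC finT by (subst sum.Sigma[symmetric]) auto
    also have "\<dots> = (\<Sum>G\<in>?C. \<Sum>j\<in>?T G. ?w G * h G j * real (card (excl X G b c)))"
    proof (intro sum.cong refl, goal_cases)
      case (1 G j)
      then have "G \<subseteq> X" by (auto simp: deg_class_def col_graphs_def)
      then have "excl X G b c = {j' \<in> ?T G. (b, j') \<in> G}"
        by (auto simp: discord_def excl_def)
      then have "(\<Sum>j'\<in>?T G. of_bool ((b, j') \<in> G)) = real (card (excl X G b c))"
        using finT by (simp add: of_bool_def sum.inter_filter[symmetric])
      then show ?case by (simp only: sum_distrib_left[symmetric])
    qed
    also have "\<dots> = (\<Sum>G\<in>?C. (\<Sum>j\<in>?T G. h G j) * (real (card (excl X G b c)) / real (card (?T G))))"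
      by (simp add: sum_distrib_right sum_distrib_left sum_divide_distrib mult_ac)
    finally show ?thesis .
  qed
  ultimately show ?thesis by simp
qed

text \<open>The exchange identity for row \<open>b\<close> minus the one for row \<open>c\<close>:
  up to the factor carrying \<open>h\<close>, only the difference of the two exclusive degrees
  remains.\<close>

lemma exchange_difference:
  assumes X: "finite X" and bc: "b \<noteq> c"
    and h: "\<And>G G'. (\<And>i j. i \<noteq> b \<Longrightarrow> i \<noteq> c \<Longrightarrow> (i, j) \<in> G \<longleftrightarrow> (i, j) \<in> G') \<Longrightarrow> h G = h G'"
  shows "(\<Sum>G\<in>deg_class X n t m s. \<Sum>j\<in>discord X G b c. h G j * (of_bool ((b, j) \<in> G) - of_bool ((c, j) \<in> G))) =
     (\<Sum>G\<in>deg_class X n t m s. (\<Sum>j\<in>discord X G b c. h G j) *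
        ((real (card (excl X G b c)) - real (card (excl X G c b))) / real (card (discord X G b c))) :: real)"
proof -
  have sym: "discord X G c b = discord X G b c" for G by (auto simp: discord_def)
  have h': "\<And>G G'. (\<And>i j. i \<noteq> c \<Longrightarrow> i \<noteq> b \<Longrightarrow> (i, j) \<in> G \<longleftrightarrow> (i, j) \<in> G') \<Longrightarrow> h G = h G'"
    using h by blast
  show ?thesis
    using exchange_identity[OF X bc, of h n t m s, OF h]
      exchange_identity[OF X bc[symmetric], of h n t m s, OF h']
    by (simp add: sym sum_subtractf right_diff_distrib diff_divide_distrib)
qed

section \<open>Expected codegrees\<close>

lemma avg_add: "avg S (\<lambda>x. f x + g x) = avg S f + avg S g"
  by (simp add: avg_def sum.distrib add_divide_distrib)

lemma avg_diff: "avg S (\<lambda>x. f x - g x) = avg S f - avg S g"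
  by (simp add: avg_def sum_subtractf diff_divide_distrib)

lemma avg_cmult: "avg S (\<lambda>x. c * f x) = c * avg S f"
  by (simp add: avg_def sum_distrib_left)

lemma avg_sum: "avg S (\<lambda>x. \<Sum>i\<in>I. f i x) = (\<Sum>i\<in>I. avg S (f i))"
  unfolding avg_def by (subst sum.swap) (simp add: sum_divide_distrib)

lemma avg_const: "finite S \<Longrightarrow> S \<noteq> {} \<Longrightarrow> avg S (\<lambda>x. c) = c"
  by (simp add: avg_def)

lemma avg_cong: "(\<And>x. x \<in> S \<Longrightarrow> f x = g x) \<Longrightarrow> avg S f = avg S g"
  by (simp add: avg_def cong: sum.cong)

lemma avg_mono: "(\<And>x. x \<in> S \<Longrightarrow> f x \<le> g x) \<Longrightarrow> avg S f \<le> avg S g"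
  unfolding avg_def by (intro divide_right_mono sum_mono) auto

lemma abs_avg_le: "\<bar>avg S f\<bar> \<le> avg S (\<lambda>x. \<bar>f x\<bar>)"
  unfolding avg_def by (simp add: sum_abs divide_right_mono)

lemma abs_avg_le_const:
  assumes "finite S" "S \<noteq> {}" "\<And>x. x \<in> S \<Longrightarrow> \<bar>f x\<bar> \<le> c"
  shows "\<bar>avg S f\<bar> \<le> c"
proof -
  have "avg S (\<lambda>x. \<bar>f x\<bar>) \<le> avg S (\<lambda>_. c)" using assms(3) by (rule avg_mono)
  then show ?thesis using abs_avg_le[of S f] avg_const[OF assms(1,2), of c] by linarith
qed

lemma abs_avg_split:
  assumes S: "finite S" "S \<noteq> {}" and AB: "A \<ge> 0" "B \<ge> 0"
    and good: "\<And>x. x \<in> S \<Longrightarrow> P x \<Longrightarrow> \<bar>f x\<bar> \<le> A" and all: "\<And>x. x \<in> S \<Longrightarrow> \<bar>f x\<bar> \<le> B"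
    and bad: "real (card {x \<in> S. \<not> P x}) \<le> \<xi> * real (card S)"
  shows "\<bar>avg S f\<bar> \<le> A + \<xi> * B"
proof -
  have pos: "real (card S) > 0" using S by (simp add: card_gt_0_iff)
  have "\<bar>avg S f\<bar> \<le> avg S (\<lambda>x. \<bar>f x\<bar>)" by (rule abs_avg_le)
  also have "\<dots> \<le> avg S (\<lambda>x. A + B * of_bool (\<not> P x))"
    using good all AB by (intro avg_mono) (force simp: of_bool_def)
  also have "\<dots> = A + B * (real (card {x \<in> S. \<not> P x}) / real (card S))"
    using S by (simp add: avg_add avg_cmult avg_const) (simp add: avg_def of_bool_def sum.inter_filter[symmetric])
  also have "\<dots> \<le> A + B * \<xi>"
    using bad pos AB by (intro add_left_mono mult_left_mono) (simp_all add: field_simps)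
  finally show ?thesis by (simp add: mult.commute)
qed

text \<open>The flag \<open>z\<close> selects the digraph case, in which the diagonal is
  forbidden.\<close>

definition cells :: "nat \<Rightarrow> nat \<Rightarrow> bool \<Rightarrow> (nat \<times> nat) set" where
  "cells m n z = {(i, j). i < m \<and> j < n \<and> (z \<longrightarrow> i \<noteq> j)}"

lemma finite_cells [simp]: "finite (cells m n z)"
  by (rule finite_subset[of _ "{..<m} \<times> {..<n}"]) (auto simp: cells_def)

text \<open>The real number \<open>Q\<close> plays the role of a small power of \<open>n\<close>.\<close>

locale regular_columns =
  fixes m n :: nat and z :: bool and t :: "nat \<Rightarrow> nat" and Q :: real
  assumes square: "z \<Longrightarrow> m = n"
    and m_le: "real m \<le> Q * real n" and n_le: "real n \<le> Q * real m"
    and density: "1 / Q \<le> edge_density m n t * (1 - edge_density m n t)"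
    and regular: "\<And>j. j < n \<Longrightarrow> \<bar>real (t j) - edge_density m n t * real m\<bar> \<le> Q * sqrt (real n)"
    and Q_large: "Q \<ge> 2000" and Q_small: "Q ^ 60 \<le> sqrt (real n)" and exp_Q: "real n ^ 20 \<le> exp Q"
begin

definition "lam = edge_density m n t"
definition "w = sqrt (real n)"
abbreviation "X \<equiv> cells m n z"
abbreviation "\<Omega> \<equiv> col_graphs X n t"
abbreviation "cls s \<equiv> deg_class X n t m s"

text \<open>Each condition serves one estimate. The first makes the row degrees regular, and the
  second makes discordant sets of size about n. The third says that a third row meets a discordant
  set in the expected proportion, for the comparison of codegrees. The fourth controls the double
  count of codegrees; its scale is w^2 because each summand can be as large as Q * w.\<close>

definition good :: "(nat \<times> nat) set \<Rightarrow> bool" where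
  "good G \<longleftrightarrow>
     (\<forall>a<m. \<bar>real (card (rowset G a)) - lam * real n\<bar> \<le> Q ^ 4 * w) \<and>
     (\<forall>b<m. \<forall>c<m. b \<noteq> c \<longrightarrow> \<bar>real (card (discord X G b c)) - 2 * lam * (1 - lam) * real n\<bar> \<le> Q ^ 4 * w) \<and>
     (\<forall>a<m. \<forall>b<m. \<forall>c<m. a \<noteq> b \<longrightarrow> a \<noteq> c \<longrightarrow> b \<noteq> c \<longrightarrow>
        \<bar>\<Sum>j\<in>discord X G b c. of_bool ((a, j) \<in> G) - lam\<bar> \<le> Q ^ 4 * w) \<and>
     (\<forall>a<m. \<bar>\<Sum>j\<in>rowset G a. real (t j) - lam * real m\<bar> \<le> Q ^ 6 * w\<^sup>2)"

lemma scale_bounds: "Q > 0" "Q \<ge> 1" "w > 0" "w \<ge> 1" "w\<^sup>2 = real n" "Q ^ 60 \<le> w" "n > 0" "m > 0"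
proof -
  show "Q > 0" "Q \<ge> 1" using Q_large by auto
  show "Q ^ 60 \<le> w" using Q_small by (simp add: w_def)
  moreover have "Q ^ 60 \<ge> 1" using Q_large by (intro one_le_power) auto
  ultimately show w: "w \<ge> 1" "w > 0" by auto
  from w(2) have "sqrt (real n) > 0" unfolding w_def .
  then show n: "n > 0" by simp
  then have "0 < Q * real m" using n_le by (simp add: less_le_trans)
  then show "m > 0" by (cases m) auto
  show "w\<^sup>2 = real n" by (simp add: w_def)
qed

lemma Q_pow_mono: "i \<le> j \<Longrightarrow> Q ^ i \<le> Q ^ j"
  using scale_bounds by (intro power_increasing) auto

lemma w_ge: "i \<le> 60 \<Longrightarrow> Q ^ i \<le> w"
  using Q_pow_mono[of i 60] scale_bounds by linarith

text \<open>This is the purpose of the bound 2000: any numerical constant that occurs costs one more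
  power of Q.\<close>

lemma const_Q: "c \<le> 2000 \<Longrightarrow> c * Q ^ i \<le> Q ^ Suc i"
  using Q_large scale_bounds by (simp add: mult_right_mono)

lemma lam_bounds: "0 < lam" "lam < 1" "1 / Q \<le> lam * (1 - lam)" "1 / Q \<le> lam" "lam \<le> 1 - 1 / Q"
proof -
  show d: "1 / Q \<le> lam * (1 - lam)" using density by (simp add: lam_def)
  have "lam * (1 - lam) > 0" using d scale_bounds by (smt (verit) divide_pos_pos)
  then show l: "0 < lam" "lam < 1" by (auto simp: zero_less_mult_iff)
  have "lam * (1 - lam) \<le> lam * 1" using l by (intro mult_left_mono) auto
  then show "1 / Q \<le> lam" using d by linarith
  have "lam * (1 - lam) \<le> 1 * (1 - lam)" using l by (intro mult_right_mono) auto
  from order.trans[OF d this] show "lam \<le> 1 - 1 / Q" by simp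
qed

lemma sum_t: "(\<Sum>j<n. real (t j)) = lam * real m * real n"
  using scale_bounds by (simp add: lam_def edge_density_def)

lemma m_ge: "real m \<ge> w\<^sup>2 / Q" "real m - 1 \<ge> w\<^sup>2 / (2 * Q)" "real m - 3 \<ge> w\<^sup>2 / (2 * Q)"
proof -
  show 1: "real m \<ge> w\<^sup>2 / Q" using n_le scale_bounds by (simp add: field_simps)
  have "6 * Q \<le> w" using const_Q[of 6 1] w_ge[of 2] by (simp add: numeral_2_eq_2)
  also have "\<dots> \<le> w\<^sup>2" using scale_bounds(4) by (simp add: power2_eq_square)
  finally have "3 \<le> w\<^sup>2 / (2 * Q)" using scale_bounds by (simp add: field_simps)
  moreover have "w\<^sup>2 / Q = w\<^sup>2 / (2 * Q) + w\<^sup>2 / (2 * Q)" by (simp add: field_simps)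
  ultimately show "real m - 1 \<ge> w\<^sup>2 / (2 * Q)" "real m - 3 \<ge> w\<^sup>2 / (2 * Q)" using 1 by linarith+
qed

lemma exp_minus_Q_bounds: "exp (- Q) \<le> 1 / w ^ 40" "exp (- Q) * real n ^ 3 * real m \<le> 1" "exp (- Q) < 1"
proof -
  have "w ^ 40 = real n ^ 20" unfolding scale_bounds(5)[symmetric] by (simp flip: power_mult)
  then show 1: "exp (- Q) \<le> 1 / w ^ 40" using exp_Q scale_bounds by (simp add: exp_minus field_simps)
  have "Q * real n \<le> real n * real n"
  proof (rule mult_right_mono)
    have "Q \<le> w" using w_ge[of 1] by simp
    also have "w \<le> w\<^sup>2" using scale_bounds(4) by (simp add: power2_eq_square)
    finally show "Q \<le> real n" using scale_bounds by simp
  qed simp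
  then have "real n ^ 3 * real m \<le> real n ^ 3 * (real n * real n)"
    using m_le by (intro mult_left_mono) auto
  also have "\<dots> = real n ^ 5" by (simp add: eval_nat_numeral)
  also have "\<dots> \<le> real n ^ 20" using scale_bounds by (intro power_increasing) auto
  also have "\<dots> \<le> exp Q" by (rule exp_Q)
  finally have "exp (- Q) * (real n ^ 3 * real m) \<le> exp (- Q) * exp Q" by (intro mult_left_mono) auto
  then show "exp (- Q) * real n ^ 3 * real m \<le> 1" by (simp add: exp_minus mult.assoc)
  show "exp (- Q) < 1" using scale_bounds by simp
qed

lemma forb_card:
  assumes "G \<subseteq> X" "b < m"
  shows "card {j \<in> rowset G b. (c, j) \<notin> X} \<le> 1 \<or> c \<ge> m"
proof -
  have "c < m \<Longrightarrow> {j \<in> rowset G b. (c, j) \<notin> X} \<subseteq> {c}"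
    using assms by (auto simp: rowset_def cells_def)
  then have "c < m \<Longrightarrow> card {j \<in> rowset G b. (c, j) \<notin> X} \<le> card {c}" by (intro card_mono) auto
  then show ?thesis by (cases "c < m") auto
qed

lemma rowset_split:
  assumes G: "G \<subseteq> X" and fA: "finite A"
  shows "real (card (A \<inter> rowset G b)) = real (card (A \<inter> excl X G b c)) + real (card (A \<inter> rowset G b \<inter> rowset G c))
     + real (card (A \<inter> {j \<in> rowset G b. (c, j) \<notin> X}))"
proof -
  have "A \<inter> rowset G b = A \<inter> excl X G b c \<union> A \<inter> rowset G b \<inter> rowset G c \<union> A \<inter> {j \<in> rowset G b. (c, j) \<notin> X}"
    using G by (auto simp: rowset_def excl_def)
  moreover have "card (A \<inter> excl X G b c \<union> A \<inter> rowset G b \<inter> rowset G c \<union> A \<inter> {j \<in> rowset G b. (c, j) \<notin> X})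
     = card (A \<inter> excl X G b c) + card (A \<inter> rowset G b \<inter> rowset G c) + card (A \<inter> {j \<in> rowset G b. (c, j) \<notin> X})"
    using fA G by (subst card_Un_disjoint; (subst card_Un_disjoint)?) (auto simp: rowset_def excl_def)
  ultimately show ?thesis by simp
qed

text \<open>Columns common to both rows cancel. What remains are columns used by one row and
  forbidden for the other, at most one for each row.\<close>

lemma codeg_diff:
  assumes G: "G \<subseteq> X" and b: "b < m" "c < m" and fA: "finite A"
  shows "\<bar>(real (card (A \<inter> rowset G b)) - real (card (A \<inter> rowset G c)))
     - (real (card (A \<inter> excl X G b c)) - real (card (A \<inter> excl X G c b)))\<bar> \<le> 1"
proof -
  have fr: "finite (rowset G i)" for i by (rule finite_rowset[OF finite_subset[OF G finite_cells]])
  have "card (A \<inter> {j \<in> rowset G u. (v, j) \<notin> X}) \<le> 1" if "u < m" "v < m" for u v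
    using forb_card[OF G, of u v] that fr[of u]
      card_mono[of "{j \<in> rowset G u. (v, j) \<notin> X}" "A \<inter> {j \<in> rowset G u. (v, j) \<notin> X}"] by simp
  then have "card (A \<inter> {j \<in> rowset G b. (c, j) \<notin> X}) \<le> 1" "card (A \<inter> {j \<in> rowset G c. (b, j) \<notin> X}) \<le> 1"
    using b by auto
  moreover have "A \<inter> rowset G c \<inter> rowset G b = A \<inter> rowset G b \<inter> rowset G c" by auto
  ultimately show ?thesis
    using rowset_split[OF G fA, of b c] rowset_split[OF G fA, of c b] by simp
qed

lemma deg_diff:
  assumes G: "G \<subseteq> X" and b: "b < m" "c < m"
  shows "\<bar>(real (card (rowset G b)) - real (card (rowset G c)))
     - (real (card (excl X G b c)) - real (card (excl X G c b)))\<bar> \<le> 1"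
proof -
  have "rowset G i \<subseteq> {..<n}" "excl X G i l \<subseteq> {..<n}" for i l
    using G by (auto simp: rowset_def excl_def cells_def)
  then have "{..<n} \<inter> rowset G i = rowset G i" "{..<n} \<inter> excl X G i l = excl X G i l" for i l by (auto simp: subset_iff)
  then show ?thesis using codeg_diff[OF G b, of "{..<n}"] by simp
qed

end

text \<open>A degree sequence for which a uniformly random graph is good with overwhelming
  probability. That few sequences fail this is shown in \<open>bad_mass\<close>.\<close>

locale good_class = regular_columns +
  fixes s :: "nat \<Rightarrow> nat"
  assumes cls_ne: "cls s \<noteq> {}"
    and few_bad: "real (card {G \<in> cls s. \<not> good G}) \<le> exp (- Q) * real (card (cls s))"
begin

abbreviation "\<C> \<equiv> cls s"
abbreviation "codeg a b G \<equiv> real (card (rowset G a \<inter> rowset G b))"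

lemma finC [simp]: "finite \<C>" by (rule finite_deg_class) simp

lemma clsD: assumes "G \<in> \<C>"
  shows "G \<subseteq> X" "finite G" "\<And>j. j < n \<Longrightarrow> card (colset G j) = t j" "\<And>i. i < m \<Longrightarrow> card (rowset G i) = s i"
    "rowset G i \<subseteq> {..<n}" "finite (rowset G i)"
proof -
  show 1: "G \<subseteq> X" "\<And>j. j < n \<Longrightarrow> card (colset G j) = t j" "\<And>i. i < m \<Longrightarrow> card (rowset G i) = s i"
    using assms by (auto simp: deg_class_def col_graphs_def)
  show "finite G" by (rule finite_subset[OF 1(1)]) simp
  then show "finite (rowset G i)" by (rule finite_rowset)
  show "rowset G i \<subseteq> {..<n}" using 1(1) by (auto simp: rowset_def cells_def)
qed

lemma avg_split:
  assumes "A \<ge> 0" "B \<ge> 0" "\<And>G. G \<in> \<C> \<Longrightarrow> good G \<Longrightarrow> \<bar>f G\<bar> \<le> A" "\<And>G. G \<in> \<C> \<Longrightarrow> \<bar>f G\<bar> \<le> B"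
  shows "\<bar>avg \<C> f\<bar> \<le> A + exp (- Q) * B"
  by (rule abs_avg_split[where P = good, OF finC cls_ne assms(1,2) assms(3) assms(4) few_bad])

text \<open>Row degrees are constant on the class, so a single good member determines them.\<close>

lemma s_regular:
  assumes a: "a < m" shows "\<bar>real (s a) - lam * real n\<bar> \<le> Q ^ 4 * w"
proof -
  have "{G \<in> \<C>. \<not> good G} \<noteq> \<C>"
  proof
    assume "{G \<in> \<C>. \<not> good G} = \<C>"
    then have "real (card \<C>) \<le> exp (- Q) * real (card \<C>)" using few_bad by simp
    moreover have "real (card \<C>) > 0" using cls_ne by (simp add: card_gt_0_iff)
    ultimately show False using exp_minus_Q_bounds(3) by (simp add: mult_le_cancel_right1)
  qed
  then obtain G where "G \<in> \<C>" "good G" by auto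
  then show ?thesis using a clsD(4) by (auto simp: good_def)
qed

lemma s_le: assumes "a < m" shows "s a \<le> n"
proof -
  obtain G where "G \<in> \<C>" using cls_ne by auto
  then show ?thesis using clsD(4)[of G a] clsD(5)[of G a] card_mono[of "{..<n}" "rowset G a"] assms by simp
qed

lemma dev_small: "Q ^ 4 * w \<le> w\<^sup>2 / (100 * Q)" "Q ^ 4 * w \<ge> 1" "100 * Q ^ 4 * w \<le> real n"
proof -
  have "100 * Q ^ 5 \<le> w" using const_Q[of 100 5] w_ge[of 6] by simp
  then have "(100 * Q ^ 5) * w \<le> w * w" using scale_bounds by (intro mult_right_mono) auto
  moreover have "Q ^ 5 = Q ^ 4 * Q" by (simp add: eval_nat_numeral)
  ultimately show 1: "Q ^ 4 * w \<le> w\<^sup>2 / (100 * Q)" using scale_bounds(1) by (simp add: pos_le_divide_eq power2_eq_square mult_ac)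
  have "1 * 1 \<le> Q ^ 4 * w" using scale_bounds by (intro mult_mono one_le_power) auto
  then show "Q ^ 4 * w \<ge> 1" by simp
  have "w\<^sup>2 / Q \<le> w\<^sup>2 / 1" using scale_bounds by (intro divide_left_mono) auto
  then show "100 * Q ^ 4 * w \<le> real n" using 1 scale_bounds by simp
qed

lemma discord_large:
  assumes "good G" "b < m" "c < m" "b \<noteq> c"
  shows "real (card (discord X G b c)) \<ge> w\<^sup>2 / Q"
proof -
  have "\<bar>real (card (discord X G b c)) - 2 * lam * (1 - lam) * real n\<bar> \<le> Q ^ 4 * w"
    using assms by (auto simp: good_def)
  moreover have "2 * lam * (1 - lam) * real n = 2 * ((lam * (1 - lam)) * real n)" by simp
  moreover have "1 / Q * real n \<le> (lam * (1 - lam)) * real n"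
    using lam_bounds by (intro mult_right_mono) auto
  moreover have "Q ^ 4 * w \<le> 1 / Q * real n" using dev_small(1) scale_bounds by (simp add: field_simps)
  ultimately have "real (card (discord X G b c)) \<ge> 1 / Q * real n" by linarith
  then show ?thesis using scale_bounds(5) by simp
qed

text \<open>A deviation Q^4 * w relative to a discordant set of size at least w^2 / Q, with the bad
  graphs absorbed in the factor 2.\<close>

lemma ratio_avg:
  assumes "a < m" "b < m" "c < m" "a \<noteq> b" "a \<noteq> c" "b \<noteq> c"
  shows "avg \<C> (\<lambda>G. \<bar>real (card (rowset G a \<inter> discord X G b c)) / real (card (discord X G b c)) - lam\<bar>) \<le> 2 * Q ^ 5 / w"
proof -
  let ?T = "\<lambda>G. discord X G b c"
  let ?f = "\<lambda>G. \<bar>real (card (rowset G a \<inter> ?T G)) / real (card (?T G)) - lam\<bar>"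
  have finT: "finite (?T G)" for G by (rule finite_discord) simp
  have "\<bar>avg \<C> ?f\<bar> \<le> Q ^ 5 / w + exp (- Q) * 1"
  proof (rule avg_split)
    fix G assume G: "G \<in> \<C>" "good G"
    have T: "real (card (?T G)) \<ge> w\<^sup>2 / Q" by (rule discord_large) (use assms G in auto)
    have Tpos: "real (card (?T G)) > 0" using T scale_bounds by (smt (verit) divide_pos_pos zero_less_power)
    have "\<bar>\<Sum>j\<in>?T G. of_bool ((a, j) \<in> G) - lam\<bar> \<le> Q ^ 4 * w" using assms G by (auto simp: good_def)
    moreover have "(\<Sum>j\<in>?T G. of_bool ((a, j) \<in> G) - lam) = real (card (rowset G a \<inter> ?T G)) - lam * real (card (?T G))"
    proof -
      have "(\<Sum>j\<in>?T G. of_bool ((a, j) \<in> G)) = real (card {j \<in> ?T G. (a, j) \<in> G})"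
        using finT by (simp add: of_bool_def sum.inter_filter[symmetric])
      also have "{j \<in> ?T G. (a, j) \<in> G} = rowset G a \<inter> ?T G" by (auto simp: rowset_def)
      finally show ?thesis by (simp add: sum_subtractf mult.commute)
    qed
    ultimately have "\<bar>real (card (rowset G a \<inter> ?T G)) - lam * real (card (?T G))\<bar> \<le> Q ^ 4 * w" by simp
    moreover have "?f G = \<bar>real (card (rowset G a \<inter> ?T G)) - lam * real (card (?T G))\<bar> / real (card (?T G))"
    proof -
      have "real (card (rowset G a \<inter> ?T G)) / real (card (?T G)) - lam =
          (real (card (rowset G a \<inter> ?T G)) - lam * real (card (?T G))) / real (card (?T G))"
        using Tpos by (simp add: field_simps)
      then show ?thesis by (simp add: abs_divide)
    qed
    ultimately have "?f G \<le> (Q ^ 4 * w) / (w\<^sup>2 / Q)"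
      using T scale_bounds by (simp only:, intro frac_le) auto
    also have "\<dots> = Q ^ 5 / w" using scale_bounds by (simp add: field_simps eval_nat_numeral)
    finally show "\<bar>?f G\<bar> \<le> Q ^ 5 / w" by simp
  next
    fix G assume G: "G \<in> \<C>"
    have "card (rowset G a \<inter> ?T G) \<le> card (?T G)" using finT by (intro card_mono) auto
    then have "real (card (rowset G a \<inter> ?T G)) / real (card (?T G)) \<le> 1"
      by (cases "card (?T G) = 0") (simp_all add: divide_le_eq_1)
    moreover have "0 \<le> real (card (rowset G a \<inter> ?T G)) / real (card (?T G))" by simp
    ultimately show "\<bar>?f G\<bar> \<le> 1" using lam_bounds by linarith
  qed (use scale_bounds in auto)
  also have "exp (- Q) * 1 \<le> Q ^ 5 / w"
  proof -
    have "1 / w ^ 40 \<le> 1 / w" using scale_bounds by (intro divide_left_mono) (auto simp: self_le_power)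
    also have "\<dots> \<le> Q ^ 5 / w" using scale_bounds by (intro divide_right_mono) auto
    finally show ?thesis using exp_minus_Q_bounds(1) by simp
  qed
  finally show ?thesis by simp
qed

lemma s_diff: "a < m \<Longrightarrow> b < m \<Longrightarrow> \<bar>real (s a) - real (s b)\<bar> \<le> 2 * Q ^ 4 * w"
  using s_regular[of a] s_regular[of b] by linarith

text \<open>Exchanging the rows \<open>b\<close> and \<open>c\<close> on their discordant columns shows that the expected
  codegrees of \<open>a\<close> with \<open>b\<close> and with \<open>c\<close> differ by about \<open>lam * (s b - s c)\<close>.  The average
  over \<open>c\<close> is known from double counting.\<close>

lemma codeg_compare:
  assumes "a < m" "b < m" "c < m" "a \<noteq> b" "a \<noteq> c"
  shows "\<bar>avg \<C> (codeg a b) - avg \<C> (codeg a c) - lam * (real (s b) - real (s c))\<bar> \<le> 5 * Q ^ 9"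
proof (cases "b = c")
  case True
  then show ?thesis using scale_bounds by simp
next
  case False
  let ?T = "\<lambda>G. discord X G b c"
  let ?A = "\<lambda>G. rowset G a"
  let ?d = "\<lambda>G. real (card (?A G \<inter> excl X G b c)) - real (card (?A G \<inter> excl X G c b))"
  let ?\<rho> = "\<lambda>G. real (card (?A G \<inter> ?T G)) / real (card (?T G))"
  let ?e = "\<lambda>G. real (card (excl X G b c)) - real (card (excl X G c b))"
  have finT: "finite (?T G)" for G by (rule finite_discord) simp
  \<comment> \<open>\<open>exchange_difference\<close> with \<open>h\<close> the indicator of row
    \<open>a\<close>, which is unaffected by the rows \<open>b\<close> and \<open>c\<close>.\<close>
  have "avg \<C> ?d = avg \<C> (\<lambda>G. ?\<rho> G * ?e G)"
  proof -
    have "(\<Sum>G\<in>\<C>. \<Sum>j\<in>?T G. of_bool ((a, j) \<in> G) * (of_bool ((b, j) \<in> G) - of_bool ((c, j) \<in> G))) =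
       (\<Sum>G\<in>\<C>. (\<Sum>j\<in>?T G. of_bool ((a, j) \<in> G)) * (?e G / real (card (?T G))))"
      by (rule exchange_difference) (use assms False in auto)
    moreover have "(\<Sum>j\<in>?T G. of_bool ((a, j) \<in> G)) = real (card (?A G \<inter> ?T G))" for G
    proof -
      have "(\<Sum>j\<in>?T G. of_bool ((a, j) \<in> G)) = real (card {j \<in> ?T G. (a, j) \<in> G})"
        using finT by (simp add: of_bool_def sum.inter_filter[symmetric])
      also have "{j \<in> ?T G. (a, j) \<in> G} = ?A G \<inter> ?T G" by (auto simp: rowset_def)
      finally show ?thesis .
    qed
    moreover have "(\<Sum>j\<in>?T G. of_bool ((a, j) \<in> G) * (of_bool ((b, j) \<in> G) - of_bool ((c, j) \<in> G))) = ?d G"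
      if G: "G \<in> \<C>" for G
    proof -
      have GX: "G \<subseteq> X" using clsD[OF G] by simp
      have one: "(\<Sum>j\<in>?T G. of_bool ((a, j) \<in> G) * of_bool ((u, j) \<in> G)) = real (card (?A G \<inter> excl X G u v))"
        if uv: "(u = b \<and> v = c) \<or> (u = c \<and> v = b)" for u v
      proof -
        have "(\<Sum>j\<in>?T G. of_bool ((a, j) \<in> G) * of_bool ((u, j) \<in> G)) = real (card {j \<in> ?T G. (a, j) \<in> G \<and> (u, j) \<in> G})"
          unfolding of_bool_conj[symmetric] using finT by (simp add: of_bool_def sum.inter_filter[symmetric])
        also have "{j \<in> ?T G. (a, j) \<in> G \<and> (u, j) \<in> G} = ?A G \<inter> excl X G u v"
          using uv GX by (auto simp: rowset_def discord_def excl_def)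
        finally show ?thesis .
      qed
      show ?thesis using one[of b c] one[of c b] by (simp add: right_diff_distrib sum_subtractf)
    qed
    ultimately show ?thesis by (simp add: avg_def)
  qed
  have "avg \<C> (codeg a b) - avg \<C> (codeg a c) - lam * (real (s b) - real (s c)) =
    avg \<C> (\<lambda>G. (codeg a b G - codeg a c G) - ?d G) + (avg \<C> (\<lambda>G. ?\<rho> G * ?e G) - lam * (real (s b) - real (s c)))"
    using \<open>avg \<C> ?d = _\<close> by (simp add: avg_diff)
  moreover have "\<bar>avg \<C> (\<lambda>G. (codeg a b G - codeg a c G) - ?d G)\<bar> \<le> 1"
    by (rule abs_avg_le_const) (use cls_ne assms codeg_diff clsD in auto)
  moreover have "\<bar>avg \<C> (\<lambda>G. ?\<rho> G * ?e G) - lam * (real (s b) - real (s c))\<bar> \<le> 1 + 4 * Q ^ 9"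
  proof -
    let ?D = "real (s b) - real (s c)"
    have D: "\<bar>?D\<bar> \<le> 2 * Q ^ 4 * w" using s_diff assms by simp
    have "\<bar>avg \<C> (\<lambda>G. ?\<rho> G * ?e G) - lam * ?D\<bar> = \<bar>avg \<C> (\<lambda>G. ?\<rho> G * ?e G - lam * ?D)\<bar>"
      using cls_ne by (simp add: avg_diff avg_const)
    also have "\<dots> \<le> avg \<C> (\<lambda>G. \<bar>?\<rho> G * ?e G - lam * ?D\<bar>)" by (rule abs_avg_le)
    also have "\<dots> \<le> avg \<C> (\<lambda>G. 1 + \<bar>?D\<bar> * \<bar>?\<rho> G - lam\<bar>)"
    proof (rule avg_mono)
      fix G assume G: "G \<in> \<C>"
      have "card (?A G \<inter> ?T G) \<le> card (?T G)" using finT by (intro card_mono) auto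
      then have "?\<rho> G \<le> 1" by (cases "card (?T G) = 0") (simp_all add: divide_le_eq_1)
      moreover have "0 \<le> ?\<rho> G" by simp
      ultimately have \<rho>: "0 \<le> ?\<rho> G" "?\<rho> G \<le> 1" by auto
      have "\<bar>?D - ?e G\<bar> \<le> 1" using deg_diff[of G b c] clsD[OF G] assms by simp
      then have "\<bar>?\<rho> G * (?e G - ?D)\<bar> \<le> 1 * 1"
        unfolding abs_mult using \<rho> by (intro mult_mono) auto
      moreover have "?\<rho> G * ?e G - lam * ?D = ?\<rho> G * (?e G - ?D) + ?D * (?\<rho> G - lam)"
        by (simp add: right_diff_distrib mult.commute)
      moreover have "\<bar>?D * (?\<rho> G - lam)\<bar> = \<bar>?D\<bar> * \<bar>?\<rho> G - lam\<bar>" by (rule abs_mult)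
      moreover have "\<bar>x\<bar> \<le> 1 * 1 \<Longrightarrow> v = x + y \<Longrightarrow> \<bar>y\<bar> = u \<Longrightarrow> \<bar>v\<bar> \<le> 1 + u" for x y u v :: real
        by linarith
      ultimately show "\<bar>?\<rho> G * ?e G - lam * ?D\<bar> \<le> 1 + \<bar>?D\<bar> * \<bar>?\<rho> G - lam\<bar>" by blast
    qed
    also have "\<dots> = 1 + \<bar>?D\<bar> * avg \<C> (\<lambda>G. \<bar>?\<rho> G - lam\<bar>)"
      using cls_ne by (simp add: avg_add avg_cmult avg_const)
    \<comment> \<open>The decisive cancellation of scales: a degree difference of order w meets a
      relative error of order 1 / w, and only a power of Q is left.\<close>
    also have "\<dots> \<le> 1 + (2 * Q ^ 4 * w) * (2 * Q ^ 5 / w)"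
      using D ratio_avg[of a b c] assms False scale_bounds
      by (intro add_left_mono mult_mono) (auto simp: avg_def intro!: divide_nonneg_nonneg sum_nonneg)
    also have "(2 * Q ^ 4 * w) * (2 * Q ^ 5 / w) = 4 * Q ^ 9"
      using scale_bounds by (simp add: eval_nat_numeral)
    finally show ?thesis .
  qed
  moreover have "2 \<le> Q ^ 9" using w_ge const_Q[of 2 0] Q_pow_mono[of 1 9] by simp
  ultimately show ?thesis by linarith
qed

text \<open>Double counting: an edge of row \<open>a\<close> in column j contributes t j - 1 to the
  sum of the codegrees. The deviation of these weights from their mean is the fourth condition of
  \<open>good\<close>.\<close>

lemma codeg_sum:
  assumes a: "a < m"
  shows "\<bar>(\<Sum>c\<in>{..<m} - {a}. avg \<C> (codeg a c)) - real (s a) * (lam * real m - 1)\<bar> \<le> 2 * Q ^ 6 * w\<^sup>2"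
proof -
  let ?f = "\<lambda>G. \<Sum>j\<in>rowset G a. real (t j) - lam * real m"
  have "(\<Sum>c\<in>{..<m} - {a}. codeg a c G) = real (s a) * (lam * real m - 1) + ?f G" if G: "G \<in> \<C>" for G
  proof -
    note GD = clsD[OF G]
    have "(\<Sum>c\<in>{..<m} - {a}. codeg a c G) = (\<Sum>c\<in>{..<m} - {a}. \<Sum>j\<in>rowset G a. of_bool ((c, j) \<in> G))"
    proof (rule sum.cong[OF refl])
      fix c
      have "(\<Sum>j\<in>rowset G a. of_bool ((c, j) \<in> G)) = real (card {j \<in> rowset G a. (c, j) \<in> G})"
        using GD by (simp add: of_bool_def sum.inter_filter[symmetric])
      also have "{j \<in> rowset G a. (c, j) \<in> G} = rowset G a \<inter> rowset G c" by (auto simp: rowset_def)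
      finally show "codeg a c G = (\<Sum>j\<in>rowset G a. of_bool ((c, j) \<in> G))" by simp
    qed
    also have "\<dots> = (\<Sum>j\<in>rowset G a. \<Sum>c\<in>{..<m} - {a}. of_bool ((c, j) \<in> G))" by (rule sum.swap)
    also have "\<dots> = (\<Sum>j\<in>rowset G a. real (t j) - 1)"
    proof (rule sum.cong[OF refl])
      fix j assume j: "j \<in> rowset G a"
      have "(\<Sum>c\<in>{..<m} - {a}. of_bool ((c, j) \<in> G)) = real (card {c \<in> {..<m} - {a}. (c, j) \<in> G})"
        by (simp add: of_bool_def sum.inter_filter[symmetric])
      also have "{c \<in> {..<m} - {a}. (c, j) \<in> G} = colset G j - {a}"
        using GD(1) by (auto simp: colset_def cells_def)
      also have "card \<dots> = t j - 1"
        using j GD(3)[of j] GD(5)[of a] by (auto simp: colset_def rowset_def)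
      also have "real (t j - 1) = real (t j) - 1"
      proof -
        have "j < n" using j GD(5) by auto
        moreover have "a \<in> colset G j" using j by (auto simp: colset_def rowset_def)
        ultimately have "t j > 0" using GD(3)[of j] finite_colset[OF GD(2), of j] by (metis card_gt_0_iff empty_iff)
        then show ?thesis by simp
      qed
      finally show "(\<Sum>c\<in>{..<m} - {a}. of_bool ((c, j) \<in> G)) = real (t j) - 1" .
    qed
    also have "\<dots> = real (s a) * (lam * real m - 1) + ?f G"
      using GD(4)[OF a] by (simp add: sum_subtractf algebra_simps)
    finally show ?thesis .
  qed
  then have "avg \<C> (\<lambda>G. \<Sum>c\<in>{..<m} - {a}. codeg a c G) = avg \<C> (\<lambda>G. real (s a) * (lam * real m - 1) + ?f G)"
    by (rule avg_cong)
  then have eq: "(\<Sum>c\<in>{..<m} - {a}. avg \<C> (codeg a c)) = real (s a) * (lam * real m - 1) + avg \<C> ?f"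
    using cls_ne by (simp add: avg_sum avg_add avg_const)
  have *: "\<bar>avg \<C> ?f\<bar> \<le> Q ^ 6 * w\<^sup>2 + exp (- Q) * (real n * (Q * w))"
  proof (rule avg_split)
    fix G assume "G \<in> \<C>" "good G"
    then show "\<bar>?f G\<bar> \<le> Q ^ 6 * w\<^sup>2" using a by (auto simp: good_def)
  next
    fix G assume G: "G \<in> \<C>"
    have "\<bar>?f G\<bar> \<le> (\<Sum>j\<in>rowset G a. \<bar>real (t j) - lam * real m\<bar>)" by (rule sum_abs)
    also have "\<dots> \<le> (\<Sum>j\<in>rowset G a. Q * w)"
      using clsD(5)[OF G] regular by (intro sum_mono) (auto simp: lam_def w_def)
    also have "\<dots> = real (card (rowset G a)) * (Q * w)" by simp
    also have "\<dots> \<le> real n * (Q * w)"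
      using clsD(4)[OF G a] s_le[OF a] scale_bounds by (intro mult_right_mono) auto
    finally show "\<bar>?f G\<bar> \<le> real n * (Q * w)" .
  qed (use scale_bounds in auto)
  have "exp (- Q) * (real n * (Q * w)) \<le> 1 / w ^ 40 * (real n * (w * w))"
    using exp_minus_Q_bounds(1) scale_bounds w_ge[of 1] by (intro mult_mono) auto
  also have "\<dots> \<le> 1"
    using scale_bounds power_increasing[of 4 40 w] by (simp add: field_simps eval_nat_numeral)
  also have "1 \<le> Q ^ 6 * w\<^sup>2"
    using scale_bounds mult_mono[of 1 "Q ^ 6" 1 "w\<^sup>2"] by simp
  finally show ?thesis using * eq by simp
qed

text \<open>Summing \<open>codeg_compare\<close> over all rows c other than \<open>a\<close>
  expresses the codegree of \<open>a\<close> and \<open>b\<close> through the total of the codegrees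
  of \<open>a\<close>, which \<open>codeg_sum\<close> gives, and the total of the row degrees, which
  is the number of edges.\<close>

lemma codeg_avg:
  assumes "a < m" "b < m" "a \<noteq> b"
  shows "\<bar>avg \<C> (codeg a b) - (lam * real (s a) + lam * real (s b) - lam\<^sup>2 * real n)\<bar> \<le> 7 * Q ^ 9"
proof -
  let ?I = "{..<m} - {a}"
  let ?y = "avg \<C> (codeg a b)"
  have cI: "real (card ?I) = real m - 1" using assms by simp
  have "0 < w\<^sup>2 / (2 * Q)" using scale_bounds by simp
  then have m1: "real m - 1 > 0" using m_ge(2) by linarith
  have sum_s: "(\<Sum>c\<in>?I. real (s c)) = lam * real m * real n - real (s a)"
  proof -
    obtain G where G: "G \<in> \<C>" using cls_ne by auto
    note GD = clsD[OF G]
    have grid: "G \<subseteq> {..<m} \<times> {..<n}" using GD(1) by (auto simp: cells_def)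
    have "(\<Sum>c<m. s c) = card G" using card_eq_sum_rowset[OF grid] GD(4) by simp
    also have "\<dots> = (\<Sum>j<n. t j)" using card_eq_sum_colset[OF grid] GD(3) by simp
    finally have "(\<Sum>c<m. real (s c)) = (\<Sum>j<n. real (t j))" by (metis of_nat_sum)
    then show ?thesis using sum.remove[of "{..<m}" a "\<lambda>c. real (s c)"] assms(1) sum_t by simp
  qed
  have "\<bar>\<Sum>c\<in>?I. ?y - avg \<C> (codeg a c) - lam * (real (s b) - real (s c))\<bar> \<le>
      (\<Sum>c\<in>?I. \<bar>?y - avg \<C> (codeg a c) - lam * (real (s b) - real (s c))\<bar>)" by (rule sum_abs)
  also have "\<dots> \<le> (\<Sum>c\<in>?I. 5 * Q ^ 9)"
    by (intro sum_mono codeg_compare) (use assms in auto)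
  also have "\<dots> = (real m - 1) * (5 * Q ^ 9)" by (simp only: sum_constant cI)
  also have "(\<Sum>c\<in>?I. ?y - avg \<C> (codeg a c) - lam * (real (s b) - real (s c))) =
      (real m - 1) * ?y - (\<Sum>c\<in>?I. avg \<C> (codeg a c)) - lam * ((real m - 1) * real (s b) - (lam * real m * real n - real (s a)))"
    unfolding sum_subtractf sum_distrib_left[symmetric] sum_s sum_constant cI ..
  finally have A: "\<bar>(real m - 1) * ?y - (\<Sum>c\<in>?I. avg \<C> (codeg a c)) - lam * ((real m - 1) * real (s b) - (lam * real m * real n - real (s a)))\<bar>
      \<le> (real m - 1) * (5 * Q ^ 9)" .
  define Y where "Y = lam * real (s a) + lam * real (s b) - lam\<^sup>2 * real n"
  \<comment> \<open>An exact rearrangement into the error of the comparison, the error of the double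
    count and a remainder of order w^2. After division by m - 1, which is at least w^2 / (2 * Q),
    each part is a power of Q.\<close>
  have id: "(real m - 1) * (?y - Y) =
     ((real m - 1) * ?y - (\<Sum>c\<in>?I. avg \<C> (codeg a c)) - lam * ((real m - 1) * real (s b) - (lam * real m * real n - real (s a))))
     + ((\<Sum>c\<in>?I. avg \<C> (codeg a c)) - real (s a) * (lam * real m - 1))
     + (lam * (real (s a) - lam * real n) - real (s a) * (1 - lam))"
    by (simp add: Y_def power2_eq_square algebra_simps)
  have C: "\<bar>lam * (real (s a) - lam * real n) - real (s a) * (1 - lam)\<bar> \<le> 2 * w\<^sup>2"
  proof -
    have "\<bar>lam * (real (s a) - lam * real n)\<bar> \<le> 1 * (Q ^ 4 * w)"
      unfolding abs_mult using lam_bounds s_regular[OF assms(1)] by (intro mult_mono) auto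
    moreover have "Q ^ 4 * w \<le> w\<^sup>2" using dev_small(2,3) scale_bounds(5) by linarith
    moreover have "\<bar>real (s a) * (1 - lam)\<bar> \<le> real n * 1"
      unfolding abs_mult using lam_bounds s_le[OF assms(1)] by (intro mult_mono) auto
    ultimately show ?thesis using scale_bounds by linarith
  qed
  have "\<bar>(real m - 1) * (?y - Y)\<bar> \<le> (real m - 1) * (5 * Q ^ 9) + 2 * Q ^ 6 * w\<^sup>2 + 2 * w\<^sup>2"
    unfolding id using A codeg_sum[OF assms(1)] C by linarith
  also have "\<dots> \<le> (real m - 1) * (5 * Q ^ 9) + (real m - 1) * (2 * Q ^ 9)"
  proof -
    have "2 * Q ^ 6 * w\<^sup>2 + 2 * w\<^sup>2 \<le> 4 * Q ^ 6 * w\<^sup>2" using scale_bounds by (simp add: one_le_power)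
    also have "\<dots> = w\<^sup>2 / (2 * Q) * (8 * Q ^ 7)" using scale_bounds by (simp add: eval_nat_numeral)
    also have "\<dots> \<le> (real m - 1) * (2 * Q ^ 9)"
    proof (rule mult_mono)
      have "8 * Q ^ 7 \<le> Q ^ 8" using const_Q[of 8 7] by simp
      moreover have "Q ^ 8 \<le> Q ^ 9" "0 \<le> Q ^ 9" using Q_pow_mono[of 8 9] scale_bounds(1) by simp_all
      ultimately show "8 * Q ^ 7 \<le> 2 * Q ^ 9" by linarith
      show "0 \<le> real m - 1" using m1 by simp
    qed (use m_ge scale_bounds in auto)
    finally show ?thesis by linarith
  qed
  finally have "\<bar>(real m - 1) * (?y - Y)\<bar> \<le> (real m - 1) * (7 * Q ^ 9)" by (simp add: algebra_simps)
  then have "(real m - 1) * \<bar>?y - Y\<bar> \<le> (real m - 1) * (7 * Q ^ 9)"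
    using m1 by (simp add: abs_mult)
  then show ?thesis unfolding Y_def using m1 by simp
qed

end

section \<open>From expected codegrees to the switching ratio\<close>

context good_class begin

lemma w_powers: "1 / w ^ 40 \<le> 1 / w" "1 / w ^ 40 * (4 * real n ^ 2) \<le> 4 / w ^ 4" "1 / w ^ 40 * (2 * real n) \<le> 1 / w ^ 3"
proof -
  have w1: "w \<ge> 1" by (rule scale_bounds(4))
  show "1 / w ^ 40 \<le> 1 / w" using w1 by (intro divide_left_mono) (auto simp: self_le_power)
  have w2: "w ^ 40 = w ^ 36 * w ^ 4" by (simp flip: power_add)
  have n2: "real n ^ 2 = w ^ 4" unfolding scale_bounds(5)[symmetric] by (simp flip: power_mult)
  have "1 / w ^ 40 * (4 * real n ^ 2) = 4 / w ^ 36"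
  proof -
    have "1 / (A * B) * (4 * B) = 4 / A" if "B \<noteq> 0" for A B :: real using that by simp
    moreover have "w ^ 4 \<noteq> 0" using w1 by simp
    ultimately show ?thesis unfolding w2 n2 .
  qed
  also have "\<dots> \<le> 4 / w ^ 4" using w1 by (intro divide_left_mono power_increasing) auto
  finally show "1 / w ^ 40 * (4 * real n ^ 2) \<le> 4 / w ^ 4" .
  have w3: "w ^ 40 = w ^ 3 * (w ^ 35 * w\<^sup>2)" by (simp flip: power_add)
  have "2 \<le> w" using w_ge[of 1] Q_large by simp
  also have "w \<le> w ^ 35" using w1 by (simp add: self_le_power)
  finally have "2 / w ^ 35 \<le> 1" using w1 by simp
  then have le: "2 / w ^ 35 * (1 / w ^ 3) \<le> 1 * (1 / w ^ 3)" using w1 by (intro mult_right_mono) auto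
  have "1 / (A * (B * C)) * (2 * C) = 2 / B * (1 / A)" if "C \<noteq> 0" for A B C :: real
    using that by simp
  moreover have "w\<^sup>2 \<noteq> 0" using w1 by simp
  ultimately have eq: "1 / (w ^ 3 * (w ^ 35 * w\<^sup>2)) * (2 * w\<^sup>2) = 2 / w ^ 35 * (1 / w ^ 3)" .
  show "1 / w ^ 40 * (2 * real n) \<le> 1 / w ^ 3" unfolding w3 scale_bounds(5)[symmetric] eq using le by (simp only: mult_1)
qed

lemma excl_bounds:
  assumes "G \<in> \<C>" "a < m" "b < m"
  shows "card (excl X G a b) \<le> s a"
    "\<bar>real (card (excl X G a b)) - (real (s a) - codeg a b G)\<bar> \<le> 1"
proof -
  note GD = clsD[OF assms(1)]
  have "excl X G a b \<subseteq> rowset G a" by (auto simp: excl_def rowset_def)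
  then show "card (excl X G a b) \<le> s a"
    using card_mono[OF GD(6)[of a]] GD(4)[OF assms(2)] by metis
  have sub: "excl X G a b \<subseteq> {..<n}" using GD(1) by (auto simp: excl_def cells_def)
  have e: "{..<n} \<inter> rowset G a = rowset G a" "{..<n} \<inter> excl X G a b = excl X G a b"
    "{..<n} \<inter> {j \<in> rowset G a. (b, j) \<notin> X} = {j \<in> rowset G a. (b, j) \<notin> X}"
    using sub GD(5)[of a] by auto
  have "real (card (rowset G a)) = real (card (excl X G a b)) + codeg a b G + real (card {j \<in> rowset G a. (b, j) \<notin> X})"
    using rowset_split[OF GD(1), of "{..<n}" a b] by (simp only: e finite_lessThan simp_thms)
  moreover have "card {j \<in> rowset G a. (b, j) \<notin> X} \<le> 1" using forb_card[OF GD(1), of a b] assms by auto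
  ultimately show "\<bar>real (card (excl X G a b)) - (real (s a) - codeg a b G)\<bar> \<le> 1"
    using GD(4)[OF assms(2)] by simp
qed

text \<open>The exchange argument with \<open>h\<close> the indicator of a single column: the two
  cells differ in probability by at most the degree difference divided by the size of the discordant
  set.\<close>

lemma cell_compare:
  assumes "b < m" "c < m" "b \<noteq> c" "(b, j) \<in> X" "(c, j) \<in> X"
  shows "\<bar>avg \<C> (\<lambda>G. of_bool ((b, j) \<in> G)) - avg \<C> (\<lambda>G. of_bool ((c, j) \<in> G))\<bar> \<le> 4 * Q ^ 5 / w"
proof -
  let ?T = "\<lambda>G. discord X G b c"
  let ?e = "\<lambda>G. real (card (excl X G b c)) - real (card (excl X G c b))"
  let ?f = "\<lambda>G. of_bool (j \<in> ?T G) * (?e G / real (card (?T G)))"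
  have finT: "finite (?T G)" for G by (rule finite_discord) simp
  have pick: "(\<Sum>j'\<in>?T G. of_bool (j' = j) * f j') = of_bool (j \<in> ?T G) * f j" for G and f :: "nat \<Rightarrow> real"
  proof -
    have "(\<Sum>j'\<in>?T G. of_bool (j' = j) * f j') = (\<Sum>j'\<in>?T G. if j' = j then f j' else 0)"
      by (intro sum.cong) auto
    then show ?thesis using finT by (simp add: sum.delta)
  qed
  have "(\<Sum>G\<in>\<C>. \<Sum>j'\<in>?T G. of_bool (j' = j) * (of_bool ((b, j') \<in> G) - of_bool ((c, j') \<in> G))) =
     (\<Sum>G\<in>\<C>. (\<Sum>j'\<in>?T G. of_bool (j' = j)) * (?e G / real (card (?T G))))"
    by (rule exchange_difference) (use assms in auto)
  moreover have "(\<Sum>j'\<in>?T G. of_bool (j' = j)) = (of_bool (j \<in> ?T G) :: real)" for G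
    using pick[of "\<lambda>_. 1" G] by simp
  moreover have "(\<Sum>j'\<in>?T G. of_bool (j' = j) * (of_bool ((b, j') \<in> G) - of_bool ((c, j') \<in> G))) =
      (of_bool ((b, j) \<in> G) - of_bool ((c, j) \<in> G) :: real)" for G
    unfolding pick using assms(4,5) by (auto simp: discord_def)
  ultimately have "(\<Sum>G\<in>\<C>. of_bool ((b, j) \<in> G) - of_bool ((c, j) \<in> G)) = (\<Sum>G\<in>\<C>. ?f G)" by simp
  then have "avg \<C> (\<lambda>G. of_bool ((b, j) \<in> G) - of_bool ((c, j) \<in> G)) = avg \<C> ?f"
    by (simp add: avg_def)
  then have "\<bar>avg \<C> (\<lambda>G. of_bool ((b, j) \<in> G)) - avg \<C> (\<lambda>G. of_bool ((c, j) \<in> G))\<bar> = \<bar>avg \<C> ?f\<bar>"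
    by (simp add: avg_diff)
  also have "\<bar>avg \<C> ?f\<bar> \<le> 3 * Q ^ 5 / w + exp (- Q) * 1"
  proof (rule avg_split)
    fix G assume G: "G \<in> \<C>" "good G"
    have T: "real (card (?T G)) \<ge> w\<^sup>2 / Q" by (rule discord_large) (use assms G in auto)
    have "\<bar>(real (s b) - real (s c)) - ?e G\<bar> \<le> 1" using deg_diff[of G b c] clsD[OF G(1)] assms by simp
    then have "\<bar>?e G\<bar> \<le> 3 * Q ^ 4 * w" using s_diff[OF assms(1,2)] dev_small(2) by linarith
    then have "\<bar>?e G\<bar> / real (card (?T G)) \<le> (3 * Q ^ 4 * w) / (w\<^sup>2 / Q)"
      using T scale_bounds by (intro frac_le) auto
    also have "\<dots> = 3 * Q ^ 5 / w" using scale_bounds(1,3) by (simp add: field_simps eval_nat_numeral)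
    finally show "\<bar>?f G\<bar> \<le> 3 * Q ^ 5 / w" using scale_bounds(1,3) by (simp add: abs_mult)
  next
    fix G assume G: "G \<in> \<C>"
    have "card (?T G) = card (excl X G b c) + card (excl X G c b)"
      using card_discord[of G X b c] clsD(1)[OF G] by simp
    then have "\<bar>?e G\<bar> \<le> real (card (?T G))" by simp
    then have "\<bar>?e G\<bar> / real (card (?T G)) \<le> 1"
      by (cases "card (?T G) = 0") (simp_all add: divide_le_eq_1)
    then show "\<bar>?f G\<bar> \<le> 1" by (simp add: abs_mult)
  qed (use scale_bounds in auto)
  also have "exp (- Q) * 1 \<le> 1 / w" using exp_minus_Q_bounds(1) w_powers(1) by simp
  also have "1 / w \<le> Q ^ 5 / w" using scale_bounds by (intro divide_right_mono) auto
  finally show ?thesis by simp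
qed

text \<open>In the digraph case column \<open>j\<close> has n - 1 allowed cells with total
  probability t j. By \<open>cell_compare\<close> each of them is close to the mean.\<close>

lemma cell_avg:
  assumes "z" "b < m" "j < n" "b \<noteq> j"
  shows "\<bar>avg \<C> (\<lambda>G. of_bool ((b, j) \<in> G)) - real (t j) / (real n - 1)\<bar> \<le> 4 * Q ^ 5 / w"
proof -
  let ?I = "{..<m} - {j}"
  let ?p = "\<lambda>i. avg \<C> (\<lambda>G. of_bool ((i, j) \<in> G))"
  have mn: "m = n" using square assms by simp
  have cI: "real (card ?I) = real n - 1" using assms mn by simp
  have "0 < w\<^sup>2 / (2 * Q)" using scale_bounds by simp
  then have n1: "real n - 1 > 0" using m_ge(2) mn by simp
  have "(\<Sum>i\<in>?I. ?p i) = real (t j)"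
  proof -
    have "(\<Sum>i\<in>?I. of_bool ((i, j) \<in> G)) = real (t j)" if G: "G \<in> \<C>" for G
    proof -
      have "(\<Sum>i\<in>?I. of_bool ((i, j) \<in> G)) = real (card {i \<in> ?I. (i, j) \<in> G})"
        by (simp add: of_bool_def sum.inter_filter[symmetric])
      also have "{i \<in> ?I. (i, j) \<in> G} = colset G j"
        using clsD(1)[OF G] assms(1) by (auto simp: colset_def cells_def)
      finally show ?thesis using clsD(3)[OF G assms(3)] by simp
    qed
    then have "avg \<C> (\<lambda>G. \<Sum>i\<in>?I. of_bool ((i, j) \<in> G)) = avg \<C> (\<lambda>G. real (t j))"
      by (rule avg_cong)
    then show ?thesis unfolding avg_sum using cls_ne by (simp add: avg_const)
  qed
  moreover have "\<bar>\<Sum>i\<in>?I. ?p b - ?p i\<bar> \<le> (\<Sum>i\<in>?I. \<bar>?p b - ?p i\<bar>)" by (rule sum_abs)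
  moreover have "(\<Sum>i\<in>?I. \<bar>?p b - ?p i\<bar>) \<le> (\<Sum>i\<in>?I. 4 * Q ^ 5 / w)"
  proof (rule sum_mono)
    fix i assume i: "i \<in> ?I"
    show "\<bar>?p b - ?p i\<bar> \<le> 4 * Q ^ 5 / w"
    proof (cases "i = b")
      case True
      then show ?thesis using scale_bounds by simp
    next
      case False
      show ?thesis by (rule cell_compare) (use i False assms mn in \<open>auto simp: cells_def\<close>)
    qed
  qed
  ultimately have "\<bar>(real n - 1) * ?p b - real (t j)\<bar> \<le> (real n - 1) * (4 * Q ^ 5 / w)"
    unfolding sum_subtractf sum_constant cI by linarith
  moreover have "(real n - 1) * ?p b - real (t j) = (real n - 1) * (?p b - real (t j) / (real n - 1))"
    using n1 by (simp add: right_diff_distrib)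
  ultimately have "(real n - 1) * \<bar>?p b - real (t j) / (real n - 1)\<bar> \<le> (real n - 1) * (4 * Q ^ 5 / w)"
    using n1 by (simp add: abs_mult)
  then show ?thesis using n1 by (rule mult_left_le_imp_le)
qed

definition "row_cap = real n - of_bool z"

text \<open>Pointwise this difference may be 1 in absolute value, which would spoil the switching
  ratio at order 1 / n. In the digraph case it is the indicator of (b, a) minus that of (a, b), and
  these cells have nearly equal probabilities, so the average gains a factor 1 / w.\<close>

lemma forb_avg:
  assumes "a < m" "b < m" "a \<noteq> b"
  shows "\<bar>avg \<C> (\<lambda>G. (real (s b) - real (s a)) - (real (card (excl X G b a)) - real (card (excl X G a b))))\<bar> \<le> 9 * Q ^ 5 / w"
proof -
  let ?e = "\<lambda>G. (real (s b) - real (s a)) - (real (card (excl X G b a)) - real (card (excl X G a b)))"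
  let ?F = "\<lambda>G u v. {j \<in> rowset G u. (v, j) \<notin> X}"
  have e: "?e G = real (card (?F G b a)) - real (card (?F G a b))" if G: "G \<in> \<C>" for G
  proof -
    note GD = clsD[OF G]
    have i: "{..<n} \<inter> rowset G u = rowset G u" "{..<n} \<inter> excl X G u v = excl X G u v"
      "{..<n} \<inter> ?F G u v = ?F G u v" for u v
      using GD(1) by (auto simp: excl_def rowset_def cells_def)
    have "rowset G b \<inter> rowset G a = rowset G a \<inter> rowset G b" by auto
    then show ?thesis
      using rowset_split[OF GD(1) finite_lessThan, of n a b] rowset_split[OF GD(1) finite_lessThan, of n b a]
        GD(4)[OF assms(1)] GD(4)[OF assms(2)]
      unfolding i by simp
  qed
  show ?thesis
  proof (cases z)
    case False
    then have F: "?F G u v = {}" if "G \<in> \<C>" "v < m" for G u v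
      using that clsD(5)[OF that(1), of u] by (auto simp: cells_def)
    have "?e G = 0" if "G \<in> \<C>" for G
      unfolding e[OF that] F[OF that assms(1)] F[OF that assms(2)] by simp
    then have "avg \<C> ?e = avg \<C> (\<lambda>G. 0)" by (rule avg_cong)
    also have "\<dots> = 0" by (simp add: avg_def)
    finally show ?thesis using scale_bounds by simp
  next
    case True
    then have mn: "m = n" by (rule square)
    have ab: "a < n" "b < n" "a < m" "b < m" using assms mn by auto
    have "?F G u v = (if (u, v) \<in> G then {v} else {})" if "G \<in> \<C>" "v < m" for G u v
      using that clsD(5)[OF that(1), of u] mn True by (auto simp: cells_def rowset_def)
    then have "real (card (?F G u v)) = of_bool ((u, v) \<in> G)" if "G \<in> \<C>" "v < m" for G u v using that by simp
    then have "avg \<C> ?e = avg \<C> (\<lambda>G. of_bool ((b, a) \<in> G) - of_bool ((a, b) \<in> G))"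
      using e assms by (intro avg_cong) simp
    also have "\<dots> = avg \<C> (\<lambda>G. of_bool ((b, a) \<in> G)) - avg \<C> (\<lambda>G. of_bool ((a, b) \<in> G))" by (rule avg_diff)
    finally have eq: "avg \<C> ?e = avg \<C> (\<lambda>G. of_bool ((b, a) \<in> G)) - avg \<C> (\<lambda>G. of_bool ((a, b) \<in> G))" .
    have "\<bar>real (t a) / (real n - 1) - real (t b) / (real n - 1)\<bar> \<le> 4 * Q\<^sup>2 / w"
    proof -
      have n1: "real n - 1 \<ge> w\<^sup>2 / (2 * Q)" using m_ge(2) mn by simp
      have "0 < w\<^sup>2 / (2 * Q)" using scale_bounds by simp
      then have "\<bar>real (t a) / (real n - 1) - real (t b) / (real n - 1)\<bar> = \<bar>real (t a) - real (t b)\<bar> / (real n - 1)"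
        using n1 by (simp flip: diff_divide_distrib)
      also have "\<dots> \<le> (2 * Q * w) / (w\<^sup>2 / (2 * Q))"
      proof (rule frac_le)
        show "\<bar>real (t a) - real (t b)\<bar> \<le> 2 * Q * w"
          using regular[of a] regular[of b] assms mn by (simp add: w_def)
      qed (use n1 \<open>0 < w\<^sup>2 / (2 * Q)\<close> scale_bounds in auto)
      also have "\<dots> = 4 * Q\<^sup>2 / w" using scale_bounds(1,3) by (simp add: field_simps eval_nat_numeral)
      finally show ?thesis .
    qed
    also have "4 * Q\<^sup>2 / w \<le> Q ^ 5 / w"
    proof (rule divide_right_mono)
      show "4 * Q\<^sup>2 \<le> Q ^ 5" using const_Q[of 4 2] Q_pow_mono[of 3 5] by (simp add: eval_nat_numeral)
    qed (use scale_bounds in auto)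
    finally have "\<bar>real (t a) / (real n - 1) - real (t b) / (real n - 1)\<bar> \<le> Q ^ 5 / w" .
    moreover have "\<bar>avg \<C> (\<lambda>G. of_bool ((b, a) \<in> G)) - real (t a) / (real n - 1)\<bar> \<le> 4 * Q ^ 5 / w"
      "\<bar>avg \<C> (\<lambda>G. of_bool ((a, b) \<in> G)) - real (t b) / (real n - 1)\<bar> \<le> 4 * Q ^ 5 / w"
      using cell_avg[of b a] cell_avg[of a b] assms(3) ab True by blast+
    ultimately have "\<bar>avg \<C> ?e\<bar> \<le> 4 * Q ^ 5 / w + Q ^ 5 / w + 4 * Q ^ 5 / w" unfolding eq by linarith
    then show ?thesis by simp
  qed
qed

text \<open>\<open>R\<close> is the ratio of the binomial weights of the two degree sequences, and \<open>D0\<close> is the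
  predicted number of columns in \<open>excl X G a b\<close>, plus one.\<close>

lemma switch_avg_ge:
  assumes ab: "a < m" "b < m" "a \<noteq> b"
  defines "D0 \<equiv> (real (s a) + 1) * (row_cap - real (s b) + 1) / (row_cap + 1)"
  defines "R \<equiv> 1 + (real (s b) - real (s a) - 1) / D0"
  shows "D0 > 0" "R \<ge> 1/2"
    "avg \<C> (\<lambda>G. real (card (excl X G b a)) / (real (card (excl X G a b)) + 1)) \<ge> R * (1 - 2 * Q ^ 16 / w ^ 3)"
proof -
  define \<Delta> where "\<Delta> = Q ^ 4 * w"
  define \<Lambda>n where "\<Lambda>n = lam * (1 - lam) * real n"
  define d where "d = real (s b) - real (s a) - 1"
  define x where "x G = real (card (excl X G a b)) + 1" for G
  define e where "e G = (real (s b) - real (s a)) - (real (card (excl X G b a)) - real (card (excl X G a b)))" for G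
  define u where "u = real (s a) - lam * real n"
  define v where "v = real (s b) - lam * real n"
  define V where "V = w\<^sup>2 / (2 * Q)"
  have uv: "\<bar>u\<bar> \<le> \<Delta>" "\<bar>v\<bar> \<le> \<Delta>" using s_regular ab by (auto simp: u_def v_def \<Delta>_def)
  have \<Delta>1: "\<Delta> \<ge> 1" using dev_small by (simp add: \<Delta>_def)
  have d_le: "\<bar>d\<bar> \<le> 3 * \<Delta>" using s_diff[OF ab(2,1)] \<Delta>1 by (auto simp: d_def \<Delta>_def)
  have Vpos: "V > 0" using scale_bounds by (simp add: V_def)
  have Vge: "50 * \<Delta> \<le> V" using dev_small(1) by (simp add: \<Delta>_def V_def field_simps)
  have \<Lambda>n: "\<Lambda>n \<ge> 2 * V"
  proof -
    have "1 / Q * real n \<le> lam * (1 - lam) * real n" using lam_bounds by (intro mult_right_mono) auto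
    moreover have "1 / Q * real n = 2 * V" using scale_bounds(5) by (simp add: V_def)
    ultimately show ?thesis by (simp add: \<Lambda>n_def)
  qed
  have Q8: "Q ^ 8 + 2 \<le> \<Delta>"
  proof -
    have "2 * Q ^ 8 \<le> w" using const_Q[of 2 8] w_ge[of 9] by simp
    moreover have "2 \<le> Q ^ 8" using Q_pow_mono[of 1 8] Q_large by simp
    moreover have "1 * w \<le> Q ^ 4 * w" using scale_bounds by (intro mult_right_mono) auto
    ultimately show ?thesis unfolding \<Delta>_def by linarith
  qed
  \<comment> \<open>The product form of \<open>D0\<close> makes \<open>R\<close> exactly the ratio
    of binomial weights. Up to a power of Q it agrees with the linear expression in \<open>u\<close>
    and \<open>v\<close> that \<open>codeg_avg\<close> yields for the mean of
    \<open>x\<close>.\<close>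
  have D0_loc: "\<bar>D0 - (\<Lambda>n + (1 - lam) * u - lam * v)\<bar> \<le> Q ^ 8 + 2"
  proof -
    define N1 where "N1 = row_cap + 1"
    have N1: "N1 = real n \<or> N1 = real n + 1" by (auto simp: N1_def row_cap_def)
    have npos: "real n > 0" using scale_bounds by simp
    have N1p: "N1 > 0" using N1 npos by auto
    have sb: "0 \<le> real (s b)" "real (s b) \<le> real n" "0 \<le> real (s a)" "real (s a) \<le> real n" using s_le ab by auto
    have D0_eq: "D0 = real (s a) + 1 - (real (s a) + 1) * real (s b) / N1"
      using N1p by (simp add: D0_def N1_def field_simps)
    have id: "D0 - (\<Lambda>n + (1 - lam) * u - lam * v) =
      (1 - real (s b) / N1) + real (s a) * real (s b) * (1 / real n - 1 / N1) - u * v / real n"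
      using N1p npos unfolding D0_eq \<Lambda>n_def u_def v_def by (simp add: field_simps)
    have "0 \<le> real (s b) / N1" "real (s b) / N1 \<le> 1" using sb N1 N1p by auto
    moreover have "0 \<le> real (s a) * real (s b) * (1 / real n - 1 / N1)"
      "real (s a) * real (s b) * (1 / real n - 1 / N1) \<le> 1"
    proof -
      have k: "0 \<le> 1 / real n - 1 / N1" "1 / real n - 1 / N1 \<le> 1 / (real n * real n)"
        using N1 npos by (auto simp: field_simps)
      then show "0 \<le> real (s a) * real (s b) * (1 / real n - 1 / N1)" by simp
      have "real (s a) * real (s b) * (1 / real n - 1 / N1) \<le> (real n * real n) * (1 / (real n * real n))"
        using k sb by (intro mult_mono) auto
      then show "real (s a) * real (s b) * (1 / real n - 1 / N1) \<le> 1" using npos by simp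
    qed
    moreover have "\<bar>u * v / real n\<bar> \<le> Q ^ 8"
    proof -
      have "\<bar>u * v\<bar> \<le> \<Delta> * \<Delta>" unfolding abs_mult using uv by (intro mult_mono) auto
      also have "\<dots> = Q ^ 8 * real n" unfolding scale_bounds(5)[symmetric] \<Delta>_def by (simp add: eval_nat_numeral)
      finally show ?thesis using npos by (simp add: field_simps)
    qed
    ultimately show ?thesis unfolding id by linarith
  qed
  have lin: "\<bar>(1 - lam) * u - lam * v\<bar> \<le> 2 * \<Delta>"
  proof -
    have "\<bar>1 - lam\<bar> * \<bar>u\<bar> \<le> 1 * \<Delta>" "\<bar>lam\<bar> * \<bar>v\<bar> \<le> 1 * \<Delta>"
      by (intro mult_mono; use uv lam_bounds in force)+
    then show ?thesis unfolding abs_mult[symmetric] by linarith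
  qed
  have D0\<Lambda>: "\<bar>D0 - \<Lambda>n\<bar> \<le> 3 * \<Delta>" using D0_loc lin Q8 by linarith
  have D0V: "D0 \<ge> V" using D0\<Lambda> \<Lambda>n Vge Vpos \<Delta>1 by linarith
  then show D0pos: "D0 > 0" using Vpos by linarith
  have V1: "V \<ge> 1" using Vge \<Delta>1 by linarith
  have xpos: "x G \<ge> 1" for G by (simp add: x_def)
  have e1: "\<bar>e G\<bar> \<le> 1" if "G \<in> \<C>" for G
    using deg_diff[of G b a] clsD[OF that] ab by (simp add: e_def)
  \<comment> \<open>On a good graph the size of the discordant set fixes the sum of the two
    exclusive degrees, and the row degrees fix their difference up to 1. This locates
    \<open>x\<close> only within order w.\<close>
  have x_good: "\<bar>x G - D0\<bar> \<le> 6 * \<Delta>" "x G \<ge> V" if G: "G \<in> \<C>" "good G" for G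
  proof -
    have "\<bar>real (card (discord X G a b)) - 2 * lam * (1 - lam) * real n\<bar> \<le> \<Delta>"
      using G ab by (auto simp: good_def \<Delta>_def)
    moreover have "card (discord X G a b) = card (excl X G a b) + card (excl X G b a)"
      using card_discord[of G X a b] clsD(1)[OF G(1)] by simp
    moreover have "2 * lam * (1 - lam) * real n = 2 * \<Lambda>n" by (simp add: \<Lambda>n_def)
    ultimately have "\<bar>2 * (x G - 1) + (real (s b) - real (s a)) - e G - 2 * \<Lambda>n\<bar> \<le> \<Delta>"
      by (simp add: x_def e_def)
    moreover have "\<bar>real (s b) - real (s a)\<bar> \<le> 2 * \<Delta>" using s_diff[OF ab(2,1)] by (simp add: \<Delta>_def)
    ultimately have "\<bar>x G - 1 - \<Lambda>n\<bar> \<le> 2 * \<Delta>" using e1[OF G(1)] \<Delta>1 by (smt (verit))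
    then show "\<bar>x G - D0\<bar> \<le> 6 * \<Delta>" "x G \<ge> V" using D0\<Lambda> \<Delta>1 \<Lambda>n Vge Vpos by linarith+
  qed
  have nbig: "real n \<ge> 100" using dev_small(2,3) by linarith
  have x_all: "\<bar>x G - D0\<bar> \<le> 2 * real n" if G: "G \<in> \<C>" for G
  proof -
    have "x G \<le> real n + 1" using excl_bounds(1)[OF G ab(1,2)] s_le[OF ab(1)] by (simp add: x_def)
    moreover have "lam * (1 - lam) \<le> 1 * 1" using lam_bounds by (intro mult_mono) auto
    then have "\<Lambda>n \<le> real n" unfolding \<Lambda>n_def by (intro mult_left_le_one_le) (use lam_bounds in auto)
    then have "D0 \<le> real n + 3 * \<Delta>" using D0\<Lambda> by linarith
    moreover have "100 * \<Delta> \<le> real n" using dev_small(3) by (simp add: \<Delta>_def)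
    ultimately show ?thesis using xpos[of G] D0pos nbig by linarith
  qed
  have avg_x: "\<bar>avg \<C> x - D0\<bar> \<le> 8 * Q ^ 9"
  proof -
    let ?y = "avg \<C> (codeg a b)"
    have "avg \<C> x - (real (s a) + 1 - ?y) = avg \<C> (\<lambda>G. x G - (real (s a) + 1 - codeg a b G))"
      using cls_ne by (simp add: avg_diff avg_const avg_add)
    moreover have "\<bar>avg \<C> (\<lambda>G. x G - (real (s a) + 1 - codeg a b G))\<bar> \<le> 1"
    proof (rule abs_avg_le_const)
      fix G assume "G \<in> \<C>"
      then show "\<bar>x G - (real (s a) + 1 - codeg a b G)\<bar> \<le> 1"
        using excl_bounds(2)[of G a b] ab by (simp add: x_def algebra_simps)
    qed (use cls_ne in auto)
    ultimately have 1: "\<bar>avg \<C> x - (real (s a) + 1 - ?y)\<bar> \<le> 1" by simp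
    have 2: "\<bar>?y - (lam * real (s a) + lam * real (s b) - lam\<^sup>2 * real n)\<bar> \<le> 7 * Q ^ 9"
      using codeg_avg ab by blast
    have 3: "real (s a) - (lam * real (s a) + lam * real (s b) - lam\<^sup>2 * real n) = \<Lambda>n + (1 - lam) * u - lam * v"
      by (simp add: \<Lambda>n_def u_def v_def power2_eq_square algebra_simps)
    have "Q ^ 8 + 4 \<le> Q ^ 9" using const_Q[of 2 8] Q_pow_mono[of 1 8] Q_large by simp
    then show ?thesis using 1 2 3 D0_loc by linarith
  qed
  have V2: "V = w\<^sup>2 / (2 * Q)" by (rule V_def)
  have iV2: "1 / D0\<^sup>2 \<le> 4 * Q\<^sup>2 / w ^ 4"
  proof -
    have "1 / D0\<^sup>2 \<le> 1 / V\<^sup>2" using D0V Vpos by (intro divide_left_mono power_mono) auto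
    also have "\<dots> = 4 * Q\<^sup>2 / w ^ 4" using scale_bounds(1,3) by (simp add: V_def field_simps eval_nat_numeral)
    finally show ?thesis .
  qed
  have iV1: "1 / D0 \<le> 2 * Q / w\<^sup>2"
  proof -
    have "1 / D0 \<le> 1 / V" using D0V Vpos by (intro divide_left_mono) auto
    then show ?thesis using scale_bounds(1,3) by (simp add: V_def field_simps)
  qed
  \<comment> \<open>Second-order expansion of 1 / x at \<open>D0\<close>. The linear term sees only
    the mean of \<open>x\<close>, known within a power of Q, and the quadratic term is of order w^2
    / w^6. Both are of order w^(-4), although \<open>x\<close> itself fluctuates by w.\<close>
  have inv: "\<bar>avg \<C> (\<lambda>G. 1 / x G) - 1 / D0\<bar> \<le> 324 * Q ^ 11 / w ^ 4"
  proof -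
    let ?q = "\<lambda>G. (x G - D0)\<^sup>2 / (x G * D0\<^sup>2)"
    have id: "1 / x G = 1 / D0 - (x G - D0) / D0\<^sup>2 + ?q G" for G
    proof -
      have "x G \<noteq> 0" "D0 \<noteq> 0" using xpos[of G] D0pos by auto
      then show ?thesis by (simp add: field_simps power2_eq_square)
    qed
    have "\<bar>avg \<C> ?q\<bar> \<le> 288 * Q ^ 11 / w ^ 4 + exp (- Q) * (4 * real n ^ 2)"
    proof (rule avg_split)
      fix G assume G: "G \<in> \<C>" "good G"
      have "(x G - D0)\<^sup>2 \<le> (6 * \<Delta>)\<^sup>2" using power_mono[OF x_good(1)[OF G], of 2] by simp
      moreover have "V * V\<^sup>2 \<le> x G * D0\<^sup>2"
        using x_good(2)[OF G] D0V Vpos by (intro mult_mono power_mono) auto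
      ultimately have "?q G \<le> (6 * \<Delta>)\<^sup>2 / (V * V\<^sup>2)"
        using Vpos by (intro frac_le) auto
      also have "\<dots> = 288 * Q ^ 11 / w ^ 4"
        using scale_bounds(1,3) by (simp add: \<Delta>_def V_def field_simps eval_nat_numeral)
      finally show "\<bar>?q G\<bar> \<le> 288 * Q ^ 11 / w ^ 4" using xpos[of G] by simp
    next
      fix G assume G: "G \<in> \<C>"
      have "(x G - D0)\<^sup>2 \<le> (2 * real n)\<^sup>2" using power_mono[OF x_all[OF G], of 2] by simp
      moreover have "1 * 1 \<le> x G * D0\<^sup>2"
        using xpos[of G] D0V V1 by (intro mult_mono one_le_power) auto
      ultimately have "?q G \<le> (2 * real n)\<^sup>2 / 1" by (intro frac_le) auto
      then show "\<bar>?q G\<bar> \<le> 4 * real n ^ 2" using xpos[of G] by (simp add: power_mult_distrib)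
    qed (use scale_bounds in auto)
    also have "exp (- Q) * (4 * real n ^ 2) \<le> 1 / w ^ 40 * (4 * real n ^ 2)"
      using exp_minus_Q_bounds(1) by (intro mult_right_mono) auto
    also have "\<dots> \<le> 4 * Q ^ 11 / w ^ 4"
      using w_powers(2) scale_bounds one_le_power[of Q 11] divide_right_mono[of 4 "4 * Q ^ 11" "w ^ 4"] by simp
    finally have q: "\<bar>avg \<C> ?q\<bar> \<le> 292 * Q ^ 11 / w ^ 4" by simp
    have "avg \<C> (\<lambda>G. 1 / x G) = avg \<C> (\<lambda>G. 1 / D0 - (x G - D0) * (1 / D0\<^sup>2) + ?q G)"
      by (rule avg_cong) (simp add: id)
    also have "\<dots> = 1 / D0 - (avg \<C> x - D0) * (1 / D0\<^sup>2) + avg \<C> ?q"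
    proof -
      have "avg \<C> (\<lambda>G. (x G - D0) * (1 / D0\<^sup>2)) = (avg \<C> x - D0) * (1 / D0\<^sup>2)"
        using avg_cmult[of \<C> "1 / D0\<^sup>2" "\<lambda>G. x G - D0"] cls_ne by (simp add: mult.commute avg_diff avg_const)
      then show ?thesis using cls_ne by (simp add: avg_add avg_diff avg_const)
    qed
    finally have "\<bar>avg \<C> (\<lambda>G. 1 / x G) - 1 / D0\<bar> \<le> \<bar>(avg \<C> x - D0) * (1 / D0\<^sup>2)\<bar> + \<bar>avg \<C> ?q\<bar>" by linarith
    also have "\<bar>(avg \<C> x - D0) * (1 / D0\<^sup>2)\<bar> \<le> (8 * Q ^ 9) * (4 * Q\<^sup>2 / w ^ 4)"
      unfolding abs_mult using avg_x iV2 scale_bounds by (intro mult_mono) auto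
    also have "\<dots> = 32 * Q ^ 11 / w ^ 4" by (simp add: eval_nat_numeral)
    finally show ?thesis using q add_divide_distrib[of "32 * Q ^ 11" "292 * Q ^ 11" "w ^ 4"] by simp
  qed
  have dinv: "\<bar>d * (avg \<C> (\<lambda>G. 1 / x G) - 1 / D0)\<bar> \<le> 972 * Q ^ 15 / w ^ 3"
  proof -
    have "\<bar>d * (avg \<C> (\<lambda>G. 1 / x G) - 1 / D0)\<bar> \<le> (3 * \<Delta>) * (324 * Q ^ 11 / w ^ 4)"
      unfolding abs_mult using d_le inv \<Delta>1 by (intro mult_mono) auto
    also have "\<dots> = 972 * Q ^ 15 / w ^ 3" using scale_bounds(1,3) by (simp add: \<Delta>_def field_simps eval_nat_numeral)
    finally show ?thesis .
  qed
  \<comment> \<open>Replacing x by \<open>D0\<close> costs order w / w^4; the main term e / D0 is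
    small on average by \<open>forb_avg\<close>.\<close>
  have einv: "\<bar>avg \<C> (\<lambda>G. e G / x G)\<bar> \<le> 43 * Q ^ 6 / w ^ 3"
  proof -
    let ?q = "\<lambda>G. e G * (D0 - x G) / (x G * D0)"
    have "\<bar>avg \<C> (\<lambda>G. e G)\<bar> \<le> 9 * Q ^ 5 / w" unfolding e_def by (rule forb_avg[OF ab])
    then have avg_e: "\<bar>avg \<C> e\<bar> \<le> 9 * Q ^ 5 / w" by simp
    have id: "e G / x G = (1 / D0) * e G + ?q G" for G
    proof -
      have "x G \<noteq> 0" "D0 \<noteq> 0" using xpos[of G] D0pos by auto
      then show ?thesis by (simp add: field_simps)
    qed
    have "\<bar>avg \<C> ?q\<bar> \<le> 24 * Q ^ 6 / w ^ 3 + exp (- Q) * (2 * real n)"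
    proof (rule avg_split)
      fix G assume G: "G \<in> \<C>" "good G"
      have "\<bar>?q G\<bar> = \<bar>e G\<bar> * \<bar>x G - D0\<bar> / (x G * D0)"
        using xpos[of G] D0pos by (simp add: abs_mult abs_minus_commute)
      also have "\<dots> \<le> (1 * (6 * \<Delta>)) / (V * V)"
        using e1[OF G(1)] x_good[OF G] D0V Vpos by (intro frac_le mult_mono) auto
      also have "\<dots> = 24 * Q ^ 6 / w ^ 3"
        using scale_bounds(1,3) by (simp add: \<Delta>_def V_def field_simps eval_nat_numeral)
      finally show "\<bar>?q G\<bar> \<le> 24 * Q ^ 6 / w ^ 3" .
    next
      fix G assume G: "G \<in> \<C>"
      have "\<bar>?q G\<bar> = \<bar>e G\<bar> * \<bar>x G - D0\<bar> / (x G * D0)"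
        using xpos[of G] D0pos by (simp add: abs_mult abs_minus_commute)
      also have "\<dots> \<le> (1 * (2 * real n)) / (1 * 1)"
        using e1[OF G] x_all[OF G] D0V V1 xpos[of G] by (intro frac_le mult_mono) auto
      finally show "\<bar>?q G\<bar> \<le> 2 * real n" by simp
    qed (use scale_bounds in auto)
    also have "exp (- Q) * (2 * real n) \<le> 1 / w ^ 40 * (2 * real n)"
      using exp_minus_Q_bounds(1) by (intro mult_right_mono) auto
    also have "\<dots> \<le> Q ^ 6 / w ^ 3"
      using w_powers(3) scale_bounds one_le_power[of Q 6] divide_right_mono[of 1 "Q ^ 6" "w ^ 3"] by simp
    finally have q: "\<bar>avg \<C> ?q\<bar> \<le> 25 * Q ^ 6 / w ^ 3" by simp
    have "avg \<C> (\<lambda>G. e G / x G) = avg \<C> (\<lambda>G. (1 / D0) * e G + ?q G)"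
      by (rule avg_cong) (rule id)
    also have "\<dots> = (1 / D0) * avg \<C> e + avg \<C> ?q" by (simp only: avg_add avg_cmult)
    finally have "\<bar>avg \<C> (\<lambda>G. e G / x G)\<bar> \<le> \<bar>(1 / D0) * avg \<C> e\<bar> + \<bar>avg \<C> ?q\<bar>" by linarith
    also have "\<bar>(1 / D0) * avg \<C> e\<bar> \<le> (2 * Q / w\<^sup>2) * (9 * Q ^ 5 / w)"
      unfolding abs_mult using iV1 D0pos scale_bounds avg_e by (intro mult_mono) auto
    also have "\<dots> = 18 * Q ^ 6 / w ^ 3" using scale_bounds(1,3) by (simp add: field_simps eval_nat_numeral)
    finally show ?thesis using q add_divide_distrib[of "18 * Q ^ 6" "25 * Q ^ 6" "w ^ 3"] by simp
  qed
  have R_def': "R = 1 + d / D0" by (simp add: R_def d_def)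
  show Rhalf: "R \<ge> 1/2"
  proof -
    have "\<bar>d / D0\<bar> \<le> (3 * \<Delta>) / V"
      unfolding abs_divide using d_le D0V Vpos by (intro frac_le) auto
    also have "\<dots> \<le> 1/2" using Vge Vpos \<Delta>1 by (simp add: field_simps)
    finally show ?thesis unfolding R_def' by linarith
  qed
  \<comment> \<open>The numerator is x + d - e, so the ratio splits into 1 + d / x - e / x.\<close>
  have "avg \<C> (\<lambda>G. real (card (excl X G b a)) / (real (card (excl X G a b)) + 1)) =
      avg \<C> (\<lambda>G. 1 + d * (1 / x G) - e G / x G)"
  proof (rule avg_cong)
    fix G
    have "x G \<noteq> 0" using xpos[of G] by auto
    moreover have "real (card (excl X G b a)) = x G + d - e G" by (simp add: x_def d_def e_def)
    ultimately show "real (card (excl X G b a)) / (real (card (excl X G a b)) + 1) = 1 + d * (1 / x G) - e G / x G"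
      by (simp add: x_def[symmetric] add_divide_distrib diff_divide_distrib)
  qed
  also have "\<dots> = 1 + d * avg \<C> (\<lambda>G. 1 / x G) - avg \<C> (\<lambda>G. e G / x G)"
    unfolding avg_add avg_diff avg_cmult using cls_ne by (simp add: avg_const)
  also have "\<dots> = R + d * (avg \<C> (\<lambda>G. 1 / x G) - 1 / D0) - avg \<C> (\<lambda>G. e G / x G)"
    by (simp add: R_def' right_diff_distrib)
  finally have main: "avg \<C> (\<lambda>G. real (card (excl X G b a)) / (real (card (excl X G a b)) + 1)) =
      R + d * (avg \<C> (\<lambda>G. 1 / x G) - 1 / D0) - avg \<C> (\<lambda>G. e G / x G)" .
  have "972 * Q ^ 15 / w ^ 3 + 43 * Q ^ 6 / w ^ 3 \<le> Q ^ 16 / w ^ 3"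
  proof -
    have "972 * Q ^ 15 + 43 * Q ^ 6 \<le> 1015 * Q ^ 15" using Q_pow_mono[of 6 15] by simp
    also have "\<dots> \<le> Q ^ 16" using const_Q[of 1015 15] by simp
    finally have "(972 * Q ^ 15 + 43 * Q ^ 6) / w ^ 3 \<le> Q ^ 16 / w ^ 3"
      using scale_bounds by (intro divide_right_mono) auto
    then show ?thesis by (simp add: add_divide_distrib)
  qed
  \<comment> \<open>The bound \<open>R \<ge> 1/2\<close> turns the additive error into a relative
    one, which doubles it.\<close>
  moreover have "Q ^ 16 / w ^ 3 \<le> R * (2 * Q ^ 16 / w ^ 3)"
  proof -
    have "1/2 * (2 * Q ^ 16 / w ^ 3) \<le> R * (2 * Q ^ 16 / w ^ 3)"
      using Rhalf scale_bounds by (intro mult_right_mono) auto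
    then show ?thesis by simp
  qed
  ultimately show "avg \<C> (\<lambda>G. real (card (excl X G b a)) / (real (card (excl X G a b)) + 1)) \<ge> R * (1 - 2 * Q ^ 16 / w ^ 3)"
    unfolding main using dinv einv by (simp add: right_diff_distrib)
qed

end

section \<open>Typical graphs with given column degrees\<close>

lemma card_slice_mem:
  assumes "finite X" "x \<in> X"
  shows "real (card {A \<in> slice X k. x \<in> A}) * real (card X) = real k * real (card (slice X k))"
proof (cases "k = 0")
  case True
  then have "{A \<in> slice X k. x \<in> A} = {}" using assms by (auto simp: slice_def dest: finite_subset)
  then have "card {A \<in> slice X k. x \<in> A} = 0" by (simp only: card.empty)
  then show ?thesis using True by simp
next
  case False
  then have k: "0 < k" by simp
  note sp = slice_remove_split[OF assms k]
  have "card {A \<in> slice X k. x \<in> A} = (card X - 1) choose (k - 1)"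
    unfolding sp(2)[symmetric] card_image[OF sp(4)] using assms by (simp add: card_slice)
  then have "card {A \<in> slice X k. x \<in> A} * card X = k * card (slice X k)"
    using times_binomial_minus1_eq[OF k, of "card X"] assms by (simp add: card_slice mult.commute)
  then show ?thesis by (metis of_nat_mult)
qed

lemma card_slice_mem_notmem:
  assumes "finite X" "x \<in> X" "y \<in> X" "x \<noteq> y" "k \<le> card X"
  shows "real (card {A \<in> slice X k. x \<in> A \<and> y \<notin> A}) * (real (card X) * (real (card X) - 1)) =
    real k * (real (card X) - real k) * real (card (slice X k))"
proof -
  have cX: "card (X - {y}) = card X - 1" using assms by simp
  have pos: "card X \<ge> 1" using assms by (metis One_nat_def Suc_leI card_gt_0_iff empty_iff)
  have "{A \<in> slice X k. x \<in> A \<and> y \<notin> A} = {A \<in> slice (X - {y}) k. x \<in> A}" by (auto simp: slice_def)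
  then have "real (card {A \<in> slice X k. x \<in> A \<and> y \<notin> A}) * (real (card X) - 1) = real k * real (card (slice (X - {y}) k))"
    using card_slice_mem[of "X - {y}" x k] assms cX pos by (simp add: of_nat_diff)
  moreover have "real (card X) * real (card (slice (X - {y}) k)) = (real (card X) - real k) * real (card (slice X k))"
  proof -
    have "card X * card (slice (X - {y}) k) = (card X - k) * card (slice X k)"
      using binomial_absorb_comp[of "card X" k] assms by (simp add: card_slice)
    then have "real (card X * card (slice (X - {y}) k)) = real ((card X - k) * card (slice X k))" by (simp only:)
    then show ?thesis using assms(5) by (simp add: of_nat_diff)
  qed
  ultimately show ?thesis by algebra
qed

text \<open>Once \<open>x\<close> is fixed inside and \<open>y\<close> outside, the remaining k - 1
  elements form a uniform subset of the other card X - 2 points.\<close>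

lemma card_slice_mem_mem_notmem:
  assumes "finite X" "u \<in> X" "x \<in> X" "y \<in> X" "u \<noteq> x" "u \<noteq> y" "x \<noteq> y"
  shows "real (card {A \<in> slice X k. x \<in> A \<and> y \<notin> A \<and> u \<in> A}) * (real (card X) - 2) =
    (real k - 1) * real (card {A \<in> slice X k. x \<in> A \<and> y \<notin> A})"
proof (cases "k = 0")
  case True
  then have "{A \<in> slice X k. x \<in> A \<and> y \<notin> A} = {}" "{A \<in> slice X k. x \<in> A \<and> y \<notin> A \<and> u \<in> A} = {}"
    using assms finite_subset[of _ X] by (auto simp: slice_def card_eq_0_iff)
  then show ?thesis by (simp only: card.empty)
next
  case False
  then have k: "0 < k" by simp
  let ?Y = "X - {y}" and ?W = "X - {y} - {x}"
  have xY: "finite ?Y" "x \<in> ?Y" using assms by auto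
  note sp = slice_remove_split[OF xY k]
  have cW: "card ?W = card X - 2" using assms by simp
  have "card {u, x, y} \<le> card X" using assms by (intro card_mono) auto
  then have c3: "card X \<ge> 2" using assms by simp
  have "{A \<in> slice X k. x \<in> A \<and> y \<notin> A} = {A \<in> slice ?Y k. x \<in> A}" by (auto simp: slice_def)
  then have 1: "{A \<in> slice X k. x \<in> A \<and> y \<notin> A} = insert x ` slice ?W (k - 1)" using sp(2) by simp
  have 2: "{A \<in> slice X k. x \<in> A \<and> y \<notin> A \<and> u \<in> A} = insert x ` {A \<in> slice ?W (k - 1). u \<in> A}"
  proof -
    have "{A \<in> slice X k. x \<in> A \<and> y \<notin> A \<and> u \<in> A} = {A \<in> insert x ` slice ?W (k - 1). u \<in> A}"
      unfolding 1[symmetric] by auto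
    also have "\<dots> = insert x ` {A \<in> slice ?W (k - 1). u \<in> A}" using assms by auto
    finally show ?thesis .
  qed
  have "card {A \<in> slice X k. x \<in> A \<and> y \<notin> A} = card (slice ?W (k - 1))"
    unfolding 1 by (rule card_image[OF sp(4)])
  moreover have "card {A \<in> slice X k. x \<in> A \<and> y \<notin> A \<and> u \<in> A} = card {A \<in> slice ?W (k - 1). u \<in> A}"
    unfolding 2 by (rule card_image) (rule inj_on_subset[OF sp(4)], auto)
  moreover have "real (card {A \<in> slice ?W (k - 1). u \<in> A}) * real (card ?W) = real (k - 1) * real (card (slice ?W (k - 1)))"
    by (rule card_slice_mem) (use assms in auto)
  ultimately show ?thesis using cW c3 k by (simp add: of_nat_diff)
qed

lemma avg_of_bool:
  "finite S \<Longrightarrow> avg S (\<lambda>x. of_bool (P x)) = real (card {x \<in> S. P x}) / real (card S)"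
  by (simp add: avg_def of_bool_def sum.inter_filter[symmetric])

section \<open>The columns of a random graph as independent uniform slices\<close>

context regular_columns begin

definition "cap = m - of_bool z"
definition "F j = slice (colset X j) (t j)"

lemma cap_bounds: "real cap = real m - of_bool z" "real cap - 2 \<ge> w\<^sup>2 / (2 * Q)" "real cap \<le> real m"
proof -
  show 1: "real cap = real m - of_bool z" using scale_bounds(8) by (auto simp: cap_def)
  show "real cap - 2 \<ge> w\<^sup>2 / (2 * Q)" using m_ge(3) unfolding 1 by (cases z) auto
  show "real cap \<le> real m" unfolding 1 by simp
qed

lemma card_colset_X: "j < n \<Longrightarrow> card (colset X j) = cap"
proof -
  assume j: "j < n"
  have "colset X j = {..<m} - (if z then {j} else {})" using j by (auto simp: colset_def cells_def)
  then show ?thesis using j square by (auto simp: cap_def)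
qed

text \<open>Regularity and \<open>lam \<le> 1 - 1 / Q\<close> keep every column degree below m - 1,
  so there is room for a forbidden cell and the set of graphs is nonempty in the digraph case as
  well.\<close>

lemma t_le: assumes j: "j < n" shows "t j \<le> cap"
proof -
  have "real (t j) \<le> lam * real m + Q * w" using regular[OF j] by (simp add: lam_def w_def)
  also have "\<dots> \<le> (1 - 1 / Q) * real m + Q * w"
    using lam_bounds by (intro add_right_mono mult_right_mono) auto
  also have "\<dots> = real m - real m / Q + Q * w" by (simp add: algebra_simps)
  finally have "real (t j) \<le> real m - real m / Q + Q * w" .
  moreover have "Q * w + 1 \<le> real m / Q"
  proof -
    have "Q * w + 1 \<le> Q * w + Q * w" using scale_bounds mult_mono[of 1 Q 1 w] by simp
    also have "\<dots> = (2 * Q ^ 3) * (w / Q\<^sup>2)" using scale_bounds(1) by (simp add: field_simps eval_nat_numeral)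
    also have "\<dots> \<le> w * (w / Q\<^sup>2)"
      using const_Q[of 2 3] w_ge[of 4] scale_bounds by (intro mult_right_mono) auto
    also have "\<dots> = (w\<^sup>2 / Q) / Q" by (simp add: power2_eq_square)
    also have "\<dots> \<le> real m / Q" using m_ge(1) scale_bounds by (intro divide_right_mono) auto
    finally show ?thesis .
  qed
  ultimately have "real (t j) \<le> real cap" unfolding cap_bounds(1) by (cases z) auto
  then show ?thesis by simp
qed

lemma finite_F [simp]: "finite (F j)"
  unfolding F_def by (intro finite_slice finite_colset) simp

lemma F_ne: "j < n \<Longrightarrow> F j \<noteq> {}"
proof -
  assume j: "j < n"
  have "card (F j) = cap choose t j" unfolding F_def by (simp add: card_slice finite_colset card_colset_X[OF j])
  then show ?thesis using t_le[OF j] by auto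
qed

text \<open>Only column degrees are prescribed, so the graphs form a full product over the columns.
  This is the independence that Hoeffding's inequality needs.\<close>

lemma bij_columns: "bij_betw (\<lambda>G. restrict (colset G) {..<n}) \<Omega> (PiE {..<n} F)"
proof (rule bij_betw_byWitness[where f' = "\<lambda>\<omega>. {(i, j). j < n \<and> i \<in> \<omega> j}"])
  show "\<forall>G\<in>\<Omega>. {(i, j). j < n \<and> i \<in> restrict (colset G) {..<n} j} = G"
    by (auto simp: col_graphs_def colset_def cells_def)
  show "\<forall>\<omega>\<in>PiE {..<n} F. restrict (colset {(i, j). j < n \<and> i \<in> \<omega> j}) {..<n} = \<omega>"
  proof
    fix \<omega> assume "\<omega> \<in> PiE {..<n} F"
    then have "\<omega> \<in> extensional {..<n}" by (simp add: PiE_iff)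
    then show "restrict (colset {(i, j). j < n \<and> i \<in> \<omega> j}) {..<n} = \<omega>"
      by (auto simp: colset_def restrict_def extensional_def fun_eq_iff)
  qed
  show "(\<lambda>G. restrict (colset G) {..<n}) ` \<Omega> \<subseteq> PiE {..<n} F"
    by (auto simp: col_graphs_def F_def slice_def colset_def)
  show "(\<lambda>\<omega>. {(i, j). j < n \<and> i \<in> \<omega> j}) ` PiE {..<n} F \<subseteq> \<Omega>"
  proof clarify
    fix \<omega> assume \<omega>: "\<omega> \<in> PiE {..<n} F"
    have sub: "\<omega> j \<subseteq> colset X j" "card (\<omega> j) = t j" if "j < n" for j
      using PiE_mem[OF \<omega>, of j] that by (auto simp: F_def slice_def)
    have "colset {(i, j). j < n \<and> i \<in> \<omega> j} j = \<omega> j" if "j < n" for j using that by (auto simp: colset_def)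
    then show "{(i, j). j < n \<and> i \<in> \<omega> j} \<in> \<Omega>"
      using sub by (force simp: col_graphs_def colset_def)
  qed
qed

lemma finite_Omega [simp]: "finite \<Omega>" by (rule finite_col_graphs) simp

lemma Omega_ne: "\<Omega> \<noteq> {}"
proof -
  have "PiE {..<n} F \<noteq> {}" using F_ne by (simp add: PiE_eq_empty_iff)
  then show ?thesis using bij_columns by (auto simp: bij_betw_def)
qed

text \<open>The deviation 4 * c * Q * w makes the Hoeffding exponent exactly Q^2. \<open>B0\<close>
  allows for the difference between the true mean and the target \<open>T\<close>.\<close>

lemma column_sum_tail:
  assumes g: "\<And>j A. j < n \<Longrightarrow> A \<in> F j \<Longrightarrow> \<bar>g j A\<bar> \<le> c" and c: "c > 0"
    and mean: "\<bar>(\<Sum>j<n. avg (F j) (g j)) - T\<bar> \<le> B0" and B: "B0 + 4 * c * Q * w \<le> B"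
  shows "real (card {G \<in> \<Omega>. \<not> \<bar>(\<Sum>j<n. g j (colset G j)) - T\<bar> \<le> B}) \<le> 2 * exp (- (Q\<^sup>2)) * real (card \<Omega>)"
proof -
  let ?f = "\<lambda>G. restrict (colset G) {..<n}"
  let ?\<tau> = "4 * c * Q * w"
  let ?B = "{\<omega> \<in> PiE {..<n} F. \<bar>(\<Sum>j<n. g j (\<omega> j)) - (\<Sum>j<n. avg (F j) (g j))\<bar> \<ge> ?\<tau>}"
  have \<tau>: "?\<tau> > 0" using c scale_bounds by simp
  have "card {G \<in> \<Omega>. \<not> \<bar>(\<Sum>j<n. g j (colset G j)) - T\<bar> \<le> B} \<le> card ?B"
  proof (rule card_inj_on_le[where f = ?f])
    show "inj_on ?f {G \<in> \<Omega>. \<not> \<bar>(\<Sum>j<n. g j (colset G j)) - T\<bar> \<le> B}"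
      by (rule inj_on_subset[OF bij_betw_imp_inj_on[OF bij_columns]]) auto
    show "?f ` {G \<in> \<Omega>. \<not> \<bar>(\<Sum>j<n. g j (colset G j)) - T\<bar> \<le> B} \<subseteq> ?B"
    proof clarify
      fix G assume G: "G \<in> \<Omega>" "\<not> \<bar>(\<Sum>j<n. g j (colset G j)) - T\<bar> \<le> B"
      have "?f G \<in> PiE {..<n} F" using bij_betwE[OF bij_columns] G by blast
      moreover have "(\<Sum>j<n. g j (?f G j)) = (\<Sum>j<n. g j (colset G j))" by (intro sum.cong) auto
      ultimately show "?f G \<in> PiE {..<n} F \<and> ?\<tau> \<le> \<bar>(\<Sum>j<n. g j (?f G j)) - (\<Sum>j<n. avg (F j) (g j))\<bar>"
        using G(2) mean B by linarith
    qed
    show "finite ?B" by (intro finite_subset[OF _ finite_PiE[of "{..<n}" F]]) auto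
  qed
  then have "real (card {G \<in> \<Omega>. \<not> \<bar>(\<Sum>j<n. g j (colset G j)) - T\<bar> \<le> B}) \<le> real (card ?B)" by simp
  also have "\<dots> \<le> 2 * exp (- (?\<tau>\<^sup>2 / (16 * real (card {..<n}) * c\<^sup>2))) * real (card (PiE {..<n} F))"
    by (rule hoeffding_PiE) (use g c \<tau> scale_bounds F_ne in auto)
  also have "?\<tau>\<^sup>2 / (16 * real (card {..<n}) * c\<^sup>2) = Q\<^sup>2"
    unfolding card_lessThan scale_bounds(5)[symmetric] using c scale_bounds(3) by (simp add: power_mult_distrib field_simps)
  also have "card (PiE {..<n} F) = card \<Omega>" using bij_betw_same_card[OF bij_columns] by simp
  finally show ?thesis .
qed

text \<open>Means are compared column by column. The exceptional set \<open>E\<close> holds the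
  columns in which one of at most three rows has a forbidden cell; there the trivial bound is
  affordable.\<close>

lemma sum_close:
  fixes p :: "nat \<Rightarrow> real"
  assumes E: "E \<subseteq> {..<n}" "card E \<le> 3" and d: "\<delta> \<ge> 0" "\<delta>' \<ge> 0"
    and 1: "\<And>j. j < n \<Longrightarrow> j \<notin> E \<Longrightarrow> \<bar>p j - q j\<bar> \<le> \<delta>" and 2: "\<And>j. j < n \<Longrightarrow> \<bar>p j - q j\<bar> \<le> \<delta>'"
  shows "\<bar>(\<Sum>j<n. p j) - (\<Sum>j<n. q j)\<bar> \<le> real n * \<delta> + 3 * \<delta>'"
proof -
  have "\<bar>(\<Sum>j<n. p j) - (\<Sum>j<n. q j)\<bar> \<le> (\<Sum>j<n. \<bar>p j - q j\<bar>)" by (simp flip: sum_subtractf)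
  also have "\<dots> \<le> (\<Sum>j<n. \<delta> + (if j \<in> E then \<delta>' else 0))"
    using 1 2 d by (intro sum_mono) (auto intro: add_increasing)
  also have "\<dots> = real n * \<delta> + real (card ({..<n} \<inter> E)) * \<delta>'"
    by (simp add: sum.distrib sum.inter_restrict[symmetric])
  also have "{..<n} \<inter> E = E" using E by auto
  also have "real n * \<delta> + real (card E) * \<delta>' \<le> real n * \<delta> + 3 * \<delta>'"
    using E d by (intro add_left_mono mult_right_mono) auto
  finally show ?thesis .
qed

lemma forbidden_cols:
  assumes "I \<subseteq> {..<m}" "card I \<le> 3"
  shows "\<exists>E\<subseteq>{..<n}. card E \<le> 3 \<and> (\<forall>j<n. j \<notin> E \<longrightarrow> (\<forall>i\<in>I. i \<in> colset X j))"
proof (cases z)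
  case True
  then show ?thesis using assms square by (intro exI[of _ I]) (auto simp: colset_def cells_def)
next
  case False
  then show ?thesis using assms by (intro exI[of _ "{}"]) (auto simp: colset_def cells_def)
qed

text \<open>Both fractions are probabilities that a cell is used: the first unconditionally, the
  second given that exactly one of two other cells of the column is used.\<close>

lemma col_density:
  assumes j: "j < n"
  shows "\<bar>real (t j) / real cap - lam\<bar> \<le> 4 * Q\<^sup>2 / w" "\<bar>(real (t j) - 1) / (real cap - 2) - lam\<bar> \<le> 4 * Q\<^sup>2 / w"
proof -
  have V: "w\<^sup>2 / (2 * Q) > 0" using scale_bounds by simp
  have reg: "\<bar>real (t j) - lam * real m\<bar> \<le> Q * w" using regular[OF j] by (simp add: lam_def w_def)
  have Qw4: "Q * w \<ge> 4" using mult_mono[of 4 Q 1 w] scale_bounds Q_large by simp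
  have lz: "0 \<le> lam * of_bool z" "lam * of_bool z \<le> 1" using lam_bounds by (auto simp: of_bool_def)
  have key: "\<bar>y / d - lam\<bar> \<le> 4 * Q\<^sup>2 / w" if "d \<ge> w\<^sup>2 / (2 * Q)" "\<bar>y - lam * d\<bar> \<le> 2 * Q * w" for y d
  proof -
    have dp: "d > 0" using that V by linarith
    have "y / d - lam = (y - lam * d) / d" using dp by (simp add: field_simps)
    then have "\<bar>y / d - lam\<bar> = \<bar>y - lam * d\<bar> / d" using dp by (simp add: abs_divide)
    also have "\<dots> \<le> (2 * Q * w) / (w\<^sup>2 / (2 * Q))" using that V scale_bounds by (intro frac_le) auto
    also have "\<dots> = 4 * Q\<^sup>2 / w" using scale_bounds(1,3) by (simp add: field_simps eval_nat_numeral)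
    finally show ?thesis .
  qed
  show "\<bar>real (t j) / real cap - lam\<bar> \<le> 4 * Q\<^sup>2 / w"
  proof (rule key)
    show "w\<^sup>2 / (2 * Q) \<le> real cap" using cap_bounds(2) by linarith
    have "lam * real cap = lam * real m - lam * of_bool z" unfolding cap_bounds(1) by (simp add: algebra_simps)
    then show "\<bar>real (t j) - lam * real cap\<bar> \<le> 2 * Q * w" using reg Qw4 lz by linarith
  qed
  show "\<bar>(real (t j) - 1) / (real cap - 2) - lam\<bar> \<le> 4 * Q\<^sup>2 / w"
  proof (rule key)
    show "w\<^sup>2 / (2 * Q) \<le> real cap - 2" using cap_bounds(2) by linarith
    have "lam * (real cap - 2) = lam * real m - lam * of_bool z - 2 * lam" unfolding cap_bounds(1) by (simp add: algebra_simps)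
    then show "\<bar>real (t j) - 1 - lam * (real cap - 2)\<bar> \<le> 2 * Q * w" using reg Qw4 lz lam_bounds by linarith
  qed
qed

lemma prob_mem:
  assumes j: "j < n" and a: "a \<in> colset X j"
  shows "avg (F j) (\<lambda>A. of_bool (a \<in> A)) = real (t j) / real cap"
proof -
  have "0 < w\<^sup>2 / (2 * Q)" using scale_bounds by simp
  then have c: "real cap > 0" using cap_bounds(2) by linarith
  have pos: "real (card (F j)) > 0" using F_ne[OF j] by (simp add: card_gt_0_iff)
  have "real (card {A \<in> F j. a \<in> A}) * real cap = real (t j) * real (card (F j))"
    using card_slice_mem[of "colset X j" a "t j"] a
    by (simp add: F_def[symmetric] card_colset_X[OF j] finite_colset)
  then show ?thesis using c pos unfolding avg_of_bool[OF finite_F] by (subst frac_eq_eq) auto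
qed

lemma prob_differ:
  assumes j: "j < n" and b: "b \<in> colset X j" "c \<in> colset X j" "b \<noteq> c"
  shows "avg (F j) (\<lambda>A. of_bool ((b \<in> A) \<noteq> (c \<in> A))) = 2 * (real (t j) / real cap) * (1 - real (t j) / real cap) * (real cap / (real cap - 1))"
proof -
  have "0 < w\<^sup>2 / (2 * Q)" using scale_bounds by simp
  then have c: "real cap > 2" using cap_bounds(2) by linarith
  have pos: "real (card (F j)) > 0" using F_ne[OF j] by (simp add: card_gt_0_iff)
  have half: "real (card {A \<in> F j. x \<in> A \<and> y \<notin> A}) / real (card (F j)) = real (t j) * (real cap - real (t j)) / (real cap * (real cap - 1))"
    if "x \<in> colset X j" "y \<in> colset X j" "x \<noteq> y" for x y
  proof -
    have "real (card {A \<in> F j. x \<in> A \<and> y \<notin> A}) * (real cap * (real cap - 1)) = real (t j) * (real cap - real (t j)) * real (card (F j))"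
      using card_slice_mem_notmem[of "colset X j" x y "t j"] that t_le[OF j]
      by (simp add: F_def[symmetric] card_colset_X[OF j] finite_colset)
    then show ?thesis using c pos by (subst frac_eq_eq) auto
  qed
  have "{A \<in> F j. (b \<in> A) \<noteq> (c \<in> A)} = {A \<in> F j. b \<in> A \<and> c \<notin> A} \<union> {A \<in> F j. c \<in> A \<and> b \<notin> A}" by auto
  then have "card {A \<in> F j. (b \<in> A) \<noteq> (c \<in> A)} = card {A \<in> F j. b \<in> A \<and> c \<notin> A} + card {A \<in> F j. c \<in> A \<and> b \<notin> A}"
    by (simp add: card_Un_disjoint disjoint_iff)
  then have "avg (F j) (\<lambda>A. of_bool ((b \<in> A) \<noteq> (c \<in> A))) = 2 * (real (t j) * (real cap - real (t j)) / (real cap * (real cap - 1)))"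
    unfolding avg_of_bool[OF finite_F] using half[OF b] half[OF b(2,1)] b(3) by (simp add: add_divide_distrib)
  also have "\<dots> = 2 * (real (t j) / real cap) * (1 - real (t j) / real cap) * (real cap / (real cap - 1))"
    using c by (simp add: field_simps)
  finally show ?thesis .
qed

text \<open>Given that \<open>b\<close> and \<open>c\<close> disagree, row \<open>a\<close> is used
  with the conditional probability (t j - 1) / (cap - 2), which is close to \<open>lam\<close>; so
  the centred product has small mean.\<close>

lemma mean_differ_mem:
  assumes j: "j < n" and a: "a \<in> colset X j" "b \<in> colset X j" "c \<in> colset X j" "a \<noteq> b" "a \<noteq> c" "b \<noteq> c"
  shows "\<bar>avg (F j) (\<lambda>A. of_bool ((b \<in> A) \<noteq> (c \<in> A)) * (of_bool (a \<in> A) - lam))\<bar> \<le> 4 * Q\<^sup>2 / w"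
proof -
  have "0 < w\<^sup>2 / (2 * Q)" using scale_bounds by simp
  then have c: "real cap > 2" using cap_bounds(2) by linarith
  have pos: "real (card (F j)) > 0" using F_ne[OF j] by (simp add: card_gt_0_iff)
  have third: "real (card {A \<in> F j. x \<in> A \<and> y \<notin> A \<and> a \<in> A}) =
      (real (t j) - 1) / (real cap - 2) * real (card {A \<in> F j. x \<in> A \<and> y \<notin> A})"
    if "x \<in> colset X j" "y \<in> colset X j" "a \<noteq> x" "a \<noteq> y" "x \<noteq> y" for x y
    using card_slice_mem_mem_notmem[of "colset X j" a x y "t j"] that a c
    by (simp add: F_def[symmetric] card_colset_X[OF j] finite_colset field_simps)
  have un: "{A \<in> F j. (b \<in> A) \<noteq> (c \<in> A)} = {A \<in> F j. b \<in> A \<and> c \<notin> A} \<union> {A \<in> F j. c \<in> A \<and> b \<notin> A}"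
    "{A \<in> F j. (b \<in> A) \<noteq> (c \<in> A) \<and> a \<in> A} = {A \<in> F j. b \<in> A \<and> c \<notin> A \<and> a \<in> A} \<union> {A \<in> F j. c \<in> A \<and> b \<notin> A \<and> a \<in> A}" by auto
  let ?\<rho> = "(real (t j) - 1) / (real cap - 2)"
  have "real (card {A \<in> F j. (b \<in> A) \<noteq> (c \<in> A) \<and> a \<in> A}) = ?\<rho> * real (card {A \<in> F j. (b \<in> A) \<noteq> (c \<in> A)})"
    unfolding un using third[of b c] third[of c b] a
    by (simp add: card_Un_disjoint disjoint_iff distrib_left)
  then have "avg (F j) (\<lambda>A. of_bool ((b \<in> A) \<noteq> (c \<in> A) \<and> a \<in> A)) = ?\<rho> * avg (F j) (\<lambda>A. of_bool ((b \<in> A) \<noteq> (c \<in> A)))"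
    unfolding avg_of_bool[OF finite_F] by simp
  then have eq: "avg (F j) (\<lambda>A. of_bool ((b \<in> A) \<noteq> (c \<in> A)) * (of_bool (a \<in> A) - lam)) =
      (?\<rho> - lam) * avg (F j) (\<lambda>A. of_bool ((b \<in> A) \<noteq> (c \<in> A)))"
  proof -
    have "avg (F j) (\<lambda>A. of_bool ((b \<in> A) \<noteq> (c \<in> A)) * (of_bool (a \<in> A) - lam)) =
        avg (F j) (\<lambda>A. of_bool ((b \<in> A) \<noteq> (c \<in> A) \<and> a \<in> A) - lam * of_bool ((b \<in> A) \<noteq> (c \<in> A)))"
      by (rule avg_cong) (auto simp: of_bool_def)
    also have "\<dots> = avg (F j) (\<lambda>A. of_bool ((b \<in> A) \<noteq> (c \<in> A) \<and> a \<in> A)) - lam * avg (F j) (\<lambda>A. of_bool ((b \<in> A) \<noteq> (c \<in> A)))"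
      by (simp only: avg_diff avg_cmult)
    finally show ?thesis
      using \<open>avg (F j) (\<lambda>A. of_bool ((b \<in> A) \<noteq> (c \<in> A) \<and> a \<in> A)) = _\<close> by (simp add: algebra_simps)
  qed
  have "\<bar>avg (F j) (\<lambda>A. of_bool ((b \<in> A) \<noteq> (c \<in> A)))\<bar> \<le> 1"
    by (rule abs_avg_le_const) (use F_ne[OF j] in auto)
  then show ?thesis unfolding eq abs_mult
    using mult_mono[OF col_density(2)[OF j], of "\<bar>avg (F j) (\<lambda>A. of_bool ((b \<in> A) \<noteq> (c \<in> A)))\<bar>" 1] scale_bounds by simp
qed

end

lemma card_UN_le_real:
  assumes "finite I" "\<And>i. i \<in> I \<Longrightarrow> real (card (A i)) \<le> \<theta>"
  shows "real (card (\<Union>i\<in>I. A i)) \<le> real (card I) * \<theta>"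
proof -
  have "real (card (\<Union>i\<in>I. A i)) \<le> (\<Sum>i\<in>I. real (card (A i)))"
    using card_UN_le[OF assms(1), of A] by (metis of_nat_le_iff of_nat_sum)
  also have "\<dots> \<le> (\<Sum>i\<in>I. \<theta>)" using assms by (intro sum_mono) auto
  finally show ?thesis by simp
qed

section \<open>Tail bounds for the four conditions of a good graph\<close>

context regular_columns begin

abbreviation "\<theta> \<equiv> 2 * exp (- (Q\<^sup>2)) * real (card \<Omega>)"

lemma deviation_bounds: "4 * Q\<^sup>2 / w * real n = 4 * Q\<^sup>2 * w" "20 * Q\<^sup>2 * w \<le> Q ^ 4 * w" "1 \<le> Q\<^sup>2 * w" "Q * w \<le> Q\<^sup>2 * w"
proof -
  show "4 * Q\<^sup>2 / w * real n = 4 * Q\<^sup>2 * w" unfolding scale_bounds(5)[symmetric] using scale_bounds(3) by (simp add: power2_eq_square)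
  have "20 * Q\<^sup>2 \<le> Q ^ 4" using const_Q[of 20 2] Q_pow_mono[of 3 4] by (simp add: eval_nat_numeral)
  then show "20 * Q\<^sup>2 * w \<le> Q ^ 4 * w" using scale_bounds by (intro mult_right_mono) auto
  show "1 \<le> Q\<^sup>2 * w" using mult_mono[of 1 "Q\<^sup>2" 1 w] scale_bounds one_le_power[of Q 2] by simp
  have "Q \<le> Q\<^sup>2" using scale_bounds(2) by (simp add: power2_eq_square)
  then show "Q * w \<le> Q\<^sup>2 * w" using scale_bounds by (intro mult_right_mono) auto
qed

lemma tail_degree:
  assumes a: "a < m"
  shows "real (card {G \<in> \<Omega>. \<not> \<bar>real (card (rowset G a)) - lam * real n\<bar> \<le> Q ^ 4 * w}) \<le> \<theta>"
proof -
  let ?g = "\<lambda>(j::nat) A. of_bool (a \<in> A) :: real"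
  obtain E where E: "E \<subseteq> {..<n}" "card E \<le> 3" "\<And>j. j < n \<Longrightarrow> j \<notin> E \<Longrightarrow> a \<in> colset X j"
    using forbidden_cols[of "{a}"] a by auto
  have avg1: "\<bar>avg (F j) (?g j)\<bar> \<le> 1" if "j < n" for j
    by (rule abs_avg_le_const) (use F_ne[OF that] in auto)
  have "\<bar>(\<Sum>j<n. avg (F j) (?g j)) - (\<Sum>j<n. lam)\<bar> \<le> real n * (4 * Q\<^sup>2 / w) + 3 * 2"
  proof (rule sum_close[OF E(1,2)])
    fix j assume j: "j < n"
    show "\<bar>avg (F j) (?g j) - lam\<bar> \<le> 2" using avg1[OF j] lam_bounds by linarith
    assume "j \<notin> E"
    then show "\<bar>avg (F j) (?g j) - lam\<bar> \<le> 4 * Q\<^sup>2 / w" using prob_mem[OF j] E(3)[OF j] col_density(1)[OF j] by simp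
  qed (use scale_bounds in auto)
  then have "\<bar>(\<Sum>j<n. avg (F j) (?g j)) - lam * real n\<bar> \<le> 4 * Q\<^sup>2 * w + 6" using deviation_bounds(1) by (simp add: mult.commute)
  moreover have "4 * Q\<^sup>2 * w + 6 + 4 * 1 * Q * w \<le> Q ^ 4 * w" using deviation_bounds by linarith
  ultimately have "real (card {G \<in> \<Omega>. \<not> \<bar>(\<Sum>j<n. ?g j (colset G j)) - lam * real n\<bar> \<le> Q ^ 4 * w}) \<le> \<theta>"
    by (intro column_sum_tail[where c = 1]) auto
  moreover have "(\<Sum>j<n. ?g j (colset G j)) = real (card (rowset G a))" if "G \<in> \<Omega>" for G
  proof -
    have "rowset G a = {j \<in> {..<n}. a \<in> colset G j}"
      using that by (auto simp: rowset_def colset_def col_graphs_def cells_def)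
    then show ?thesis by (simp add: of_bool_def sum.inter_filter[symmetric])
  qed
  ultimately show ?thesis by (simp cong: conj_cong)
qed

lemma tail_discord:
  assumes b: "b < m" "c < m" "b \<noteq> c"
  shows "real (card {G \<in> \<Omega>. \<not> \<bar>real (card (discord X G b c)) - 2 * lam * (1 - lam) * real n\<bar> \<le> Q ^ 4 * w}) \<le> \<theta>"
proof -
  let ?g = "\<lambda>j A. of_bool (b \<in> colset X j \<and> c \<in> colset X j \<and> (b \<in> A) \<noteq> (c \<in> A)) :: real"
  have "card {b, c} \<le> 3" "{b, c} \<subseteq> {..<m}" using b by auto
  from forbidden_cols[OF this(2,1)] obtain E where E: "E \<subseteq> {..<n}" "card E \<le> 3"
    "\<And>j. j < n \<Longrightarrow> j \<notin> E \<Longrightarrow> b \<in> colset X j \<and> c \<in> colset X j" by auto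
  have avg1: "\<bar>avg (F j) (?g j)\<bar> \<le> 1" if "j < n" for j
    by (rule abs_avg_le_const) (use F_ne[OF that] in auto)
  have l01: "0 \<le> lam * (1 - lam)" "lam * (1 - lam) \<le> 1" using lam_bounds mult_mono[of lam 1 "1 - lam" 1] by auto
  have "\<bar>(\<Sum>j<n. avg (F j) (?g j)) - (\<Sum>j<n. 2 * lam * (1 - lam))\<bar> \<le> real n * (9 * Q\<^sup>2 / w) + 3 * 3"
  proof (rule sum_close[OF E(1,2)])
    fix j assume j: "j < n"
    show "\<bar>avg (F j) (?g j) - 2 * lam * (1 - lam)\<bar> \<le> 3" using avg1[OF j] l01 by simp
    assume "j \<notin> E"
    then have bc: "b \<in> colset X j" "c \<in> colset X j" using E(3)[OF j] by auto
    define x where "x = real (t j) / real cap"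
    have V: "w\<^sup>2 / (2 * Q) > 0" using scale_bounds by simp
    have c1: "real cap - 1 \<ge> w\<^sup>2 / (2 * Q)" "real cap > 2" using cap_bounds(2) V by linarith+
    have x: "0 \<le> x" "x \<le> 1" using t_le[OF j] c1 by (simp_all add: x_def)
    have xl: "\<bar>x - lam\<bar> \<le> 4 * Q\<^sup>2 / w" using col_density(1)[OF j] by (simp add: x_def)
    have "avg (F j) (?g j) = 2 * x * (1 - x) * (real cap / (real cap - 1))"
      using prob_differ[OF j bc b(3)] bc by (simp add: x_def)
    also have "real cap / (real cap - 1) = 1 + 1 / (real cap - 1)" using c1 by (simp add: field_simps)
    finally have eq: "avg (F j) (?g j) - 2 * lam * (1 - lam) =
        2 * ((x - lam) * (1 - x - lam)) + 2 * x * (1 - x) * (1 / (real cap - 1))"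
      by (simp add: algebra_simps)
    have "\<bar>x - lam\<bar> * \<bar>1 - x - lam\<bar> \<le> (4 * Q\<^sup>2 / w) * 1"
      using xl x lam_bounds by (intro mult_mono) auto
    moreover have "2 * x * (1 - x) * (1 / (real cap - 1)) \<le> 1 * (Q\<^sup>2 / w)"
    proof (rule mult_mono)
      have "0 \<le> (2 * x - 1)\<^sup>2" by simp
      then show "2 * x * (1 - x) \<le> 1" by (simp add: power2_eq_square algebra_simps)
      have "1 / (real cap - 1) \<le> 1 / (w\<^sup>2 / (2 * Q))" using c1 V by (intro frac_le) auto
      also have "\<dots> = 2 * Q / w\<^sup>2" by simp
      also have "\<dots> \<le> Q\<^sup>2 * w / w\<^sup>2"
      proof (rule divide_right_mono)
        have "2 * Q \<le> Q * Q" using Q_large by simp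
        also have "\<dots> \<le> Q * Q * w" using scale_bounds by simp
        finally show "2 * Q \<le> Q\<^sup>2 * w" by (simp add: power2_eq_square)
      qed simp
      also have "\<dots> = Q\<^sup>2 / w" using scale_bounds(3) by (simp add: power2_eq_square)
      finally show "1 / (real cap - 1) \<le> Q\<^sup>2 / w" .
    qed (use x c1 in auto)
    moreover have "0 \<le> 2 * x * (1 - x) * (1 / (real cap - 1))" using x c1 by simp
    moreover have "\<bar>(x - lam) * (1 - x - lam)\<bar> = \<bar>x - lam\<bar> * \<bar>1 - x - lam\<bar>" by (rule abs_mult)
    ultimately have "\<bar>avg (F j) (?g j) - 2 * lam * (1 - lam)\<bar> \<le> 2 * (4 * Q\<^sup>2 / w) + Q\<^sup>2 / w"
      unfolding eq by (smt (verit))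
    then show "\<bar>avg (F j) (?g j) - 2 * lam * (1 - lam)\<bar> \<le> 9 * Q\<^sup>2 / w" by simp
  qed (use scale_bounds in auto)
  moreover have "real n * (9 * Q\<^sup>2 / w) = 9 * Q\<^sup>2 * w" using deviation_bounds(1) by (simp add: field_simps)
  ultimately have "\<bar>(\<Sum>j<n. avg (F j) (?g j)) - 2 * lam * (1 - lam) * real n\<bar> \<le> 9 * Q\<^sup>2 * w + 9" by (simp add: mult.commute)
  moreover have "9 * Q\<^sup>2 * w + 9 + 4 * 1 * Q * w \<le> Q ^ 4 * w"
  proof -
    have "9 * Q\<^sup>2 * w + 9 + 4 * 1 * Q * w \<le> 22 * Q\<^sup>2 * w" using deviation_bounds by linarith
    also have "22 * Q\<^sup>2 * w \<le> Q ^ 4 * w"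
    proof (rule mult_right_mono)
      show "22 * Q\<^sup>2 \<le> Q ^ 4" using const_Q[of 22 2] Q_pow_mono[of 3 4] by (simp add: eval_nat_numeral)
    qed (use scale_bounds in auto)
    finally show ?thesis .
  qed
  ultimately have "real (card {G \<in> \<Omega>. \<not> \<bar>(\<Sum>j<n. ?g j (colset G j)) - 2 * lam * (1 - lam) * real n\<bar> \<le> Q ^ 4 * w}) \<le> \<theta>"
    by (intro column_sum_tail[where c = 1]) auto
  moreover have "(\<Sum>j<n. ?g j (colset G j)) = real (card (discord X G b c))" if "G \<in> \<Omega>" for G
  proof -
    have "discord X G b c = {j \<in> {..<n}. b \<in> colset X j \<and> c \<in> colset X j \<and> (b \<in> colset G j) \<noteq> (c \<in> colset G j)}"
      by (auto simp: discord_def colset_def cells_def)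
    then show ?thesis by (simp add: of_bool_def sum.inter_filter[symmetric])
  qed
  ultimately show ?thesis by (simp cong: conj_cong)
qed

lemma tail_discord_mem:
  assumes b: "a < m" "b < m" "c < m" "a \<noteq> b" "a \<noteq> c" "b \<noteq> c"
  shows "real (card {G \<in> \<Omega>. \<not> \<bar>\<Sum>j\<in>discord X G b c. of_bool ((a, j) \<in> G) - lam\<bar> \<le> Q ^ 4 * w}) \<le> \<theta>"
proof -
  let ?g = "\<lambda>j A. of_bool (b \<in> colset X j \<and> c \<in> colset X j \<and> (b \<in> A) \<noteq> (c \<in> A)) * (of_bool (a \<in> A) - lam) :: real"
  have "card {a, b, c} \<le> 3" "{a, b, c} \<subseteq> {..<m}" using b by auto
  from forbidden_cols[OF this(2,1)] obtain E where E: "E \<subseteq> {..<n}" "card E \<le> 3"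
    "\<And>j. j < n \<Longrightarrow> j \<notin> E \<Longrightarrow> a \<in> colset X j \<and> b \<in> colset X j \<and> c \<in> colset X j" by auto
  have g1: "\<bar>?g j A\<bar> \<le> 1" for j A using lam_bounds by (auto simp: of_bool_def)
  have avg1: "\<bar>avg (F j) (?g j)\<bar> \<le> 1" if "j < n" for j
    by (rule abs_avg_le_const) (use F_ne[OF that] g1 in auto)
  have "\<bar>(\<Sum>j<n. avg (F j) (?g j)) - (\<Sum>j<n. 0)\<bar> \<le> real n * (4 * Q\<^sup>2 / w) + 3 * 1"
  proof (rule sum_close[OF E(1,2)])
    fix j assume j: "j < n"
    show "\<bar>avg (F j) (?g j) - 0\<bar> \<le> 1" using avg1[OF j] by simp
    assume "j \<notin> E"
    then have abc: "a \<in> colset X j" "b \<in> colset X j" "c \<in> colset X j" using E(3)[OF j] by auto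
    then show "\<bar>avg (F j) (?g j) - 0\<bar> \<le> 4 * Q\<^sup>2 / w" using mean_differ_mem[OF j abc b(4-6)] by simp
  qed (use scale_bounds in auto)
  then have "\<bar>(\<Sum>j<n. avg (F j) (?g j)) - 0\<bar> \<le> 4 * Q\<^sup>2 * w + 3" using deviation_bounds(1) by (simp add: mult.commute)
  moreover have "4 * Q\<^sup>2 * w + 3 + 4 * 1 * Q * w \<le> Q ^ 4 * w" using deviation_bounds by linarith
  ultimately have "real (card {G \<in> \<Omega>. \<not> \<bar>(\<Sum>j<n. ?g j (colset G j)) - 0\<bar> \<le> Q ^ 4 * w}) \<le> \<theta>"
    by (intro column_sum_tail[where c = 1] g1) auto
  moreover have "(\<Sum>j<n. ?g j (colset G j)) = (\<Sum>j\<in>discord X G b c. of_bool ((a, j) \<in> G) - lam)" if "G \<in> \<Omega>" for G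
  proof -
    have "discord X G b c = {j \<in> {..<n}. b \<in> colset X j \<and> c \<in> colset X j \<and> (b \<in> colset G j) \<noteq> (c \<in> colset G j)}"
      by (auto simp: discord_def colset_def cells_def)
    then have "(\<Sum>j\<in>discord X G b c. of_bool ((a, j) \<in> G) - lam) =
      (\<Sum>j<n. if b \<in> colset X j \<and> c \<in> colset X j \<and> (b \<in> colset G j) \<noteq> (c \<in> colset G j) then of_bool ((a, j) \<in> G) - lam else 0)"
      by (simp only: sum.inter_filter finite_lessThan)
    also have "\<dots> = (\<Sum>j<n. ?g j (colset G j))"
      by (intro sum.cong refl) (auto simp: colset_def)
    finally show ?thesis by simp
  qed
  ultimately show ?thesis by (simp cong: conj_cong)
qed

lemma tail_weight:
  assumes a: "a < m"
  shows "real (card {G \<in> \<Omega>. \<not> \<bar>\<Sum>j\<in>rowset G a. real (t j) - lam * real m\<bar> \<le> Q ^ 6 * w\<^sup>2}) \<le> \<theta>"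
proof -
  let ?d = "\<lambda>j. real (t j) - lam * real m"
  let ?g = "\<lambda>j A. ?d j * of_bool (a \<in> A) :: real"
  obtain E where E: "E \<subseteq> {..<n}" "card E \<le> 3" "\<And>j. j < n \<Longrightarrow> j \<notin> E \<Longrightarrow> a \<in> colset X j"
    using forbidden_cols[of "{a}"] a by auto
  have d: "\<bar>?d j\<bar> \<le> Q * w" if "j < n" for j using regular[OF that] by (simp add: lam_def w_def)
  have Qwp: "Q * w > 0" using scale_bounds by simp
  have g1: "\<bar>?g j A\<bar> \<le> Q * w" if "j < n" for j A using d[OF that] Qwp by (auto simp: of_bool_def)
  have avg1: "\<bar>avg (F j) (?g j)\<bar> \<le> Q * w" if "j < n" for j
    by (rule abs_avg_le_const) (use F_ne[OF that] g1[OF that] in auto)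
  \<comment> \<open>The comparison sum vanishes, because the deviations of the column degrees add up
    to 0. Per column the error is (Q * w) * (4 * Q^2 / w), free of w.\<close>
  have "\<bar>(\<Sum>j<n. avg (F j) (?g j)) - (\<Sum>j<n. lam * ?d j)\<bar> \<le> real n * (4 * Q ^ 3) + 3 * (2 * (Q * w))"
  proof (rule sum_close[OF E(1,2)])
    fix j assume j: "j < n"
    have "\<bar>lam * ?d j\<bar> \<le> 1 * (Q * w)" unfolding abs_mult using lam_bounds d[OF j] by (intro mult_mono) auto
    then show "\<bar>avg (F j) (?g j) - lam * ?d j\<bar> \<le> 2 * (Q * w)" using avg1[OF j] by linarith
    assume "j \<notin> E"
    then have "avg (F j) (?g j) = ?d j * (real (t j) / real cap)"
      using prob_mem[OF j] E(3)[OF j] by (simp add: avg_cmult)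
    then have "\<bar>avg (F j) (?g j) - lam * ?d j\<bar> = \<bar>?d j\<bar> * \<bar>real (t j) / real cap - lam\<bar>"
      by (simp add: abs_mult[symmetric] algebra_simps)
    also have "\<dots> \<le> (Q * w) * (4 * Q\<^sup>2 / w)" using d[OF j] col_density(1)[OF j] Qwp by (intro mult_mono) auto
    also have "\<dots> = 4 * Q ^ 3" using scale_bounds(3) by (simp add: eval_nat_numeral)
    finally show "\<bar>avg (F j) (?g j) - lam * ?d j\<bar> \<le> 4 * Q ^ 3" .
  qed (use scale_bounds in auto)
  moreover have "(\<Sum>j<n. lam * ?d j) = 0"
  proof -
    have "(\<Sum>j<n. ?d j) = 0" using sum_t by (simp add: sum_subtractf)
    then show ?thesis by (simp flip: sum_distrib_left)
  qed
  ultimately have "\<bar>(\<Sum>j<n. avg (F j) (?g j)) - 0\<bar> \<le> 4 * Q ^ 3 * w\<^sup>2 + 6 * (Q * w)" using scale_bounds(5) by (simp add: mult_ac)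
  moreover have "(4 * Q ^ 3 * w\<^sup>2 + 6 * (Q * w)) + 4 * (Q * w) * Q * w \<le> Q ^ 6 * w\<^sup>2"
  proof -
    have "w \<le> w\<^sup>2" using scale_bounds(4) by (simp add: power2_eq_square)
    then have "Q * w \<le> Q ^ 3 * w\<^sup>2" using Q_pow_mono[of 1 3] scale_bounds(1-4) by (intro mult_mono) auto
    moreover have "4 * (Q * w) * Q * w = 4 * Q\<^sup>2 * w\<^sup>2" by (simp add: power2_eq_square)
    moreover have "Q\<^sup>2 * w\<^sup>2 \<le> Q ^ 3 * w\<^sup>2" using Q_pow_mono[of 2 3] by (intro mult_right_mono) auto
    moreover have "14 * Q ^ 3 \<le> Q ^ 6" using const_Q[of 14 3] Q_pow_mono[of 4 6] by simp
    then have "14 * Q ^ 3 * w\<^sup>2 \<le> Q ^ 6 * w\<^sup>2" by (intro mult_right_mono) auto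
    ultimately show ?thesis by linarith
  qed
  ultimately have "real (card {G \<in> \<Omega>. \<not> \<bar>(\<Sum>j<n. ?g j (colset G j)) - 0\<bar> \<le> Q ^ 6 * w\<^sup>2}) \<le> \<theta>"
    by (intro column_sum_tail[where c = "Q * w"] g1 Qwp) auto
  moreover have "(\<Sum>j<n. ?g j (colset G j)) = (\<Sum>j\<in>rowset G a. ?d j)" if "G \<in> \<Omega>" for G
  proof -
    have "rowset G a = {j \<in> {..<n}. a \<in> colset G j}"
      using that by (auto simp: rowset_def colset_def col_graphs_def cells_def)
    then have "(\<Sum>j\<in>rowset G a. ?d j) = (\<Sum>j<n. if a \<in> colset G j then ?d j else 0)"
      by (simp only: sum.inter_filter finite_lessThan)
    also have "\<dots> = (\<Sum>j<n. ?g j (colset G j))" by (intro sum.cong) auto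
    finally show ?thesis by simp
  qed
  ultimately show ?thesis by (simp cong: conj_cong)
qed

text \<open>A union bound: four families of events, each with at most m^3 members of probability at
  most 2 * exp (- Q^2).\<close>

lemma bad_graphs: "real (card {G \<in> \<Omega>. \<not> good G}) \<le> 8 * real m ^ 3 * exp (- (Q\<^sup>2)) * real (card \<Omega>)"
proof -
  let ?P2 = "{(b, c). b < m \<and> c < m \<and> b \<noteq> c}"
  let ?P3 = "{(a, b, c). a < m \<and> b < m \<and> c < m \<and> a \<noteq> b \<and> a \<noteq> c \<and> b \<noteq> c}"
  let ?S = "\<lambda>a. {G \<in> \<Omega>. \<not> \<bar>real (card (rowset G a)) - lam * real n\<bar> \<le> Q ^ 4 * w}"
  let ?T = "\<lambda>(b, c). {G \<in> \<Omega>. \<not> \<bar>real (card (discord X G b c)) - 2 * lam * (1 - lam) * real n\<bar> \<le> Q ^ 4 * w}"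
  let ?R = "\<lambda>(a, b, c). {G \<in> \<Omega>. \<not> \<bar>\<Sum>j\<in>discord X G b c. of_bool ((a, j) \<in> G) - lam\<bar> \<le> Q ^ 4 * w}"
  let ?W = "\<lambda>a. {G \<in> \<Omega>. \<not> \<bar>\<Sum>j\<in>rowset G a. real (t j) - lam * real m\<bar> \<le> Q ^ 6 * w\<^sup>2}"
  have P2: "?P2 \<subseteq> {..<m} \<times> {..<m}" and P3: "?P3 \<subseteq> {..<m} \<times> {..<m} \<times> {..<m}" by auto
  have fP: "finite ?P2" "finite ?P3" using finite_subset[OF P2] finite_subset[OF P3] by auto
  have m1: "real m \<ge> 1" using scale_bounds(8) by simp
  have th: "\<theta> \<ge> 0" by simp
  have c2: "real (card ?P2) \<le> real m ^ 3"
  proof -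
    have "card ?P2 \<le> card ({..<m} \<times> {..<m})" using P2 by (intro card_mono) auto
    then have "card ?P2 \<le> m * m" by (simp add: card_cartesian_product)
    then have "real (card ?P2) \<le> real m ^ 2" unfolding power2_eq_square of_nat_mult[symmetric] of_nat_le_iff .
    also have "\<dots> \<le> real m ^ 3" using m1 by (intro power_increasing) auto
    finally show ?thesis .
  qed
  have c3: "real (card ?P3) \<le> real m ^ 3"
  proof -
    have "card ?P3 \<le> card ({..<m} \<times> {..<m} \<times> {..<m})" using P3 by (intro card_mono) auto
    then have "card ?P3 \<le> m * m * m" by (simp add: card_cartesian_product)
    then show ?thesis unfolding power3_eq_cube of_nat_mult[symmetric] of_nat_le_iff .
  qed
  have c1: "real m \<le> real m ^ 3" using m1 by (simp add: self_le_power)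
  define U1 where "U1 = (\<Union>a\<in>{..<m}. ?S a)"
  define U2 where "U2 = (\<Union>p\<in>?P2. ?T p)"
  define U3 where "U3 = (\<Union>p\<in>?P3. ?R p)"
  define U4 where "U4 = (\<Union>a\<in>{..<m}. ?W a)"
  have sub: "{G \<in> \<Omega>. \<not> good G} \<subseteq> U1 \<union> U2 \<union> U3 \<union> U4"
    unfolding U1_def U2_def U3_def U4_def
  proof
    fix G assume G: "G \<in> {G \<in> \<Omega>. \<not> good G}"
    show "G \<in> (\<Union>a\<in>{..<m}. ?S a) \<union> (\<Union>p\<in>?P2. ?T p) \<union> (\<Union>p\<in>?P3. ?R p) \<union> (\<Union>a\<in>{..<m}. ?W a)"
    proof (rule ccontr)
      assume no: "G \<notin> (\<Union>a\<in>{..<m}. ?S a) \<union> (\<Union>p\<in>?P2. ?T p) \<union> (\<Union>p\<in>?P3. ?R p) \<union> (\<Union>a\<in>{..<m}. ?W a)"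
      have "good G"
        unfolding good_def
      proof (intro conjI allI impI)
        fix a assume a: "a < m"
        from no have "G \<notin> ?S a" "G \<notin> ?W a" using a by blast+
        then show "\<bar>real (card (rowset G a)) - lam * real n\<bar> \<le> Q ^ 4 * w"
          "\<bar>\<Sum>j\<in>rowset G a. real (t j) - lam * real m\<bar> \<le> Q ^ 6 * w\<^sup>2" using G by blast+
      next
        fix b c assume "b < m" "c < m" "b \<noteq> c"
        then have "(b, c) \<in> ?P2" by simp
        with no have "G \<notin> ?T (b, c)" by blast
        then show "\<bar>real (card (discord X G b c)) - 2 * lam * (1 - lam) * real n\<bar> \<le> Q ^ 4 * w"
          unfolding prod.case using G by blast
      next
        fix a b c assume "a < m" "b < m" "c < m" "a \<noteq> b" "a \<noteq> c" "b \<noteq> c"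
        then have "(a, b, c) \<in> ?P3" by simp
        with no have "G \<notin> ?R (a, b, c)" by blast
        then show "\<bar>\<Sum>j\<in>discord X G b c. of_bool ((a, j) \<in> G) - lam\<bar> \<le> Q ^ 4 * w"
          unfolding prod.case using G by blast
      qed
      then show False using G by simp
    qed
  qed
  have "U1 \<subseteq> \<Omega>" "U2 \<subseteq> \<Omega>" "U3 \<subseteq> \<Omega>" "U4 \<subseteq> \<Omega>" unfolding U1_def U2_def U3_def U4_def by blast+
  then have fin: "finite (U1 \<union> U2 \<union> U3 \<union> U4)" by (intro finite_subset[OF _ finite_Omega]) blast
  have "card {G \<in> \<Omega>. \<not> good G} \<le> card (U1 \<union> U2 \<union> U3 \<union> U4)" by (rule card_mono[OF fin sub])
  also have "\<dots> \<le> card U1 + card U2 + card U3 + card U4"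
    using card_Un_le[of "U1 \<union> U2 \<union> U3" U4] card_Un_le[of "U1 \<union> U2" U3] card_Un_le[of U1 U2] by linarith
  finally have "real (card {G \<in> \<Omega>. \<not> good G}) \<le> real (card U1) + real (card U2) + real (card U3) + real (card U4)"
    by linarith
  also have "\<dots> \<le> real (card {..<m}) * \<theta> + real (card ?P2) * \<theta> + real (card ?P3) * \<theta> + real (card {..<m}) * \<theta>"
    unfolding U1_def U2_def U3_def U4_def
  proof (intro add_mono card_UN_le_real fP finite_lessThan)
    show "real (card (?S a)) \<le> \<theta>" if "a \<in> {..<m}" for a by (rule tail_degree) (use that in simp)
    show "real (card (?T p)) \<le> \<theta>" if p: "p \<in> ?P2" for p
    proof -
      obtain b c where bc: "p = (b, c)" "b < m" "c < m" "b \<noteq> c" using p by blast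
      show ?thesis unfolding bc(1) prod.case by (rule tail_discord[OF bc(2-4)])
    qed
    show "real (card (?R p)) \<le> \<theta>" if p: "p \<in> ?P3" for p
    proof -
      obtain a b c where abc: "p = (a, b, c)" "a < m" "b < m" "c < m" "a \<noteq> b" "a \<noteq> c" "b \<noteq> c" using p by blast
      show ?thesis unfolding abc(1) prod.case by (rule tail_discord_mem[OF abc(2-7)])
    qed
    show "real (card (?W a)) \<le> \<theta>" if "a \<in> {..<m}" for a by (rule tail_weight) (use that in simp)
  qed
  also have "\<dots> \<le> real m ^ 3 * \<theta> + real m ^ 3 * \<theta> + real m ^ 3 * \<theta> + real m ^ 3 * \<theta>"
    using c1 c2 c3 th by (intro add_mono mult_right_mono) auto
  also have "\<dots> = 8 * real m ^ 3 * exp (- (Q\<^sup>2)) * real (card \<Omega>)" by simp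
  finally show ?thesis .
qed

end

section \<open>The density of the row degrees\<close>

lemma U_degrees_rowset: "U_degrees m G = restrict (\<lambda>i. card (rowset G i)) {..<m}"
  by (simp add: U_degrees_def rowset_def)

lemma U_degrees_eq_iff: "U_degrees m G = U_degrees m H \<longleftrightarrow> (\<forall>i<m. card (rowset G i) = card (rowset H i))"
  by (auto simp: U_degrees_rowset restrict_def fun_eq_iff)

lemma card_row_class:
  assumes X: "X \<subseteq> {..<m} \<times> {..<n}" and r: "\<And>i. i < m \<Longrightarrow> card (rowset X i) = r"
  shows "card {B. B \<subseteq> X \<and> (\<forall>i<m. card (rowset B i) = s i)} = (\<Prod>i<m. r choose s i)"
proof -
  let ?S = "{B. B \<subseteq> X \<and> (\<forall>i<m. card (rowset B i) = s i)}"
  let ?P = "PiE {..<m} (\<lambda>i. slice (rowset X i) (s i))"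
  have "bij_betw (\<lambda>B. restrict (rowset B) {..<m}) ?S ?P"
  proof (rule bij_betw_byWitness[where f' = "\<lambda>\<omega>. {(i, j). i < m \<and> j \<in> \<omega> i}"])
    show "\<forall>B\<in>?S. {(i, j). i < m \<and> j \<in> restrict (rowset B) {..<m} i} = B"
      using X by (auto simp: rowset_def)
    show "\<forall>\<omega>\<in>?P. restrict (rowset {(i, j). i < m \<and> j \<in> \<omega> i}) {..<m} = \<omega>"
    proof
      fix \<omega> assume "\<omega> \<in> ?P"
      then have "\<omega> \<in> extensional {..<m}" by (simp add: PiE_iff)
      then show "restrict (rowset {(i, j). i < m \<and> j \<in> \<omega> i}) {..<m} = \<omega>"
        by (auto simp: rowset_def restrict_def extensional_def fun_eq_iff)
    qed
    show "(\<lambda>B. restrict (rowset B) {..<m}) ` ?S \<subseteq> ?P"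
      by (auto simp: slice_def rowset_def)
    show "(\<lambda>\<omega>. {(i, j). i < m \<and> j \<in> \<omega> i}) ` ?P \<subseteq> ?S"
    proof clarify
      fix \<omega> assume \<omega>: "\<omega> \<in> ?P"
      have sub: "\<omega> i \<subseteq> rowset X i" "card (\<omega> i) = s i" if "i < m" for i
        using PiE_mem[OF \<omega>, of i] that by (auto simp: slice_def)
      have "rowset {(i, j). i < m \<and> j \<in> \<omega> i} i = \<omega> i" if "i < m" for i using that by (auto simp: rowset_def)
      then show "{(i, j). i < m \<and> j \<in> \<omega> i} \<subseteq> X \<and> (\<forall>i<m. card (rowset {(i, j). i < m \<and> j \<in> \<omega> i} i) = s i)"
        using sub by (force simp: rowset_def)
    qed
  qed
  then have "card ?S = card ?P" by (rule bij_betw_same_card)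
  also have "\<dots> = (\<Prod>i<m. r choose s i)"
  proof -
    have "finite X" using X by (rule finite_subset) simp
    then show ?thesis by (simp add: card_PiE card_slice finite_rowset r)
  qed
  finally show ?thesis .
qed

lemma real_half_power_le: "(1/2::real) ^ nat \<lceil>x\<rceil> \<le> exp (- x / 2)"
proof -
  have "exp (1/2 :: real) \<le> 2"
    using exp_bound[of "1/2"] by (simp add: power2_eq_square)
  then have "1/2 \<le> exp (- 1/2 :: real)" by (simp add: exp_minus field_simps)
  then have "(1/2::real) ^ nat \<lceil>x\<rceil> \<le> exp (- 1/2) ^ nat \<lceil>x\<rceil>" by (intro power_mono) auto
  also have "\<dots> = exp (real (nat \<lceil>x\<rceil>) * (- 1/2))" by (simp add: exp_of_nat_mult[symmetric])
  also have "\<dots> \<le> exp (- x / 2)" using real_nat_ceiling_ge[of x] by simp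
  finally show ?thesis .
qed

context regular_columns begin

definition "edges = (\<Sum>j<n. t j)"
definition "rc = n - of_bool z"
abbreviation "K \<equiv> slice X edges"
abbreviation "U \<equiv> U_degrees m"

text \<open>The ratio f = P / P', pulled back along \<open>U\<close> to edge sets. In this form it
  lives on a slice, where the Poincare inequality is available.\<close>

definition dens :: "(nat \<times> nat) set \<Rightarrow> real" where
  "dens A = (real (card {G \<in> \<Omega>. U G = U A}) / real (card \<Omega>)) / (real (card {B \<in> K. U B = U A}) / real (card K))"

lemma X_sub: "X \<subseteq> {..<m} \<times> {..<n}" by (auto simp: cells_def)

lemma finite_K [simp]: "finite K" by simp

lemma Omega_sub_K: "\<Omega> \<subseteq> K"
proof
  fix G assume G: "G \<in> \<Omega>"
  then have "G \<subseteq> X" by (simp add: col_graphs_def)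
  moreover have "card G = edges"
    using card_eq_sum_colset[of G m n] G X_sub \<open>G \<subseteq> X\<close> by (auto simp: col_graphs_def edges_def)
  ultimately show "G \<in> K" by (simp add: slice_def)
qed

lemma cards_pos: "real (card \<Omega>) > 0" "real (card K) > 0"
  using Omega_ne Omega_sub_K by (auto simp: card_gt_0_iff)

lemma dens_nonneg: "dens A \<ge> 0" by (simp add: dens_def)

lemma dens_cong: "U A = U B \<Longrightarrow> dens A = dens B" by (simp add: dens_def)

text \<open>Change of measure: integrating f over an event under P' gives its P-probability. No mass
  is lost, since every graph in question is itself a member of \<open>K\<close>.\<close>

lemma dens_sum:
  "(\<Sum>A\<in>{A \<in> K. U A \<in> E}. dens A) = real (card K) * (real (card {G \<in> \<Omega>. U G \<in> E}) / real (card \<Omega>))"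
proof -
  define c where "c s = real (card {B \<in> K. U B = s})" for s
  have "(\<Sum>A\<in>{A \<in> K. U A \<in> E}. real (card {G \<in> \<Omega>. U G = U A}) / c (U A)) =
      (\<Sum>A\<in>{A \<in> K. U A \<in> E}. \<Sum>G\<in>\<Omega>. of_bool (U G = U A) / c (U A))"
    by (intro sum.cong refl) (simp add: of_bool_def sum.inter_filter[symmetric] flip: sum_divide_distrib)
  also have "\<dots> = (\<Sum>G\<in>\<Omega>. \<Sum>A\<in>{A \<in> K. U A \<in> E}. of_bool (U G = U A) / c (U A))" by (rule sum.swap)
  also have "\<dots> = (\<Sum>G\<in>\<Omega>. of_bool (U G \<in> E))"
  proof (rule sum.cong[OF refl])
    fix G assume G: "G \<in> \<Omega>"
    have "(\<Sum>A\<in>{A \<in> K. U A \<in> E}. of_bool (U G = U A) / c (U A)) =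
        (\<Sum>A\<in>{A \<in> K. U A = U G}. if U G \<in> E then 1 / c (U G) else 0)"
      by (rule sum.mono_neutral_cong) auto
    also have "\<dots> = c (U G) * (if U G \<in> E then 1 / c (U G) else 0)" by (simp add: c_def)
    also have "c (U G) > 0" using G Omega_sub_K by (auto simp: c_def card_gt_0_iff)
    then have "c (U G) * (if U G \<in> E then 1 / c (U G) else 0) = of_bool (U G \<in> E)" by simp
    finally show "(\<Sum>A\<in>{A \<in> K. U A \<in> E}. of_bool (U G = U A) / c (U A)) = of_bool (U G \<in> E)" .
  qed
  also have "\<dots> = real (card {G \<in> \<Omega>. U G \<in> E})"
    by (simp add: of_bool_def sum.inter_filter[symmetric])
  finally have *: "(\<Sum>A\<in>{A \<in> K. U A \<in> E}. real (card {G \<in> \<Omega>. U G = U A}) / c (U A)) = real (card {G \<in> \<Omega>. U G \<in> E})" .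
  have "(\<Sum>A\<in>{A \<in> K. U A \<in> E}. dens A) =
      (\<Sum>A\<in>{A \<in> K. U A \<in> E}. real (card K) / real (card \<Omega>) * (real (card {G \<in> \<Omega>. U G = U A}) / c (U A)))"
    by (intro sum.cong refl) (simp add: dens_def c_def)
  also have "\<dots> = real (card K) / real (card \<Omega>) * real (card {G \<in> \<Omega>. U G \<in> E})"
    unfolding sum_distrib_left[symmetric] * ..
  finally show ?thesis by simp
qed

lemma real_rc: "real rc = real n - of_bool z"
  unfolding rc_def using scale_bounds(7) by (cases z) (simp_all add: of_nat_diff)

lemma card_rowset_X:
  assumes "i < m" shows "card (rowset X i) = rc"
proof (cases z)
  case True
  then have "rowset X i = {..<n} - {i}" "i < n" using assms square by (auto simp: rowset_def cells_def)
  then show ?thesis unfolding rc_def using True by simp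
next
  case False
  then have "rowset X i = {..<n}" using assms by (auto simp: rowset_def cells_def)
  then show ?thesis unfolding rc_def using False by simp
qed

lemma row_le: "A \<subseteq> X \<Longrightarrow> i < m \<Longrightarrow> card (rowset A i) \<le> rc"
  using card_mono[of "rowset X i" "rowset A i"] card_rowset_X[of i] finite_rowset[of X i]
  unfolding rowset_def by fastforce

lemma card_K_class:
  assumes A: "A \<in> K"
  shows "card {B \<in> K. U B = U A} = (\<Prod>i<m. rc choose card (rowset A i))"
proof -
  have AX: "A \<subseteq> X" "card A = edges" using A by (auto simp: slice_def)
  have "{B \<in> K. U B = U A} = {B. B \<subseteq> X \<and> (\<forall>i<m. card (rowset B i) = card (rowset A i))}"
  proof (intro equalityI subsetI)
    fix B assume "B \<in> {B \<in> K. U B = U A}"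
    then show "B \<in> {B. B \<subseteq> X \<and> (\<forall>i<m. card (rowset B i) = card (rowset A i))}"
      by (auto simp: slice_def U_degrees_eq_iff)
  next
    fix B assume B: "B \<in> {B. B \<subseteq> X \<and> (\<forall>i<m. card (rowset B i) = card (rowset A i))}"
    then have "B \<subseteq> X" by simp
    then have "card B = (\<Sum>i<m. card (rowset B i))" using X_sub by (intro card_eq_sum_rowset) auto
    also have "\<dots> = (\<Sum>i<m. card (rowset A i))" using B by simp
    also have "\<dots> = card A" using AX X_sub by (intro card_eq_sum_rowset[symmetric]) auto
    finally show "B \<in> {B \<in> K. U B = U A}" using B AX by (auto simp: slice_def U_degrees_eq_iff)
  qed
  then show ?thesis using card_row_class[OF X_sub, of rc] card_rowset_X by simp
qed

lemma cls_eq: "cls (U A) = {G \<in> \<Omega>. U G = U A}"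
  unfolding deg_class_def U_degrees_eq_iff by (simp add: U_degrees_rowset cong: conj_cong)

text \<open>The ratio of the binomial weights of two neighbouring degree sequences, cross-multiplied
  to avoid division.\<close>

lemma choose_step:
  fixes r p q :: nat
  assumes "q > 0" "q \<le> r" "p < r"
  shows "real (r choose Suc p) * real (r choose (q - 1)) * ((real p + 1) * (real r - real q + 1)) =
     real (r choose p) * real (r choose q) * ((real r - real p) * real q)"
proof -
  have 1: "(real p + 1) * real (r choose Suc p) = (real r - real p) * real (r choose p)"
  proof -
    have "Suc p * (r choose Suc p) = (r - p) * (r choose p)"
      by (rule trans[OF binomial_absorption binomial_absorb_comp[symmetric]])
    then have "real (Suc p * (r choose Suc p)) = real ((r - p) * (r choose p))" by (simp only:)
    then show ?thesis using assms by (simp add: of_nat_diff algebra_simps)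
  qed
  obtain q' where q': "q = Suc q'" using assms by (cases q) auto
  have 2: "real q * real (r choose q) = (real r - real q + 1) * real (r choose (q - 1))"
  proof -
    have "Suc q' * (r choose Suc q') = (r - q') * (r choose q')"
      by (rule trans[OF binomial_absorption binomial_absorb_comp[symmetric]])
    then have "real (Suc q' * (r choose Suc q')) = real ((r - q') * (r choose q'))" by (simp only:)
    then show ?thesis using assms q' by (simp add: of_nat_diff algebra_simps)
  qed
  have "real (r choose Suc p) * real (r choose (q - 1)) * ((real p + 1) * (real r - real q + 1)) =
      ((real p + 1) * real (r choose Suc p)) * ((real r - real q + 1) * real (r choose (q - 1)))"
    by (simp only: mult_ac)
  also have "\<dots> = real (r choose p) * real (r choose q) * ((real r - real p) * real q)"
    unfolding 1 2[symmetric] by (simp only: mult_ac)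
  finally show ?thesis .
qed

text \<open>\<open>A\<close> is any edge set of the right size and need not have column degrees
  \<open>t\<close>; the two cells may lie in different columns, since only row degrees matter for
  \<open>dens\<close>. The number of binomial edge sets changes by exactly \<open>R\<close>, and the
  number of graphs by at least \<open>R\<close> times 1 minus the error, from
  \<open>switching_le\<close> and \<open>switch_avg_ge\<close>. If both cells lie in one row,
  nothing changes.\<close>

lemma dens_step:
  assumes A: "A \<in> K" and gc: "good_class m n z t Q (U A)"
    and x: "x \<in> A" and y: "y \<in> X - A"
  shows "dens (insert y (A - {x})) \<ge> (1 - 2 * Q ^ 16 / w ^ 3) * dens A"
proof -
  interpret gc: good_class m n z t Q "U A" by (rule gc)
  let ?L = "2 * Q ^ 16 / w ^ 3"
  obtain b j where xb: "x = (b, j)" by (cases x)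
  obtain a j' where ya: "y = (a, j')" by (cases y)
  let ?A = "insert y (A - {x})"
  have AX: "A \<subseteq> X" using A by (auto simp: slice_def)
  have finA: "finite A" using AX by (rule finite_subset) simp
  have A': "?A \<in> K" using swap_in_slice[OF _ A x y] by simp
  have am: "a < m" "b < m" using x y AX X_sub xb ya by auto
  have L0: "?L \<ge> 0" using scale_bounds by simp
  show ?thesis
  proof (cases "a = b")
    case True
    have "card (rowset ?A i) = card (rowset A i)" for i
    proof (cases "i = b")
      case True
      have "rowset ?A b = insert j' (rowset A b - {j})" "j \<in> rowset A b" "j' \<notin> rowset A b"
        using x y xb ya \<open>a = b\<close> by (auto simp: rowset_def)
      then show ?thesis using finite_rowset[OF finA, of b] True by (simp add: card_Suc_Diff1 del: card_Diff_insert)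
    next
      case False
      then have "rowset ?A i = rowset A i" using xb ya \<open>a = b\<close> by (auto simp: rowset_def)
      then show ?thesis by simp
    qed
    then have "dens ?A = dens A" by (intro dens_cong) (simp add: U_degrees_eq_iff)
    then show ?thesis using mult_right_mono[of "1 - ?L" 1 "dens A"] L0 dens_nonneg[of A] by simp
  next
    case False
    define s where "s i = card (rowset A i)" for i
    have rows: "card (rowset ?A a) = s a + 1" "card (rowset ?A b) = s b - 1" "s b > 0"
      "\<And>i. i \<noteq> a \<Longrightarrow> i \<noteq> b \<Longrightarrow> card (rowset ?A i) = s i"
    proof -
      have "rowset ?A a = insert j' (rowset A a)" "j' \<notin> rowset A a"
        using x y xb ya False by (auto simp: rowset_def)
      then show "card (rowset ?A a) = s a + 1" using finite_rowset[OF finA] by (simp add: s_def)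
      have b: "rowset ?A b = rowset A b - {j}" "j \<in> rowset A b"
        using x y xb ya False by (auto simp: rowset_def)
      then show "card (rowset ?A b) = s b - 1" using finite_rowset[OF finA] by (simp add: s_def)
      show "s b > 0" using b(2) finite_rowset[OF finA, of b] unfolding s_def card_gt_0_iff by blast
      show "card (rowset ?A i) = s i" if "i \<noteq> a" "i \<noteq> b" for i
      proof -
        have "rowset ?A i = rowset A i" using xb ya that by (auto simp: rowset_def)
        then show ?thesis by (simp add: s_def)
      qed
    qed
    have UA: "U A a = s a" "U A b = s b" using am by (simp_all add: U_degrees_rowset s_def)
    have UA': "(U A)(a := U A a + 1, b := U A b - 1) = U ?A"
      using am rows UA False by (auto simp: U_degrees_rowset fun_eq_iff s_def)
    define D0 where "D0 = (real (s a) + 1) * (gc.row_cap - real (s b) + 1) / (gc.row_cap + 1)"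
    define R where "R = 1 + (real (s b) - real (s a) - 1) / D0"
    have rcap: "gc.row_cap = real rc" by (simp add: gc.row_cap_def real_rc)
    note sw = gc.switch_avg_ge[OF am False, unfolded UA, folded D0_def, folded R_def]
    have R0: "R > 0" using sw(2) by linarith
    have sb: "s b \<le> rc" "s a < rc"
      using row_le[OF AX am(2)] row_le[of ?A a] A' am rows(1) by (auto simp: s_def slice_def)
    \<comment> \<open>With this \<open>D0\<close>, \<open>R\<close> is exactly the quotient of the
      two sides of \<open>choose_step\<close>.\<close>
    have Req: "R * ((real (s a) + 1) * (real rc - real (s b) + 1)) = (real rc - real (s a)) * real (s b)"
    proof -
      have eqD: "(real (s a) + 1) * (real rc - real (s b) + 1) = D0 * (real rc + 1)"
        by (simp add: D0_def rcap)
      moreover have "R * D0 = D0 + (real (s b) - real (s a) - 1)" using sw(1) by (simp add: R_def field_simps)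
      ultimately have "R * ((real (s a) + 1) * (real rc - real (s b) + 1)) = (D0 + (real (s b) - real (s a) - 1)) * (real rc + 1)"
        by (simp only: mult.assoc[symmetric])
      also have "\<dots> = (real (s a) + 1) * (real rc - real (s b) + 1) + (real (s b) - real (s a) - 1) * (real rc + 1)"
        unfolding eqD by (rule distrib_right)
      finally show ?thesis by (simp add: algebra_simps)
    qed
    define cK where "cK B = real (card {C \<in> K. U C = U B})" for B
    have cKA: "cK A > 0" "cK ?A > 0" using A A' by (auto simp: cK_def card_gt_0_iff)
    have cK_step: "cK ?A = cK A * R"
    proof -
      define f where "f i = real (rc choose card (rowset A i))" for i
      define f' where "f' i = real (rc choose card (rowset ?A i))" for i
      have P: "(\<Prod>i<m. g i) = g a * g b * (\<Prod>i\<in>{..<m} - {a} - {b}. g i)" for g :: "nat \<Rightarrow> real"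
        using am False prod.remove[of "{..<m}" a g] prod.remove[of "{..<m} - {a}" b g] by (simp add: mult.assoc)
      have "cK A = (\<Prod>i<m. f i)" "cK ?A = (\<Prod>i<m. f' i)"
        by (simp_all add: cK_def f_def f'_def card_K_class[OF A] card_K_class[OF A'])
      then have e1: "cK A = f a * f b * (\<Prod>i\<in>{..<m} - {a} - {b}. f i)"
        and e2: "cK ?A = f' a * f' b * (\<Prod>i\<in>{..<m} - {a} - {b}. f' i)" unfolding P by blast+
      have e3: "(\<Prod>i\<in>{..<m} - {a} - {b}. f' i) = (\<Prod>i\<in>{..<m} - {a} - {b}. f i)"
        using rows(4) by (intro prod.cong) (auto simp: f_def f'_def s_def)
      have "f' a * f' b * ((real (s a) + 1) * (real rc - real (s b) + 1)) =
          f a * f b * ((real rc - real (s a)) * real (s b))"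
        using choose_step[OF rows(3) sb] rows(1,2) by (simp add: f_def f'_def s_def)
      also have "\<dots> = f a * f b * R * ((real (s a) + 1) * (real rc - real (s b) + 1))"
        using Req by (simp add: mult_ac)
      finally have "f' a * f' b = f a * f b * R" using sb by simp
      then show ?thesis unfolding e1 e2 e3 by simp
    qed
    have cls_step: "real (card {G \<in> \<Omega>. U G = U ?A}) \<ge> real (card {G \<in> \<Omega>. U G = U A}) * (R * (1 - ?L))"
    proof -
      have "real (card (cls (U A))) * avg (cls (U A)) (\<lambda>G. real (card (excl X G b a)) / (real (card (excl X G a b)) + 1)) =
          (\<Sum>G\<in>cls (U A). real (card (excl X G b a)) / (real (card (excl X G a b)) + 1))"
        using gc.cls_ne by (simp add: avg_def)
      also have "\<dots> \<le> real (card (cls ((U A)(a := U A a + 1, b := U A b - 1))))"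
        by (rule switching_le) (use X_sub am False in auto)
      finally have "real (card (cls (U A))) * avg (cls (U A)) (\<lambda>G. real (card (excl X G b a)) / (real (card (excl X G a b)) + 1))
          \<le> real (card (cls (U ?A)))" unfolding UA' .
      moreover have "real (card (cls (U A))) * (R * (1 - ?L)) \<le>
          real (card (cls (U A))) * avg (cls (U A)) (\<lambda>G. real (card (excl X G b a)) / (real (card (excl X G a b)) + 1))"
        using sw(3) by (intro mult_left_mono) auto
      ultimately show ?thesis unfolding cls_eq by linarith
    qed
    have "(real (card {G \<in> \<Omega>. U G = U A}) * (R * (1 - ?L)) / real (card \<Omega>)) / (cK A * R / real (card K)) \<le> dens ?A"
      unfolding dens_def cK_def[symmetric] cK_step
      by (intro divide_right_mono cls_step) (use cKA R0 cards_pos in auto)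
    moreover have "(real (card {G \<in> \<Omega>. U G = U A}) * (R * (1 - ?L)) / real (card \<Omega>)) / (cK A * R / real (card K)) = (1 - ?L) * dens A"
    proof -
      have "(c * (R * l) / p) / (k * R / q) = l * ((c / p) / (k / q))" for c l p k q :: real using R0 by simp
      then show ?thesis unfolding dens_def cK_def[symmetric] .
    qed
    ultimately show ?thesis by simp
  qed
qed

definition "bad_vecs = {A. \<not> good_class m n z t Q (U A)}"

text \<open>Markov's inequality class by class: a nonempty class that fails to be a
  \<open>good_class\<close> has more than a share exp (- Q) of bad graphs, so the total size of such
  classes is at most exp Q times the number of bad graphs.\<close>

lemma bad_mass: "(\<Sum>A\<in>K \<inter> bad_vecs. dens A) \<le> (8 * real m ^ 3 * exp (Q - Q\<^sup>2)) * real (card K)"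
proof -
  let ?E = "{s. \<not> good_class m n z t Q s}"
  have "real (card {G \<in> \<Omega>. U G \<in> ?E}) \<le> exp Q * real (card {G \<in> \<Omega>. \<not> good G})"
  proof -
    let ?I = "U ` {G \<in> \<Omega>. U G \<in> ?E}"
    have finI: "finite ?I" by simp
    have each: "real (card {G \<in> \<Omega>. U G = s}) \<le> exp Q * real (card {G \<in> \<Omega>. U G = s \<and> \<not> good G})" if s: "s \<in> ?I" for s
    proof -
      obtain H where H: "H \<in> \<Omega>" "s = U H" "\<not> good_class m n z t Q s" using s by auto
      have c: "cls s = {G \<in> \<Omega>. U G = s}" using cls_eq[of H] H(2) by simp
      have "\<not> real (card {G \<in> cls s. \<not> good G}) \<le> exp (- Q) * real (card (cls s))"
      proof
        assume "real (card {G \<in> cls s. \<not> good G}) \<le> exp (- Q) * real (card (cls s))"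
        moreover have "cls s \<noteq> {}" using H c by auto
        ultimately have "good_class m n z t Q s"
          by (intro good_class.intro good_class_axioms.intro regular_columns_axioms) auto
        then show False using H(3) by simp
      qed
      then have "exp Q * (exp (- Q) * real (card (cls s))) \<le> exp Q * real (card {G \<in> cls s. \<not> good G})"
        by (intro mult_left_mono) auto
      moreover have "{G \<in> cls s. \<not> good G} = {G \<in> \<Omega>. U G = s \<and> \<not> good G}" unfolding c by auto
      moreover have "exp Q * (exp (- Q) * real (card (cls s))) = real (card (cls s))"
        by (simp add: mult.assoc[symmetric] flip: exp_add)
      ultimately show ?thesis unfolding c by simp
    qed
    have "{G \<in> \<Omega>. U G \<in> ?E} = (\<Union>s\<in>?I. {G \<in> \<Omega>. U G = s})" by auto
    then have "card {G \<in> \<Omega>. U G \<in> ?E} = (\<Sum>s\<in>?I. card {G \<in> \<Omega>. U G = s})"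
      using finI by (subst card_UN_disjoint[symmetric]) auto
    then have "real (card {G \<in> \<Omega>. U G \<in> ?E}) = (\<Sum>s\<in>?I. real (card {G \<in> \<Omega>. U G = s}))" by simp
    also have "\<dots> \<le> (\<Sum>s\<in>?I. exp Q * real (card {G \<in> \<Omega>. U G = s \<and> \<not> good G}))" by (intro sum_mono each)
    also have "\<dots> = exp Q * real (\<Sum>s\<in>?I. card {G \<in> \<Omega>. U G = s \<and> \<not> good G})" by (simp add: sum_distrib_left)
    also have "(\<Sum>s\<in>?I. card {G \<in> \<Omega>. U G = s \<and> \<not> good G}) = card (\<Union>s\<in>?I. {G \<in> \<Omega>. U G = s \<and> \<not> good G})"
      using finI by (subst card_UN_disjoint) auto
    also have "exp Q * real \<dots> \<le> exp Q * real (card {G \<in> \<Omega>. \<not> good G})"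
      by (intro mult_left_mono of_nat_mono card_mono) auto
    finally show ?thesis .
  qed
  also have "\<dots> \<le> exp Q * (8 * real m ^ 3 * exp (- (Q\<^sup>2)) * real (card \<Omega>))"
    by (intro mult_left_mono bad_graphs) auto
  also have "\<dots> = (8 * real m ^ 3 * exp (Q - Q\<^sup>2)) * real (card \<Omega>)"
    by (simp add: exp_diff exp_minus field_simps)
  finally have "real (card {G \<in> \<Omega>. U G \<in> ?E}) / real (card \<Omega>) \<le> 8 * real m ^ 3 * exp (Q - Q\<^sup>2)"
    using cards_pos by (simp add: field_simps)
  then have "real (card K) * (real (card {G \<in> \<Omega>. U G \<in> ?E}) / real (card \<Omega>)) \<le> real (card K) * (8 * real m ^ 3 * exp (Q - Q\<^sup>2))"
    by (intro mult_left_mono) auto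
  moreover have "K \<inter> bad_vecs = {A \<in> K. U A \<in> ?E}" by (auto simp: bad_vecs_def)
  ultimately show ?thesis using dens_sum[of ?E] by (simp add: mult.commute)
qed

text \<open>The slice argument applied to the square root of \<open>dens\<close>. Squared roots sum
  to \<open>card K\<close> because P has total mass 1, and a relative drop of the root is no larger
  than that of the density.\<close>

lemma density_concentration:
  assumes \<Gamma>: "0 < \<Gamma>" "\<Gamma> \<le> 1/4" "Q ^ 36 \<le> \<Gamma>\<^sup>2 * w\<^sup>2"
  shows "\<exists>B. B \<subseteq> U ` K \<and> real (card {G \<in> \<Omega>. U G \<in> B}) \<le> 6 * exp (- Q / 2) * real (card \<Omega>) \<and>
    real (card {A \<in> K. U A \<in> B}) \<le> 6 * exp (- Q / 2) * real (card K) \<and>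
    (\<forall>A\<in>K. U A \<notin> B \<longrightarrow> \<bar>dens A - 1\<bar> \<le> 5 * \<Gamma>)"
proof -
  define \<phi> where "\<phi> A = sqrt (dens A)" for A
  define L where "L = 2 * Q ^ 16 / w ^ 3"
  define \<eta> where "\<eta> = 8 * real m ^ 3 * exp (Q - Q\<^sup>2)"
  have \<phi>2: "(\<phi> A)\<^sup>2 = dens A" for A by (simp add: \<phi>_def dens_nonneg)
  have L: "0 \<le> L" "L \<le> 1"
  proof -
    show "0 \<le> L" using scale_bounds by (simp add: L_def)
    have "2 * Q ^ 16 \<le> w" using const_Q[of 2 16] w_ge[of 17] by simp
    also have "\<dots> \<le> w ^ 3" using scale_bounds(4) by (simp add: self_le_power)
    finally show "L \<le> 1" using scale_bounds by (simp add: L_def)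
  qed
  interpret sd: slice_density X edges \<phi> bad_vecs L \<eta>
  proof
    show "finite X" by simp
    have "0 < real (card X)"
    proof -
      have "X \<noteq> {}"
      proof
        assume "X = {}"
        then have "edges = 0"
          using Omega_ne Omega_sub_K by (auto simp: slice_def)
        then have "(\<Sum>j<n. real (t j)) = 0" by (simp add: edges_def flip: of_nat_sum)
        then show False using sum_t lam_bounds scale_bounds by simp
      qed
      then show ?thesis by (simp add: card_gt_0_iff)
    qed
    then show "card X > 0" by simp
    show "K \<noteq> {}" using Omega_ne Omega_sub_K by auto
    show "\<phi> A \<ge> 0" for A by (simp add: \<phi>_def dens_nonneg)
    show "(\<Sum>A\<in>K. (\<phi> A)\<^sup>2) = real (card K)" using dens_sum[of UNIV] cards_pos Omega_ne by (simp add: \<phi>2)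
    show "(\<Sum>A\<in>K \<inter> bad_vecs. (\<phi> A)\<^sup>2) \<le> \<eta> * real (card K)" using bad_mass by (simp add: \<phi>2 \<eta>_def)
    show "0 \<le> L" "L \<le> 1" by (rule L)+
    show "\<phi> (insert y (A - {x})) \<ge> (1 - L) * \<phi> A" if "A \<in> K" "A \<notin> bad_vecs" "x \<in> A" "y \<in> X - A" for A x y
    proof -
      have "(1 - L) * dens A \<le> dens (insert y (A - {x}))"
        using dens_step[of A x y] that by (auto simp: bad_vecs_def L_def)
      then have "sqrt ((1 - L) * dens A) \<le> \<phi> (insert y (A - {x}))" by (simp add: \<phi>_def)
      moreover have "1 - L \<le> sqrt (1 - L)"
        using L by (intro real_le_rsqrt) (simp add: power2_eq_square mult_left_le)
      then have "(1 - L) * \<phi> A \<le> sqrt (1 - L) * \<phi> A" by (intro mult_right_mono) (auto simp: \<phi>_def dens_nonneg)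
      ultimately show ?thesis by (simp add: real_sqrt_mult \<phi>_def)
    qed
  qed
  define I where "I = nat \<lceil>Q\<rceil>"
  define \<rho> where "\<rho> = exp (- Q)"
  have I: "I > 0" "real I \<le> 2 * Q" "real I \<ge> Q"
    using Q_large by (auto simp: I_def) linarith+
  have I2: "(real I)\<^sup>2 \<le> 4 * Q\<^sup>2" using power_mono[OF I(2), of 2] by (simp add: power_mult_distrib)
  have MX: "real (card X) \<le> Q * w ^ 4"
  proof -
    have "card X \<le> card ({..<m} \<times> {..<n})" using X_sub by (intro card_mono) auto
    then have "real (card X) \<le> real m * real n" by (simp add: card_cartesian_product flip: of_nat_mult)
    also have "\<dots> \<le> (Q * real n) * real n" using m_le by (intro mult_right_mono) auto
    also have "\<dots> = Q * w ^ 4" unfolding scale_bounds(5)[symmetric] by (simp add: eval_nat_numeral)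
    finally show ?thesis .
  qed
  \<comment> \<open>The exponent 36 is made up here: 1 from the number of cells, 32 from L^2, 2 from
    I^2, and 1 to absorb the numerical constant.\<close>
  have c1: "32 * real (card X) * L\<^sup>2 * (real I)\<^sup>2 \<le> \<Gamma>\<^sup>2 / 2"
  proof -
    have "32 * real (card X) * L\<^sup>2 * (real I)\<^sup>2 \<le> 32 * (Q * w ^ 4) * L\<^sup>2 * (4 * Q\<^sup>2)"
      using MX I2 scale_bounds by (intro mult_mono) auto
    also have "\<dots> = 512 * Q ^ 35 / w\<^sup>2"
    proof -
      have "L\<^sup>2 = 4 * Q ^ 32 / (w ^ 4 * w\<^sup>2)"
        by (simp add: L_def power_divide power_mult_distrib flip: power_mult power_add)
      moreover have "Q ^ 35 = Q * Q ^ 32 * Q\<^sup>2" by (simp flip: power_add power_Suc)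
      moreover have "32 * (Q * a) * (4 * c / (a * b)) * (4 * d) = 512 * (Q * c * d) / b" if "a \<noteq> 0" for a b c d :: real
        using that by simp
      moreover have "w ^ 4 \<noteq> 0" using scale_bounds(3) by simp
      ultimately show ?thesis by (simp only:)
    qed
    also have "\<dots> \<le> \<Gamma>\<^sup>2 / 2"
    proof -
      have "1024 * Q ^ 35 \<le> Q ^ 36" using const_Q[of 1024 35] by simp
      then have "1024 * Q ^ 35 \<le> \<Gamma>\<^sup>2 * w\<^sup>2" using \<Gamma>(3) by linarith
      then show ?thesis using scale_bounds(3) by (simp add: field_simps)
    qed
    finally show ?thesis .
  qed
  \<comment> \<open>The exponent Q - Q^2 of the bad mass leaves exp (- Q) to spare after all
    polynomial factors, because 3 * Q is at most Q^2.\<close>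
  have c2: "32 * real (card X) * \<eta> * (real I)\<^sup>2 \<le> \<rho> * \<Gamma>\<^sup>2"
  proof -
    have m3: "real m ^ 3 \<le> Q ^ 3 * w ^ 6"
    proof -
      have "real m ^ 3 \<le> (Q * w\<^sup>2) ^ 3" using m_le scale_bounds(5) by (intro power_mono) auto
      then show ?thesis by (simp add: power_mult_distrib flip: power_mult)
    qed
    have "32 * real (card X) * \<eta> * (real I)\<^sup>2 \<le> 32 * (Q * w ^ 4) * (8 * (Q ^ 3 * w ^ 6) * exp (Q - Q\<^sup>2)) * (4 * Q\<^sup>2)"
      unfolding \<eta>_def using MX I2 scale_bounds m3 by (intro mult_mono) auto
    also have "\<dots> = (1024 * Q ^ 6 * w ^ 12) * exp (Q - Q\<^sup>2) / w\<^sup>2"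
    proof -
      have "w ^ 12 = w ^ 4 * w ^ 6 * w\<^sup>2" by (simp flip: power_add)
      moreover have "Q ^ 6 = Q * Q ^ 3 * Q\<^sup>2" by (simp flip: power_add power_Suc)
      moreover have "32 * (Q * a) * (8 * (c * b) * e) * (4 * d) = 1024 * (Q * c * d) * (a * b * v) * e / v"
        if "v \<noteq> 0" for a b c d e v :: real using that by simp
      moreover have "w\<^sup>2 \<noteq> 0" using scale_bounds(3) by simp
      ultimately show ?thesis by (simp only:)
    qed
    also have "\<dots> \<le> exp (- Q) / w\<^sup>2"
    proof (rule divide_right_mono)
      have "1024 * Q ^ 6 * w ^ 12 \<le> w * w ^ 12"
        using const_Q[of 1024 6] w_ge[of 7] scale_bounds by (intro mult_right_mono) auto
      also have "\<dots> = w ^ 13" by (simp add: eval_nat_numeral)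
      also have "\<dots> \<le> w ^ 40" using scale_bounds by (intro power_increasing) auto
      also have "w ^ 40 = real n ^ 20" unfolding scale_bounds(5)[symmetric] by (simp flip: power_mult)
      also have "\<dots> \<le> exp Q" by (rule exp_Q)
      finally have "1024 * Q ^ 6 * w ^ 12 * exp (Q - Q\<^sup>2) \<le> exp Q * exp (Q - Q\<^sup>2)" by (intro mult_right_mono) auto
      also have "\<dots> = exp (2 * Q - Q\<^sup>2)" by (simp flip: exp_add)
      also have "\<dots> \<le> exp (- Q)"
      proof -
        have "3 * Q \<le> Q * Q" using Q_large by (intro mult_right_mono) auto
        then show ?thesis by (simp add: power2_eq_square)
      qed
      finally show "1024 * Q ^ 6 * w ^ 12 * exp (Q - Q\<^sup>2) \<le> exp (- Q)" .
    qed simp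
    also have "\<dots> \<le> \<rho> * \<Gamma>\<^sup>2"
    proof -
      have "1 \<le> \<Gamma>\<^sup>2 * w\<^sup>2" using \<Gamma>(3) scale_bounds one_le_power[of Q 36] by linarith
      then have "1 / w\<^sup>2 \<le> \<Gamma>\<^sup>2" using scale_bounds(3) by (simp add: field_simps)
      then have "\<rho> * (1 / w\<^sup>2) \<le> \<rho> * \<Gamma>\<^sup>2" by (intro mult_left_mono) (auto simp: \<rho>_def)
      then show ?thesis by (simp add: \<rho>_def)
    qed
    finally show ?thesis .
  qed
  have \<rho>: "0 \<le> \<rho>" "\<rho> \<le> 1/2"
  proof -
    show "0 \<le> \<rho>" by (simp add: \<rho>_def)
    have "2 \<le> exp Q" using exp_ge_add_one_self[of Q] Q_large by linarith
    then show "\<rho> \<le> 1/2" by (simp add: \<rho>_def exp_minus field_simps)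
  qed
  have \<eta>: "0 \<le> \<eta>" by (simp add: \<eta>_def)
  note conc = sd.concentration[OF \<Gamma>(1,2) I(1) \<rho> \<eta> c1 c2]
  have "(1/2) ^ I + 2 * \<rho> \<le> 3 * exp (- Q / 2)"
  proof -
    have "(1/2::real) ^ I \<le> exp (- Q / 2)" unfolding I_def by (rule real_half_power_le)
    moreover have "\<rho> \<le> exp (- Q / 2)" using scale_bounds by (simp add: \<rho>_def)
    ultimately show ?thesis by linarith
  qed
  then have up: "sd.upper_mass (1 + 2 * \<Gamma>) \<le> 3 * exp (- Q / 2)" and lo: "sd.lower_mass (1 - 2 * \<Gamma>) \<le> 3 * exp (- Q / 2)"
    using conc by linarith+
  let ?Up = "{A \<in> K. \<phi> A \<ge> 1 + 2 * \<Gamma>}" and ?Lo = "{A \<in> K. \<phi> A \<le> 1 - 2 * \<Gamma>}"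
  have up': "(\<Sum>A\<in>?Up. (\<phi> A)\<^sup>2) \<le> 3 * exp (- Q / 2) * real (card K)"
    using up cards_pos by (simp add: sd.upper_mass_def field_simps)
  have lo': "real (card ?Lo) \<le> 3 * exp (- Q / 2) * real (card K)"
    using lo cards_pos by (simp add: sd.lower_mass_def field_simps)
  \<comment> \<open>Above level 1 the density dominates the uniform measure and below level 1 it is
    dominated, so each tail bound passes to the other measure.\<close>
  have up'': "real (card ?Up) \<le> (\<Sum>A\<in>?Up. (\<phi> A)\<^sup>2)"
  proof -
    have "(\<Sum>A\<in>?Up. 1) \<le> (\<Sum>A\<in>?Up. (\<phi> A)\<^sup>2)"
      using \<Gamma>(1) by (intro sum_mono) (auto intro!: one_le_power)
    then show ?thesis by simp
  qed
  have lo'': "(\<Sum>A\<in>?Lo. (\<phi> A)\<^sup>2) \<le> real (card ?Lo)"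
  proof -
    have "(\<Sum>A\<in>?Lo. (\<phi> A)\<^sup>2) \<le> (\<Sum>A\<in>?Lo. 1)"
    proof (rule sum_mono)
      fix A assume "A \<in> ?Lo"
      moreover have "\<phi> A \<ge> 0" by (simp add: \<phi>_def dens_nonneg)
      ultimately show "(\<phi> A)\<^sup>2 \<le> 1" using \<Gamma>(1) by (intro power_le_one) auto
    qed
    then show ?thesis by simp
  qed
  \<comment> \<open>\<open>\<phi>\<close> depends on \<open>A\<close> only through
    \<open>U A\<close>, so the exceptional edge sets are a union of degree classes and no mass is
    added by passing to degree sequences.\<close>
  define B where "B = U ` (?Up \<union> ?Lo)"
  have BA: "{A \<in> K. U A \<in> B} = ?Up \<union> ?Lo"
  proof -
    have eq: "\<phi> A = \<phi> A'" if "U A = U A'" for A A' using dens_cong[OF that] by (simp add: \<phi>_def)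
    have "A \<in> ?Up \<union> ?Lo \<longleftrightarrow> A' \<in> ?Up \<union> ?Lo" if "U A = U A'" "A \<in> K" "A' \<in> K" for A A'
      using eq[OF that(1)] that(2,3) by simp
    moreover have "?Up \<union> ?Lo \<subseteq> K" by auto
    ultimately show ?thesis unfolding B_def by blast
  qed
  have disj: "?Up \<inter> ?Lo = {}" using \<Gamma>(1) by auto
  have "real (card {A \<in> K. U A \<in> B}) \<le> 6 * exp (- Q / 2) * real (card K)"
  proof -
    have "card (?Up \<union> ?Lo) \<le> card ?Up + card ?Lo" by (rule card_Un_le)
    then show ?thesis unfolding BA using up' up'' lo' by linarith
  qed
  moreover have "real (card {G \<in> \<Omega>. U G \<in> B}) \<le> 6 * exp (- Q / 2) * real (card \<Omega>)"
  proof -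
    have "(\<Sum>A\<in>{A \<in> K. U A \<in> B}. dens A) = (\<Sum>A\<in>?Up. (\<phi> A)\<^sup>2) + (\<Sum>A\<in>?Lo. (\<phi> A)\<^sup>2)"
      unfolding BA \<phi>2 using disj by (intro sum.union_disjoint) auto
    then have "(\<Sum>A\<in>{A \<in> K. U A \<in> B}. dens A) \<le> real (card K) * (6 * exp (- Q / 2))"
      using up' lo' lo'' by (simp add: mult.commute)
    then have "real (card K) * (real (card {G \<in> \<Omega>. U G \<in> B}) / real (card \<Omega>)) \<le> real (card K) * (6 * exp (- Q / 2))"
      unfolding dens_sum .
    then have "real (card {G \<in> \<Omega>. U G \<in> B}) / real (card \<Omega>) \<le> 6 * exp (- Q / 2)"
      using cards_pos(2) by (rule mult_left_le_imp_le)
    then show ?thesis using cards_pos by (simp add: field_simps)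
  qed
  moreover have "\<bar>dens A - 1\<bar> \<le> 5 * \<Gamma>" if "A \<in> K" "U A \<notin> B" for A
  proof -
    have "A \<notin> ?Up" "A \<notin> ?Lo" using that unfolding B_def by blast+
    then have 1: "\<bar>\<phi> A - 1\<bar> \<le> 2 * \<Gamma>" using that by auto
    \<comment> \<open>Back from the root to the density: the first factor is at most 2 * \<Gamma>,
      the second at most 2 + 2 * \<Gamma>, hence at most 5/2.\<close>
    have "dens A - 1 = (\<phi> A - 1) * (\<phi> A + 1)" unfolding \<phi>2[symmetric] by (simp add: power2_eq_square algebra_simps)
    also have "\<bar>\<dots>\<bar> \<le> (2 * \<Gamma>) * (5/2)"
      unfolding abs_mult using 1 \<Gamma> by (intro mult_mono) auto
    finally show ?thesis by simp
  qed
  moreover have "B \<subseteq> U ` K" by (auto simp: B_def)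
  ultimately show ?thesis by blast
qed

end

section \<open>Close distributions\<close>

text \<open>Distributing the error in proportion to the two bounds turns an inequality into an
  equation with explicit error coefficients, the form in which O-terms are stated.\<close>

lemma split_error:
  fixes x V W \<alpha> \<kappa> :: real
  assumes "\<bar>x\<bar> \<le> \<alpha> * V + \<kappa> * W" "\<alpha> \<ge> 0" "\<kappa> \<ge> 0" "V \<ge> 0" "W \<ge> 0"
  shows "\<exists>d e. \<bar>d\<bar> \<le> \<alpha> \<and> \<bar>e\<bar> \<le> \<kappa> \<and> x = d * V + e * W"
proof (cases "\<alpha> * V + \<kappa> * W = 0")
  case True
  then show ?thesis using assms by (intro exI[of _ 0]) auto
next
  case False
  define T where "T = \<alpha> * V + \<kappa> * W"
  have T: "T > 0" using False assms unfolding T_def by (smt (verit) mult_nonneg_nonneg)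
  define c where "c = x / T"
  have c: "\<bar>c\<bar> \<le> 1" using assms(1) T by (simp add: c_def T_def[symmetric])
  have "\<bar>c * \<alpha>\<bar> \<le> \<alpha>" "\<bar>c * \<kappa>\<bar> \<le> \<kappa>"
    using c assms mult_right_mono[OF c, of \<alpha>] mult_right_mono[OF c, of \<kappa>] by (simp_all add: abs_mult)
  moreover have "x = c * \<alpha> * V + c * \<kappa> * W"
  proof -
    have "x = c * T" using T by (simp add: c_def)
    then show ?thesis by (simp add: T_def distrib_left mult.assoc)
  qed
  ultimately show ?thesis by blast
qed

text \<open>The theorem at a single index, without asymptotics. The exceptional set is small under
  both laws, which is what allows expectations to be compared.\<close>

locale close_pmfs =
  fixes D D' :: "'a pmf" and S B :: "'a set" and \<alpha> \<kappa> :: real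
  assumes fin: "finite S" and supp: "set_pmf D \<subseteq> S" "set_pmf D' \<subseteq> S" and B: "B \<subseteq> S"
    and \<alpha>: "0 \<le> \<alpha>" "\<alpha> \<le> 1" and prob_B: "measure_pmf.prob D B \<le> \<kappa>" "measure_pmf.prob D' B \<le> \<kappa>"
    and close: "\<And>s. s \<in> S - B \<Longrightarrow> \<bar>pmf D s - pmf D' s\<bar> \<le> \<alpha> * pmf D' s"
begin

lemma \<kappa>: "\<kappa> \<ge> 0" using prob_B(1) measure_nonneg[of "measure_pmf D" B] by linarith

lemma expectation_eq:
  "measure_pmf.expectation D X = (\<Sum>s\<in>S. X s * pmf D s)"
  "measure_pmf.expectation D' X = (\<Sum>s\<in>S. X s * pmf D' s)" for X :: "'a \<Rightarrow> real"
  using integral_measure_pmf_real[OF fin, of D X] integral_measure_pmf_real[OF fin, of D' X] supp by auto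

lemma prob_eq:
  assumes "E \<subseteq> S"
  shows "measure_pmf.prob D E = (\<Sum>s\<in>E. pmf D s)" "measure_pmf.prob D' E = (\<Sum>s\<in>E. pmf D' s)"
  using finite_subset[OF assms fin] by (simp_all add: measure_measure_pmf_finite)

lemma S_ne: "S \<noteq> {}" using supp set_pmf_not_empty[of D] by auto

lemma sum_one: "(\<Sum>s\<in>S. pmf D s) = 1" "(\<Sum>s\<in>S. pmf D' s) = 1"
  by (intro sum_pmf_eq_1 fin supp)+

lemma sum_close:
  assumes g: "\<And>s. s \<in> S \<Longrightarrow> \<bar>g s\<bar> \<le> G"
  shows "\<bar>(\<Sum>s\<in>S. g s * pmf D s) - (\<Sum>s\<in>S. g s * pmf D' s)\<bar> \<le> \<alpha> * (\<Sum>s\<in>S. \<bar>g s\<bar> * pmf D' s) + 2 * \<kappa> * G"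
proof -
  have G: "G \<ge> 0" using S_ne g by (smt (verit) abs_ge_zero all_not_in_conv)
  have split: "(\<Sum>s\<in>S. h s) = (\<Sum>s\<in>S - B. h s) + (\<Sum>s\<in>B. h s)" for h :: "'a \<Rightarrow> real"
    by (rule sum.subset_diff[OF B fin])
  have "\<bar>(\<Sum>s\<in>S. g s * pmf D s) - (\<Sum>s\<in>S. g s * pmf D' s)\<bar> = \<bar>\<Sum>s\<in>S. g s * (pmf D s - pmf D' s)\<bar>"
    by (simp add: sum_subtractf right_diff_distrib)
  also have "\<dots> \<le> (\<Sum>s\<in>S. \<bar>g s * (pmf D s - pmf D' s)\<bar>)" by (rule sum_abs)
  also have "\<dots> = (\<Sum>s\<in>S - B. \<bar>g s * (pmf D s - pmf D' s)\<bar>) + (\<Sum>s\<in>B. \<bar>g s * (pmf D s - pmf D' s)\<bar>)"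
    by (rule split)
  also have "(\<Sum>s\<in>S - B. \<bar>g s * (pmf D s - pmf D' s)\<bar>) \<le> (\<Sum>s\<in>S - B. \<alpha> * (\<bar>g s\<bar> * pmf D' s))"
  proof (rule sum_mono)
    fix s assume "s \<in> S - B"
    then have "\<bar>g s\<bar> * \<bar>pmf D s - pmf D' s\<bar> \<le> \<bar>g s\<bar> * (\<alpha> * pmf D' s)" by (intro mult_left_mono close) auto
    then show "\<bar>g s * (pmf D s - pmf D' s)\<bar> \<le> \<alpha> * (\<bar>g s\<bar> * pmf D' s)" by (simp add: abs_mult mult_ac)
  qed
  also have "\<dots> \<le> (\<Sum>s\<in>S. \<alpha> * (\<bar>g s\<bar> * pmf D' s))" using fin \<alpha> by (intro sum_mono2) auto
  also have "\<dots> = \<alpha> * (\<Sum>s\<in>S. \<bar>g s\<bar> * pmf D' s)" by (simp add: sum_distrib_left)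
  also have "(\<Sum>s\<in>B. \<bar>g s * (pmf D s - pmf D' s)\<bar>) \<le> (\<Sum>s\<in>B. G * (pmf D s + pmf D' s))"
  proof (rule sum_mono)
    fix s assume "s \<in> B"
    then have "\<bar>g s\<bar> \<le> G" using g B by auto
    moreover have "\<bar>pmf D s - pmf D' s\<bar> \<le> pmf D s + pmf D' s" by (smt (verit) pmf_nonneg)
    ultimately show "\<bar>g s * (pmf D s - pmf D' s)\<bar> \<le> G * (pmf D s + pmf D' s)"
      unfolding abs_mult using G by (intro mult_mono) auto
  qed
  also have "\<dots> = G * (measure_pmf.prob D B + measure_pmf.prob D' B)"
    unfolding prob_eq[OF B] by (simp add: sum_distrib_left[symmetric] sum.distrib)
  also have "\<dots> \<le> G * (\<kappa> + \<kappa>)" using prob_B G by (intro mult_left_mono) auto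
  finally show ?thesis by (simp add: mult_ac)
qed

lemma prob_transfer:
  assumes E: "E \<subseteq> S"
  shows "\<exists>d e. \<bar>d\<bar> \<le> \<alpha> \<and> \<bar>e\<bar> \<le> 2 * \<kappa> \<and> measure_pmf.prob D E = (1 + d) * measure_pmf.prob D' E + e"
proof -
  let ?g = "\<lambda>s. of_bool (s \<in> E) :: real"
  have eq: "(\<Sum>s\<in>S. ?g s * pmf p s) = (\<Sum>s\<in>E. pmf p s)" for p
  proof -
    have "(\<Sum>s\<in>S. ?g s * pmf p s) = (\<Sum>s\<in>S. if s \<in> E then pmf p s else 0)" by (intro sum.cong) auto
    also have "\<dots> = (\<Sum>s\<in>S \<inter> E. pmf p s)" using fin by (simp add: sum.inter_restrict)
    finally show ?thesis using E by (simp add: Int_absorb1)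
  qed
  have "\<bar>measure_pmf.prob D E - measure_pmf.prob D' E\<bar> \<le> \<alpha> * measure_pmf.prob D' E + 2 * \<kappa> * 1"
    using sum_close[of ?g 1] unfolding prob_eq[OF E] eq[symmetric] by simp
  from split_error[OF this \<alpha>(1)] \<kappa> obtain d e where
    "\<bar>d\<bar> \<le> \<alpha>" "\<bar>e\<bar> \<le> 2 * \<kappa>" "measure_pmf.prob D E - measure_pmf.prob D' E = d * measure_pmf.prob D' E + e * 1" by auto
  then show ?thesis by (intro exI[of _ d] exI[of _ e]) (simp add: algebra_simps)
qed

lemma Max_ge_abs: "s \<in> S \<Longrightarrow> f s \<le> (MAX s\<in>S. f s)" for f :: "'a \<Rightarrow> real"
  using fin by (intro Max_ge) auto

lemma expectation_transfer:
  fixes X :: "'a \<Rightarrow> real"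
  shows "\<exists>d e. \<bar>d\<bar> \<le> \<alpha> \<and> \<bar>e\<bar> \<le> 2 * \<kappa> \<and> measure_pmf.expectation D X =
    measure_pmf.expectation D' X + d * measure_pmf.expectation D' (\<lambda>s. \<bar>X s\<bar>) + e * (MAX s\<in>S. \<bar>X s\<bar>)"
proof -
  let ?W = "MAX s\<in>S. \<bar>X s\<bar>"
  have W: "?W \<ge> 0" using S_ne Max_ge_abs[of _ "\<lambda>s. \<bar>X s\<bar>"] by (smt (verit) abs_ge_zero all_not_in_conv)
  have "\<bar>measure_pmf.expectation D X - measure_pmf.expectation D' X\<bar> \<le>
      \<alpha> * measure_pmf.expectation D' (\<lambda>s. \<bar>X s\<bar>) + 2 * \<kappa> * ?W"
    unfolding expectation_eq by (rule sum_close) (rule Max_ge_abs)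
  moreover have "measure_pmf.expectation D' (\<lambda>s. \<bar>X s\<bar>) \<ge> 0" by (intro Bochner_Integration.integral_nonneg) auto
  ultimately obtain d e where "\<bar>d\<bar> \<le> \<alpha>" "\<bar>e\<bar> \<le> 2 * \<kappa>" "measure_pmf.expectation D X - measure_pmf.expectation D' X =
      d * measure_pmf.expectation D' (\<lambda>s. \<bar>X s\<bar>) + e * ?W"
    using split_error[of "measure_pmf.expectation D X - measure_pmf.expectation D' X" \<alpha> "measure_pmf.expectation D' (\<lambda>s. \<bar>X s\<bar>)" "2 * \<kappa>" ?W]
      \<alpha>(1) \<kappa> W by auto
  then show ?thesis by (intro exI[of _ d] exI[of _ e]) (simp add: algebra_simps)
qed

text \<open>The two laws have different means. The variance is the least second moment about a
  point, so the upper bound is taken about the mean of \<open>D'\<close> and the lower bound about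
  the mean of \<open>D\<close>; the means themselves are never compared. Squared deviations are at
  most 4 times the maximum of X^2.\<close>

lemma variance_transfer:
  fixes X :: "'a \<Rightarrow> real"
  shows "\<exists>d e. \<bar>d\<bar> \<le> \<alpha> \<and> \<bar>e\<bar> \<le> 8 * \<kappa> \<and> measure_pmf.variance D X =
    (1 + d) * measure_pmf.variance D' X + e * (MAX s\<in>S. (X s)\<^sup>2)"
proof -
  let ?W = "MAX s\<in>S. (X s)\<^sup>2"
  define \<mu> where "\<mu> = measure_pmf.expectation D X"
  define \<mu>' where "\<mu>' = measure_pmf.expectation D' X"
  define q where "q p c = (\<Sum>s\<in>S. (X s - c)\<^sup>2 * pmf p s)" for p c
  have W: "?W \<ge> 0" using S_ne Max_ge_abs[of _ "\<lambda>s. (X s)\<^sup>2"] by (smt (verit) zero_le_power2 all_not_in_conv)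
  have XW: "\<bar>X s\<bar> \<le> sqrt ?W" if "s \<in> S" for s
    using Max_ge_abs[OF that, of "\<lambda>s. (X s)\<^sup>2"] by (metis real_sqrt_abs real_sqrt_le_iff)
  have mean_le: "\<bar>\<Sum>s\<in>S. X s * pmf p s\<bar> \<le> sqrt ?W" if "(\<Sum>s\<in>S. pmf p s) = 1" for p
  proof -
    have "\<bar>\<Sum>s\<in>S. X s * pmf p s\<bar> \<le> (\<Sum>s\<in>S. \<bar>X s * pmf p s\<bar>)" by (rule sum_abs)
    also have "\<dots> \<le> (\<Sum>s\<in>S. sqrt ?W * pmf p s)" using XW by (intro sum_mono) (auto simp: abs_mult intro: mult_right_mono)
    also have "\<dots> = sqrt ?W" using that by (simp add: sum_distrib_left[symmetric])
    finally show ?thesis .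
  qed
  have mu: "\<bar>\<mu>\<bar> \<le> sqrt ?W" "\<bar>\<mu>'\<bar> \<le> sqrt ?W"
    unfolding \<mu>_def \<mu>'_def expectation_eq by (intro mean_le sum_one)+
  have sq_le: "(X s - c)\<^sup>2 \<le> 4 * ?W" if "s \<in> S" "\<bar>c\<bar> \<le> sqrt ?W" for s c
  proof -
    have "\<bar>X s - c\<bar> \<le> 2 * sqrt ?W" using XW[OF that(1)] that(2) by linarith
    then have "\<bar>X s - c\<bar>\<^sup>2 \<le> (2 * sqrt ?W)\<^sup>2" by (intro power_mono) auto
    then show ?thesis using W by (simp add: power_mult_distrib)
  qed
  have var: "measure_pmf.variance D X = q D \<mu>" "measure_pmf.variance D' X = q D' \<mu>'"
    unfolding q_def \<mu>_def \<mu>'_def by (simp_all only: expectation_eq)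
  have min_gen: "(\<Sum>s\<in>S. (X s - (\<Sum>s\<in>S. X s * pmf p s))\<^sup>2 * pmf p s) \<le> q p c" if one: "(\<Sum>s\<in>S. pmf p s) = 1" for p c
  proof -
    define \<nu> where "\<nu> = (\<Sum>s\<in>S. X s * pmf p s)"
    have "q p c = (\<Sum>s\<in>S. (X s - \<nu>)\<^sup>2 * pmf p s + 2 * (\<nu> - c) * (X s * pmf p s - \<nu> * pmf p s) + (\<nu> - c)\<^sup>2 * pmf p s)"
      unfolding q_def by (intro sum.cong refl) (simp add: power2_eq_square algebra_simps)
    also have "\<dots> = (\<Sum>s\<in>S. (X s - \<nu>)\<^sup>2 * pmf p s) + 2 * (\<nu> - c) * (\<nu> - \<nu> * 1) + (\<nu> - c)\<^sup>2 * 1"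
      unfolding sum.distrib sum_distrib_left[symmetric] sum_subtractf one \<nu>_def[symmetric] ..
    finally show ?thesis by (simp add: \<nu>_def)
  qed
  have min: "q D \<mu> \<le> q D c" "q D' \<mu>' \<le> q D' c" for c
    using min_gen[OF sum_one(1), of c] min_gen[OF sum_one(2), of c]
    unfolding \<mu>_def \<mu>'_def expectation_eq by (simp_all add: q_def)
  have up: "q D \<mu> \<le> q D' \<mu>' + \<alpha> * q D' \<mu>' + 2 * \<kappa> * (4 * ?W)"
  proof -
    have "\<bar>q D \<mu>' - q D' \<mu>'\<bar> \<le> \<alpha> * (\<Sum>s\<in>S. \<bar>(X s - \<mu>')\<^sup>2\<bar> * pmf D' s) + 2 * \<kappa> * (4 * ?W)"
      unfolding q_def using sq_le mu by (intro sum_close) auto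
    then show ?thesis using min(1)[of \<mu>'] by (simp add: q_def)
  qed
  have lo: "q D \<mu> \<ge> (1 - \<alpha>) * q D' \<mu>' - 4 * \<kappa> * ?W"
  proof -
    have "(1 - \<alpha>) * (q D' \<mu> - 4 * ?W * \<kappa>) \<le> (1 - \<alpha>) * (\<Sum>s\<in>S - B. (X s - \<mu>)\<^sup>2 * pmf D' s)"
    proof (rule mult_left_mono)
      have "(\<Sum>s\<in>B. (X s - \<mu>)\<^sup>2 * pmf D' s) \<le> (\<Sum>s\<in>B. 4 * ?W * pmf D' s)"
        using sq_le mu B by (intro sum_mono mult_right_mono) auto
      also have "\<dots> = 4 * ?W * measure_pmf.prob D' B" unfolding prob_eq[OF B] by (rule sum_distrib_left[symmetric])
      also have "\<dots> \<le> 4 * ?W * \<kappa>" using prob_B W by (intro mult_left_mono) auto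
      finally show "q D' \<mu> - 4 * ?W * \<kappa> \<le> (\<Sum>s\<in>S - B. (X s - \<mu>)\<^sup>2 * pmf D' s)"
        using sum.subset_diff[OF B fin, of "\<lambda>s. (X s - \<mu>)\<^sup>2 * pmf D' s"] by (simp add: q_def)
    qed (use \<alpha> in auto)
    also have "\<dots> = (\<Sum>s\<in>S - B. (X s - \<mu>)\<^sup>2 * ((1 - \<alpha>) * pmf D' s))"
      by (simp add: sum_distrib_left mult_ac)
    also have "\<dots> \<le> (\<Sum>s\<in>S - B. (X s - \<mu>)\<^sup>2 * pmf D s)"
    proof (intro sum_mono mult_left_mono)
      fix s assume "s \<in> S - B"
      from close[OF this] show "(1 - \<alpha>) * pmf D' s \<le> pmf D s" by (simp add: algebra_simps)
    qed auto
    also have "\<dots> \<le> q D \<mu>" unfolding q_def using fin by (intro sum_mono2) auto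
    finally have "(1 - \<alpha>) * (q D' \<mu> - 4 * ?W * \<kappa>) \<le> q D \<mu>" .
    moreover have "(1 - \<alpha>) * q D' \<mu>' \<le> (1 - \<alpha>) * q D' \<mu>" using \<alpha> min(2) by (intro mult_left_mono) auto
    moreover have "(1 - \<alpha>) * (4 * ?W * \<kappa>) \<le> 1 * (4 * ?W * \<kappa>)" using \<alpha> W \<kappa> by (intro mult_right_mono) auto
    ultimately show ?thesis by (simp add: right_diff_distrib mult_ac)
  qed
  have q0: "q D' \<mu>' \<ge> 0" unfolding q_def by (intro sum_nonneg) auto
  have W\<kappa>: "\<kappa> * ?W \<ge> 0" using W \<kappa> by simp
  have "\<bar>q D \<mu> - q D' \<mu>'\<bar> \<le> \<alpha> * q D' \<mu>' + 8 * \<kappa> * ?W"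
    using up lo W\<kappa> by (simp add: abs_le_iff algebra_simps)
  from split_error[OF this \<alpha>(1) _ q0 W] \<kappa> obtain d e where
    "\<bar>d\<bar> \<le> \<alpha>" "\<bar>e\<bar> \<le> 8 * \<kappa>" "q D \<mu> - q D' \<mu>' = d * q D' \<mu>' + e * ?W" by auto
  then show ?thesis unfolding var by (intro exI[of _ d] exI[of _ e]) (simp add: algebra_simps)
qed

end

lemma close_pmfs_mono:
  assumes "close_pmfs D D' S B \<alpha> \<kappa>" "\<kappa> \<le> \<kappa>'"
  shows "close_pmfs D D' S B \<alpha> \<kappa>'"
proof -
  interpret close_pmfs D D' S B \<alpha> \<kappa> by fact
  show ?thesis
  proof
    show "measure_pmf.prob D B \<le> \<kappa>'" "measure_pmf.prob D' B \<le> \<kappa>'" using prob_B assms(2) by linarith+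
  qed (use fin supp B \<alpha> close in auto)
qed

lemma pmf_map_pmf_of_set:
  assumes "finite A" "A \<noteq> {}"
  shows "pmf (map_pmf f (pmf_of_set A)) s = real (card {x \<in> A. f x = s}) / real (card A)"
proof -
  have "A \<inter> f -` {s} = {x \<in> A. f x = s}" by auto
  then show ?thesis using assms by (simp add: pmf_map measure_pmf_of_set)
qed

lemma prob_map_pmf_of_set:
  assumes "finite A" "A \<noteq> {}"
  shows "measure_pmf.prob (map_pmf f (pmf_of_set A)) E = real (card {x \<in> A. f x \<in> E}) / real (card A)"
proof -
  have "A \<inter> f -` E = {x \<in> A. f x \<in> E}" by auto
  then show ?thesis using assms by (simp add: measure_pmf_of_set)
qed

lemma U_degrees_int_vecs:
  assumes "A \<subseteq> {..<m} \<times> {..<n}"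
  shows "U_degrees m A \<in> int_vecs n m"
proof -
  have "card (rowset A i) \<le> n" for i
  proof -
    have "rowset A i \<subseteq> {..<n}" using assms by (auto simp: rowset_def)
    from card_mono[OF _ this] show ?thesis by simp
  qed
  then show ?thesis by (auto simp: int_vecs_def U_degrees_rowset)
qed

section \<open>Identification of the two random models\<close>

context regular_columns begin

definition "unif_deg = map_pmf U (pmf_of_set K)"
definition "graph_deg = map_pmf U (pmf_of_set \<Omega>)"

lemma K_ne: "K \<noteq> {}" using Omega_ne Omega_sub_K by auto

lemma sub_grid: "A \<in> K \<Longrightarrow> A \<subseteq> {..<m} \<times> {..<n}" "G \<in> \<Omega> \<Longrightarrow> G \<subseteq> {..<m} \<times> {..<n}"
  using X_sub by (auto simp: slice_def col_graphs_def)

lemma card_X: "card X = m * rc"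
  using card_eq_sum_rowset[OF X_sub] card_rowset_X by simp

text \<open>Given its row degrees, an edge set chooses each row freely among \<open>rc\<close>
  allowed cells. This identifies both binomial models, with \<open>rc\<close> equal to n or n -
  1.\<close>

lemma pmf_unif_deg:
  "pmf unif_deg s = (if s \<in> int_vecs n m \<and> (\<Sum>i<m. s i) = edges
     then (\<Prod>i<m. real (rc choose s i)) / real ((m * rc) choose edges) else 0)"
proof -
  have pm: "pmf unif_deg s = real (card {A \<in> K. U A = s}) / real (card K)"
    unfolding unif_deg_def using K_ne by (simp add: pmf_map_pmf_of_set)
  have cK: "card K = (m * rc) choose edges" by (simp add: card_slice card_X)
  show ?thesis
  proof (cases "s \<in> int_vecs n m \<and> (\<Sum>i<m. s i) = edges")
    case True
    then have ext: "s \<in> extensional {..<m}" by (simp add: int_vecs_def PiE_iff)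
    have "{A \<in> K. U A = s} = {B. B \<subseteq> X \<and> (\<forall>i<m. card (rowset B i) = s i)}"
    proof (intro equalityI subsetI)
      fix A assume "A \<in> {A \<in> K. U A = s}"
      then show "A \<in> {B. B \<subseteq> X \<and> (\<forall>i<m. card (rowset B i) = s i)}"
        by (auto simp: slice_def U_degrees_rowset)
    next
      fix A assume A: "A \<in> {B. B \<subseteq> X \<and> (\<forall>i<m. card (rowset B i) = s i)}"
      then have "card A = (\<Sum>i<m. card (rowset A i))" using X_sub by (intro card_eq_sum_rowset) auto
      also have "\<dots> = edges" using A True by simp
      finally have "A \<in> K" using A by (simp add: slice_def)
      moreover have "U A = s" using A ext by (auto simp: U_degrees_rowset fun_eq_iff extensional_def)
      ultimately show "A \<in> {A \<in> K. U A = s}" by simp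
    qed
    then show ?thesis using True card_row_class[OF X_sub, of rc s] card_rowset_X by (simp add: pm cK)
  next
    case False
    have "{A \<in> K. U A = s} = {}"
    proof (intro equals0I)
      fix A assume A: "A \<in> {A \<in> K. U A = s}"
      have "(\<Sum>i<m. s i) = (\<Sum>i<m. card (rowset A i))" using A by (auto simp: U_degrees_rowset)
      also have "\<dots> = card A" using sub_grid(1)[of A] A by (intro card_eq_sum_rowset[symmetric]) auto
      also have "\<dots> = edges" using A by (auto simp: slice_def)
      finally show False using False U_degrees_int_vecs[OF sub_grid(1)[of A]] A by auto
    qed
    then have c0: "card {A \<in> K. U A = s} = 0" by (simp only: card.empty)
    show ?thesis unfolding pm c0 using False by auto
  qed
qed

lemma close_pmfs_degrees:
  assumes \<Gamma>: "0 < \<Gamma>" "\<Gamma> \<le> 1/5" "Q ^ 36 \<le> \<Gamma>\<^sup>2 * w\<^sup>2"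
  shows "\<exists>B. close_pmfs graph_deg unif_deg (int_vecs n m) B (5 * \<Gamma>) (6 * exp (- Q / 2))"
proof -
  have "\<Gamma> \<le> 1/4" using \<Gamma> by simp
  from density_concentration[OF \<Gamma>(1) this \<Gamma>(3)] obtain B where B: "B \<subseteq> U ` K"
    "real (card {G \<in> \<Omega>. U G \<in> B}) \<le> 6 * exp (- Q / 2) * real (card \<Omega>)"
    "real (card {A \<in> K. U A \<in> B}) \<le> 6 * exp (- Q / 2) * real (card K)"
    "\<And>A. A \<in> K \<Longrightarrow> U A \<notin> B \<Longrightarrow> \<bar>dens A - 1\<bar> \<le> 5 * \<Gamma>" by blast
  have pmD: "pmf graph_deg s = real (card {G \<in> \<Omega>. U G = s}) / real (card \<Omega>)"
    "pmf unif_deg s = real (card {A \<in> K. U A = s}) / real (card K)" for s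
    unfolding graph_deg_def unif_deg_def using K_ne Omega_ne by (simp_all add: pmf_map_pmf_of_set)
  have "close_pmfs graph_deg unif_deg (int_vecs n m) B (5 * \<Gamma>) (6 * exp (- Q / 2))"
  proof
    show "finite (int_vecs n m)" by (rule finite_int_vecs)
    show "set_pmf graph_deg \<subseteq> int_vecs n m"
      unfolding graph_deg_def using Omega_ne sub_grid(2) by (auto intro: U_degrees_int_vecs)
    show "set_pmf unif_deg \<subseteq> int_vecs n m"
      unfolding unif_deg_def using K_ne sub_grid(1) by (auto intro: U_degrees_int_vecs)
    show "B \<subseteq> int_vecs n m" using B(1) sub_grid(1) U_degrees_int_vecs by blast
    show "0 \<le> 5 * \<Gamma>" "5 * \<Gamma> \<le> 1" using \<Gamma> by auto
    show "measure_pmf.prob graph_deg B \<le> 6 * exp (- Q / 2)"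
      unfolding graph_deg_def prob_map_pmf_of_set[OF finite_Omega Omega_ne] using B(2) cards_pos by (simp add: field_simps)
    show "measure_pmf.prob unif_deg B \<le> 6 * exp (- Q / 2)"
      unfolding unif_deg_def prob_map_pmf_of_set[OF finite_K K_ne] using B(3) cards_pos by (simp add: field_simps)
    fix s assume s: "s \<in> int_vecs n m - B"
    show "\<bar>pmf graph_deg s - pmf unif_deg s\<bar> \<le> 5 * \<Gamma> * pmf unif_deg s"
    proof (cases "\<exists>A\<in>K. U A = s")
      case True
      then obtain A where A: "A \<in> K" "U A = s" by auto
      have "real (card {B \<in> K. U B = s}) > 0" using A by (auto simp: card_gt_0_iff)
      then have p: "pmf unif_deg s > 0" using cards_pos by (simp add: pmD)
      have "dens A = pmf graph_deg s / pmf unif_deg s" using A(2) by (simp add: dens_def pmD)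
      then have "pmf graph_deg s - pmf unif_deg s = (dens A - 1) * pmf unif_deg s"
        using p by (simp add: field_simps)
      also have "\<bar>\<dots>\<bar> = \<bar>dens A - 1\<bar> * pmf unif_deg s" by (simp add: abs_mult)
      also have "\<dots> \<le> 5 * \<Gamma> * pmf unif_deg s" using B(4)[OF A(1)] A s by (intro mult_right_mono) auto
      finally show ?thesis .
    next
      case False
      then have "{A \<in> K. U A = s} = {}" "{G \<in> \<Omega>. U G = s} = {}" using Omega_sub_K by auto
      then have "pmf graph_deg s = 0" "pmf unif_deg s = 0" unfolding pmD by (simp_all only: card.empty of_nat_0 div_0)
      then show ?thesis by simp
    qed
  qed
  then show ?thesis by blast
qed

end

lemma bip_graphs_eq: "bip_graphs m n t = col_graphs (cells m n False) n t"
  by (auto simp: bip_graphs_def col_graphs_def cells_def colset_def)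

lemma bip_digraphs_eq: "bip_digraphs n t = col_graphs (cells n n True) n t"
  by (auto simp: bip_digraphs_def bip_graphs_def col_graphs_def cells_def colset_def)

lemma G_dist_eq:
  assumes "regular_columns m n False t Q"
  shows "G_dist m n t = regular_columns.graph_deg m n False t"
  using assms by (simp add: G_dist_def regular_columns.graph_deg_def bip_graphs_eq)

lemma G_dist_vec_eq:
  assumes "regular_columns n n True t Q"
  shows "G_dist_vec n t = regular_columns.graph_deg n n True t"
  using assms by (simp add: G_dist_vec_def regular_columns.graph_deg_def bip_digraphs_eq)

lemma B_dist_eq:
  assumes rc: "regular_columns m n False t Q" and t: "t \<in> int_vecs m n"
  shows "B_dist m n t = regular_columns.unif_deg m n False t"
proof (rule pmf_eqI)
  interpret regular_columns m n False t Q by (rule rc)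
  show "pmf (B_dist m n t) s = pmf unif_deg s" for s
    unfolding pmf_B_dist[OF t] pmf_unif_deg B_mass_def edges_def rc_def by simp
qed

lemma B_dist_vec_eq:
  assumes rc: "regular_columns n n True t Q"
  shows "B_dist_vec n t = regular_columns.unif_deg n n True t"
proof (rule pmf_eqI)
  interpret regular_columns n n True t Q by (rule rc)
  have sq: "n\<^sup>2 - n = n * (n - 1)" by (simp add: power2_eq_square algebra_simps)
  \<comment> \<open>For digraphs \<open>t_le\<close> gives t j at most n - 1, so the number of edges
    does not exceed the number of cells and the mass function is normalised.\<close>
  have "(\<Sum>j<n. t j) \<le> (\<Sum>j<n. n - 1)" using t_le by (intro sum_mono) (auto simp: cap_def)
  then have le: "(\<Sum>j<n. t j) \<le> n\<^sup>2 - n" unfolding sq by simp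
  show "pmf (B_dist_vec n t) s = pmf unif_deg s" for s
    unfolding pmf_B_dist_vec[OF le] pmf_unif_deg B_mass_vec_def edges_def rc_def sq by simp
qed

section \<open>Asymptotics\<close>

lemma eventually_powr_ge:
  fixes d C :: real
  assumes "d > 0"
  shows "\<forall>\<^sub>F x in at_top. C \<le> x powr d"
  using eventually_ge_at_top[of "max C 1 powr (1 / d)"]
proof eventually_elim
  case (elim x)
  have "max C 1 = (max C 1 powr (1 / d)) powr d" using assms by (simp add: powr_powr)
  also have "\<dots> \<le> x powr d" using elim assms by (intro powr_mono2) auto
  finally show ?case by simp
qed

lemma eventually_mult_powr_le:
  fixes d e C :: real
  assumes "d < e"
  shows "\<forall>\<^sub>F x in at_top. C * x powr d \<le> x powr e"
proof -
  have "e - d > 0" using assms by simp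
  from eventually_powr_ge[OF this, of C] eventually_gt_at_top[of 0] show ?thesis
  proof eventually_elim
    case (elim x)
    have "C * x powr d \<le> x powr (e - d) * x powr d" using elim assms by (intro mult_right_mono) auto
    also have "\<dots> = x powr e" by (simp flip: powr_add)
    finally show ?case .
  qed
qed

lemma eventually_ln_le_powr:
  fixes e C1 C2 :: real
  assumes "e > 0" "C1 \<ge> 0" "C2 \<ge> 0"
  shows "\<forall>\<^sub>F x in at_top. C1 + C2 * ln x \<le> x powr e"
proof -
  have "e / 2 < e" using assms by simp
  from eventually_mult_powr_le[OF this, of "C1 + C2 * (2 / e)"] eventually_ge_at_top[of 1] show ?thesis
  proof eventually_elim
    case (elim x)
    have 1: "1 \<le> x powr (e / 2)" using elim assms by (intro ge_one_powr_ge_zero) auto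
    have "ln x \<le> x powr (e / 2) / (e / 2)" using elim assms by (intro ln_powr_bound) auto
    then have "C2 * ln x \<le> C2 * (x powr (e / 2) / (e / 2))" using assms by (intro mult_left_mono) auto
    moreover have "C1 * 1 \<le> C1 * x powr (e / 2)" using 1 assms by (intro mult_left_mono) auto
    ultimately have "C1 + C2 * ln x \<le> (C1 + C2 * (2 / e)) * x powr (e / 2)" by (simp add: algebra_simps)
    then show ?case using elim by linarith
  qed
qed

text \<open>All finite hypotheses hold with Q = n^e. The regularity parameter is e / 4, so that
  constants, logarithms and the passage between powers of m and n all fit into one factor Q. The
  bound \<open>e \<le> 1/200\<close> makes Q^60 at most the square root of n.\<close>

lemma eventually_regular_columns:
  fixes a b e :: real and m n :: "nat \<Rightarrow> nat" and t :: "nat \<Rightarrow> nat \<Rightarrow> nat" and z :: bool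
  assumes a: "a > 0" and e: "0 < e" "e \<le> 1/200" and z: "z \<Longrightarrow> m = n"
    and reg: "eps_regular (e / 4) n (\<lambda>l j. real (t l j))"
    and acc: "acceptable a (e / 4) m n (\<lambda>l. edge_density (m l) (n l) (t l))"
  shows "\<forall>\<^sub>F l in sequentially. regular_columns (m l) (n l) z (t l) (real (n l) powr e)"
proof -
  let ?\<epsilon> = "e / 4" and ?N = "\<lambda>l. real (n l)"
  have nlim: "filterlim ?N at_top sequentially" and mlim: "filterlim (\<lambda>l. real (m l)) at_top sequentially"
    using acc by (auto simp: acceptable_def intro: filterlim_compose[OF filterlim_real_sequentially])
  have ev: "\<forall>\<^sub>F l in sequentially. P (?N l)" if "\<forall>\<^sub>F x in at_top. P x" for P
    using that nlim by (rule eventually_compose_filterlim)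
  obtain C where C: "\<forall>\<^sub>F l in sequentially. \<forall>j\<in>{..<n l}.
      \<bar>real (t l j) - (\<Sum>j<n l. real (t l j)) / ?N l\<bar> \<le> C * \<bar>?N l powr (1/2 + ?\<epsilon>)\<bar>"
    using reg by (auto simp: eps_regular_def unif_bigo_def)
  have small: "(\<lambda>l. real (m l)) \<in> o(\<lambda>l. ?N l powr (1 + ?\<epsilon>))" "(\<lambda>l. ?N l) \<in> o(\<lambda>l. real (m l) powr (1 + ?\<epsilon>))"
    using acc by (auto simp: acceptable_def)
  have mo: "\<forall>\<^sub>F l in sequentially. norm (real (m l)) \<le> 1 * norm (?N l powr (1 + ?\<epsilon>))"
    and no: "\<forall>\<^sub>F l in sequentially. norm (?N l) \<le> 1 * norm (real (m l) powr (1 + ?\<epsilon>))"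
    by (rule landau_o.smallD[OF small(1)], simp) (rule landau_o.smallD[OF small(2)], simp)
  have dens: "\<forall>\<^sub>F l in sequentially. 0 < edge_density (m l) (n l) (t l) \<and> edge_density (m l) (n l) (t l) < 1 \<and>
        (1 - 2 * edge_density (m l) (n l) (t l))\<^sup>2 / (4 * edge_density (m l) (n l) (t l) * (1 - edge_density (m l) (n l) (t l))) *
          (1 + 5 * real (m l) / (6 * real (n l)) + 5 * real (n l) / (6 * real (m l)))
        < a * ln (real (n l))"
    using acc by (auto simp: acceptable_def)
  have m1: "\<forall>\<^sub>F l in sequentially. 1 \<le> real (m l)"
    using mlim unfolding filterlim_at_top by blast
  note E1 = ev[OF eventually_powr_ge[OF e(1), of 2000]]
  have E2: "\<forall>\<^sub>F l in sequentially. 0 + 20 * ln (?N l) \<le> ?N l powr e"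
    by (rule ev[OF eventually_ln_le_powr]) (use e in auto)
  have E3: "\<forall>\<^sub>F l in sequentially. 4 + (4 * a) * ln (?N l) \<le> ?N l powr e"
    by (rule ev[OF eventually_ln_le_powr]) (use e a in auto)
  have E4: "\<forall>\<^sub>F l in sequentially. C * ?N l powr (1/2 + ?\<epsilon>) \<le> ?N l powr (1/2 + e)"
    by (rule ev[OF eventually_mult_powr_le]) (use e in auto)
  note E5 = ev[OF eventually_ge_at_top[of 2]]
  from C mo no dens m1 E1 E2 E3 E4 E5 show ?thesis
  proof eventually_elim
    case (elim l)
    let ?x = "edge_density (m l) (n l) (t l)" and ?Q = "?N l powr e"
    have N: "?N l \<ge> 2" "?N l > 0" using elim by auto
    have M: "real (m l) \<ge> 1" "real (m l) > 0" using elim by auto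
    have mean: "(\<Sum>j<n l. real (t l j)) / ?N l = ?x * real (m l)"
      using N M by (simp add: edge_density_def)
    have mle: "real (m l) \<le> ?N l powr (1 + ?\<epsilon>)" using elim(2) by simp
    show ?case
    proof
      show "m l = n l" if z using z that by simp
      have "?N l powr (1 + ?\<epsilon>) \<le> ?N l powr (1 + e)" using N e by (intro powr_mono) auto
      also have "\<dots> = ?Q * ?N l" using N by (simp add: powr_add)
      finally show "real (m l) \<le> ?Q * ?N l" using mle by linarith
      \<comment> \<open>n is at most m^(1 + \<epsilon>), and the surplus m^\<epsilon> is at most
        n^((1 + \<epsilon>) * \<epsilon>), hence at most Q.\<close>
      have "real (m l) powr ?\<epsilon> \<le> (?N l powr (1 + ?\<epsilon>)) powr ?\<epsilon>" using mle e M by (intro powr_mono2) auto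
      also have "\<dots> = ?N l powr ((1 + ?\<epsilon>) * ?\<epsilon>)" by (simp add: powr_powr)
      also have "\<dots> \<le> ?N l powr e"
      proof (rule powr_mono)
        have "(1 + ?\<epsilon>) * ?\<epsilon> \<le> 2 * ?\<epsilon>" using e by (intro mult_right_mono) auto
        then show "(1 + ?\<epsilon>) * ?\<epsilon> \<le> e" using e by linarith
      qed (use N in auto)
      finally have "real (m l) powr ?\<epsilon> * real (m l) \<le> ?Q * real (m l)" by (intro mult_right_mono) auto
      moreover have "?N l \<le> real (m l) powr (1 + ?\<epsilon>)" using elim(3) by simp
      moreover have "real (m l) powr (1 + ?\<epsilon>) = real (m l) powr ?\<epsilon> * real (m l)" using M by (simp add: powr_add)
      ultimately show "?N l \<le> ?Q * real (m l)" by linarith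
      show "1 / ?Q \<le> ?x * (1 - ?x)"
      proof -
        have x: "0 < ?x" "?x < 1" using elim(4) by auto
        \<comment> \<open>The quotient in the definition of acceptability is 1 / (4 * y) - 1, so
          acceptability bounds 1 / y by a logarithm.\<close>
        define y where "y = ?x * (1 - ?x)"
        have y: "y > 0" using x by (simp add: y_def)
        let ?r = "(1 - 2 * ?x)\<^sup>2 / (4 * ?x * (1 - ?x))"
        have "?r * 1 \<le> ?r * (1 + 5 * real (m l) / (6 * ?N l) + 5 * ?N l / (6 * real (m l)))"
          using x by (intro mult_left_mono) auto
        then have "?r < a * ln (?N l)" using elim(4) by linarith
        moreover have "?r = 1 / (4 * y) - 1"
        proof -
          have "(1 - 2 * ?x)\<^sup>2 = 1 - 4 * y" by (simp add: y_def power2_eq_square algebra_simps)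
          then show ?thesis using y by (simp add: y_def[symmetric] mult.assoc diff_divide_distrib)
        qed
        ultimately have "1 / (4 * y) < 1 + a * ln (?N l)" by linarith
        then have "1 / y \<le> 4 + (4 * a) * ln (?N l)" by (simp add: field_simps)
        also have "\<dots> \<le> ?Q" using elim by simp
        finally have "1 \<le> ?Q * y" using y by (simp add: field_simps)
        moreover have "?Q > 0" using N by simp
        ultimately show ?thesis unfolding y_def[symmetric] by (simp add: field_simps)
      qed
      show "\<bar>real (t l j) - ?x * real (m l)\<bar> \<le> ?Q * sqrt (?N l)" if "j < n l" for j
      proof -
        have "\<bar>real (t l j) - ?x * real (m l)\<bar> \<le> C * ?N l powr (1/2 + ?\<epsilon>)" using elim(1) that mean by auto
        also have "\<dots> \<le> ?N l powr (1/2 + e)" using elim by simp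
        also have "\<dots> = ?Q * sqrt (?N l)" using N by (simp add: powr_add powr_half_sqrt)
        finally show ?thesis .
      qed
      show "2000 \<le> ?Q" using elim by simp
      have "?Q ^ 60 = ?N l powr (e * 60)" using N by (simp add: powr_powr flip: powr_realpow)
      also have "\<dots> \<le> ?N l powr (1/2)" using N e by (intro powr_mono) auto
      finally show "?Q ^ 60 \<le> sqrt (?N l)" using N by (simp add: powr_half_sqrt)
      have "?N l ^ 20 = exp (20 * ln (?N l))" using N exp_of_nat_mult[of 20 "ln (?N l)"] by simp
      also have "\<dots> \<le> exp ?Q" using elim by simp
      finally show "?N l ^ 20 \<le> exp ?Q" .
    qed
  qed
qed

text \<open>The errors exist separately for each event or variable; choosing them jointly as pairs
  yields error functions with bounds uniform in x.\<close>

lemma choose_errors: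
  fixes g h :: "nat \<Rightarrow> real" and A :: "nat \<Rightarrow> 'a set"
  assumes "\<forall>\<^sub>F l in sequentially. \<forall>x\<in>A l. \<exists>d e. \<bar>d\<bar> \<le> g l \<and> \<bar>e\<bar> \<le> h l \<and> R l x d e"
  shows "\<exists>\<delta> \<eta>. (\<forall>\<^sub>F l in sequentially. \<forall>x\<in>A l. \<bar>\<delta> l x\<bar> \<le> g l) \<and>
    (\<forall>\<^sub>F l in sequentially. \<forall>x\<in>A l. \<bar>\<eta> l x\<bar> \<le> h l) \<and>
    (\<forall>\<^sub>F l in sequentially. \<forall>x\<in>A l. R l x (\<delta> l x) (\<eta> l x))"
proof -
  define p where "p l x = (SOME p. \<bar>fst p\<bar> \<le> g l \<and> \<bar>snd p\<bar> \<le> h l \<and> R l x (fst p) (snd p))" for l x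
  have "\<forall>\<^sub>F l in sequentially. \<forall>x\<in>A l. \<bar>fst (p l x)\<bar> \<le> g l \<and> \<bar>snd (p l x)\<bar> \<le> h l \<and> R l x (fst (p l x)) (snd (p l x))"
    using assms
  proof (rule eventually_mono, intro ballI)
    fix l x assume "\<forall>x\<in>A l. \<exists>d e. \<bar>d\<bar> \<le> g l \<and> \<bar>e\<bar> \<le> h l \<and> R l x d e" "x \<in> A l"
    then have "\<exists>p. \<bar>fst p\<bar> \<le> g l \<and> \<bar>snd p\<bar> \<le> h l \<and> R l x (fst p) (snd p)" by auto
    then show "\<bar>fst (p l x)\<bar> \<le> g l \<and> \<bar>snd (p l x)\<bar> \<le> h l \<and> R l x (fst (p l x)) (snd (p l x))"
      unfolding p_def by (rule someI_ex)
  qed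
  then show ?thesis
    by (intro exI[of _ "\<lambda>l x. fst (p l x)"] exI[of _ "\<lambda>l x. snd (p l x)"] conjI; elim eventually_mono) auto
qed

lemma choose_asymptotic_errors:
  fixes A :: "nat \<Rightarrow> 'a set" and n :: "nat \<Rightarrow> nat"
  assumes "\<forall>\<^sub>F l in sequentially. \<forall>x\<in>A l. \<exists>d e. \<bar>d\<bar> \<le> real (n l) powr (- b) \<and>
      \<bar>e\<bar> \<le> C * exp (- (real (n l) powr c)) \<and> R l x d e" and c: "c > 0"
  shows "\<exists>\<delta> \<eta>. unif_bigo A \<delta> (\<lambda>l. real (n l) powr (- b)) \<and> unif_otilde n A \<eta> \<and>
    (\<forall>\<^sub>F l in sequentially. \<forall>x\<in>A l. R l x (\<delta> l x) (\<eta> l x))"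
proof -
  from choose_errors[OF assms(1)] obtain \<delta> \<eta> where
    1: "\<forall>\<^sub>F l in sequentially. \<forall>x\<in>A l. \<bar>\<delta> l x\<bar> \<le> real (n l) powr (- b)" and
    2: "\<forall>\<^sub>F l in sequentially. \<forall>x\<in>A l. \<bar>\<eta> l x\<bar> \<le> C * exp (- (real (n l) powr c))" and
    3: "\<forall>\<^sub>F l in sequentially. \<forall>x\<in>A l. R l x (\<delta> l x) (\<eta> l x)" by blast
  have "unif_bigo A \<delta> (\<lambda>l. real (n l) powr (- b))"
    unfolding unif_bigo_def by (rule exI[of _ 1]) (use 1 in simp)
  moreover have "unif_otilde n A \<eta>"
    unfolding unif_otilde_def unif_bigo_def by (rule exI[of _ c], intro conjI c exI[of _ C]) (use 2 in simp)
  ultimately show ?thesis using 3 by blast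
qed

lemma asymptotic_transfer:
  fixes D D' :: "nat \<Rightarrow> (nat \<Rightarrow> nat) pmf" and m n :: "nat \<Rightarrow> nat"
  assumes c: "c > 0"
    and ev: "\<forall>\<^sub>F l in sequentially. \<exists>B. close_pmfs (D l) (D' l) (int_vecs (n l) (m l)) B
        (real (n l) powr (- b)) (6 * exp (- (real (n l) powr c)))"
  shows "(\<exists>B :: nat \<Rightarrow> (nat \<Rightarrow> nat) set.
         (\<forall>l. B l \<subseteq> int_vecs (n l) (m l)) \<and>
         otilde n (\<lambda>l. measure_pmf.prob (D l) (B l)) \<and>
         (\<exists>\<delta>. unif_bigo (\<lambda>l. int_vecs (n l) (m l) - B l) \<delta> (\<lambda>l. real (n l) powr (- b)) \<and>
            (\<forall>\<^sub>F l in sequentially. \<forall>s \<in> int_vecs (n l) (m l) - B l.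
               pmf (D l) s = (1 + \<delta> l s) * pmf (D' l) s))) \<and>
      (\<exists>\<delta> \<eta>. unif_bigo (\<lambda>l. Pow (int_vecs (n l) (m l))) \<delta> (\<lambda>l. real (n l) powr (- b)) \<and>
         unif_otilde n (\<lambda>l. Pow (int_vecs (n l) (m l))) \<eta> \<and>
         (\<forall>\<^sub>F l in sequentially. \<forall>E \<subseteq> int_vecs (n l) (m l).
            measure_pmf.prob (D l) E = (1 + \<delta> l E) * measure_pmf.prob (D' l) E + \<eta> l E)) \<and>
      (\<exists>\<delta> \<eta>. unif_bigo (\<lambda>l. UNIV) \<delta> (\<lambda>l. real (n l) powr (- b)) \<and>
         unif_otilde n (\<lambda>l. UNIV) \<eta> \<and>
         (\<forall>\<^sub>F l in sequentially. \<forall>X :: (nat \<Rightarrow> nat) \<Rightarrow> real.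
            measure_pmf.expectation (D l) X =
              measure_pmf.expectation (D' l) X
              + \<delta> l X * measure_pmf.expectation (D' l) (\<lambda>s. \<bar>X s\<bar>)
              + \<eta> l X * (MAX s \<in> int_vecs (n l) (m l). \<bar>X s\<bar>))) \<and>
      (\<exists>\<delta> \<eta>. unif_bigo (\<lambda>l. UNIV) \<delta> (\<lambda>l. real (n l) powr (- b)) \<and>
         unif_otilde n (\<lambda>l. UNIV) \<eta> \<and>
         (\<forall>\<^sub>F l in sequentially. \<forall>X :: (nat \<Rightarrow> nat) \<Rightarrow> real.
            measure_pmf.variance (D l) X =
              (1 + \<delta> l X) * measure_pmf.variance (D' l) X
              + \<eta> l X * (MAX s \<in> int_vecs (n l) (m l). (X s)\<^sup>2)))"
    (is "?point \<and> ?prob \<and> ?exp \<and> ?var")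
proof (intro conjI)
  let ?S = "\<lambda>l. int_vecs (n l) (m l)"
  let ?g = "\<lambda>l. real (n l) powr (- b)" and ?h = "\<lambda>l. exp (- (real (n l) powr c))"
  let ?close = "\<lambda>l B. close_pmfs (D l) (D' l) (?S l) B (?g l) (6 * ?h l)"
  show ?point
  proof -
    define B where "B l = (if \<exists>B. ?close l B then SOME B. ?close l B else {})" for l
    have B: "?close l (B l)" if "\<exists>B. ?close l B" for l
      using someI_ex[OF that] that by (simp add: B_def)
    have evB: "\<forall>\<^sub>F l in sequentially. ?close l (B l)" using ev by eventually_elim (rule B)
    have sub: "B l \<subseteq> ?S l" for l
    proof (cases "\<exists>B. ?close l B")
      case True
      then show ?thesis using B close_pmfs.B by blast
    qed (simp add: B_def)
    define \<delta> where "\<delta> l s = pmf (D l) s / pmf (D' l) s - 1" for l s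
    have pt: "\<bar>\<delta> l s\<bar> \<le> ?g l \<or> pmf (D' l) s = 0" "pmf (D l) s = (1 + \<delta> l s) * pmf (D' l) s"
      if cl: "?close l (B l)" and s: "s \<in> ?S l - B l" for l s
    proof -
      have le: "\<bar>pmf (D l) s - pmf (D' l) s\<bar> \<le> ?g l * pmf (D' l) s" using close_pmfs.close[OF cl s] .
      show "pmf (D l) s = (1 + \<delta> l s) * pmf (D' l) s" using le by (cases "pmf (D' l) s = 0") (auto simp: \<delta>_def)
      show "\<bar>\<delta> l s\<bar> \<le> ?g l \<or> pmf (D' l) s = 0"
      proof (cases "pmf (D' l) s = 0")
        case False
        then have p: "pmf (D' l) s > 0" by (simp add: pmf_pos)
        have "\<delta> l s = (pmf (D l) s - pmf (D' l) s) / pmf (D' l) s" using p by (simp add: \<delta>_def field_simps)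
        then have "\<bar>\<delta> l s\<bar> = \<bar>pmf (D l) s - pmf (D' l) s\<bar> / pmf (D' l) s" by (simp add: abs_divide)
        then show ?thesis using le p by (simp add: pos_divide_le_eq)
      qed simp
    qed
    \<comment> \<open>Where the second law vanishes, division by zero makes \<open>\<delta>\<close>
      equal to - 1, which is not a small error. The first law vanishes there too, so 0 serves as
      well.\<close>
    define \<delta>' where "\<delta>' l s = (if pmf (D' l) s = 0 then 0 else \<delta> l s)" for l s
    have "unif_bigo (\<lambda>l. ?S l - B l) \<delta>' ?g"
      unfolding unif_bigo_def
    proof (rule exI[of _ 1], use evB in eventually_elim, intro ballI)
      fix l s assume cl: "?close l (B l)" and s: "s \<in> ?S l - B l"
      show "\<bar>\<delta>' l s\<bar> \<le> 1 * \<bar>?g l\<bar>" using pt(1)[OF cl s] by (auto simp: \<delta>'_def)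
    qed
    moreover have "\<forall>\<^sub>F l in sequentially. \<forall>s \<in> ?S l - B l. pmf (D l) s = (1 + \<delta>' l s) * pmf (D' l) s"
      using evB
    proof (eventually_elim, intro ballI)
      fix l s assume cl: "?close l (B l)" and s: "s \<in> ?S l - B l"
      show "pmf (D l) s = (1 + \<delta>' l s) * pmf (D' l) s" using pt(2)[OF cl s] by (auto simp: \<delta>'_def)
    qed
    moreover have "otilde n (\<lambda>l. measure_pmf.prob (D l) (B l))"
      unfolding otilde_def
    proof (intro exI[of _ c] conjI c landau_o.bigI[of 6])
      show "\<forall>\<^sub>F l in sequentially. norm (measure_pmf.prob (D l) (B l)) \<le> 6 * norm (?h l)"
        using evB by eventually_elim (use close_pmfs.prob_B(1) in force)
    qed simp
    ultimately show ?thesis using sub by blast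
  qed
  \<comment> \<open>One constant for all three transfers: probabilities and expectations need 2 * 6,
    variances 8 * 6.\<close>
  have h: "2 * (6 * ?h l) \<le> 48 * ?h l" "8 * (6 * ?h l) = 48 * ?h l" for l by simp_all
  have "\<forall>\<^sub>F l in sequentially. \<forall>E\<in>Pow (?S l). \<exists>d e. \<bar>d\<bar> \<le> ?g l \<and> \<bar>e\<bar> \<le> 48 * ?h l \<and>
      measure_pmf.prob (D l) E = (1 + d) * measure_pmf.prob (D' l) E + e"
    using ev
  proof (eventually_elim, intro ballI)
    fix l E assume "\<exists>B. ?close l B" "E \<in> Pow (?S l)"
    then show "\<exists>d e. \<bar>d\<bar> \<le> ?g l \<and> \<bar>e\<bar> \<le> 48 * ?h l \<and>
        measure_pmf.prob (D l) E = (1 + d) * measure_pmf.prob (D' l) E + e"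
      using close_pmfs.prob_transfer[of "D l" "D' l" "?S l" _ "?g l" "6 * ?h l" E] h(1)[of l]
      by (meson PowD order.trans)
  qed
  from choose_asymptotic_errors[OF this c] show ?prob by (simp only: Ball_def Pow_iff)
  have "\<forall>\<^sub>F l in sequentially. \<forall>X\<in>UNIV. \<exists>d e. \<bar>d\<bar> \<le> ?g l \<and> \<bar>e\<bar> \<le> 48 * ?h l \<and>
      measure_pmf.expectation (D l) X = measure_pmf.expectation (D' l) X
        + d * measure_pmf.expectation (D' l) (\<lambda>s. \<bar>X s\<bar>) + e * (MAX s \<in> ?S l. \<bar>X s\<bar>)"
    using ev
  proof (eventually_elim, intro ballI)
    fix l and X :: "(nat \<Rightarrow> nat) \<Rightarrow> real" assume "\<exists>B. ?close l B"
    then show "\<exists>d e. \<bar>d\<bar> \<le> ?g l \<and> \<bar>e\<bar> \<le> 48 * ?h l \<and>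
        measure_pmf.expectation (D l) X = measure_pmf.expectation (D' l) X
        + d * measure_pmf.expectation (D' l) (\<lambda>s. \<bar>X s\<bar>) + e * (MAX s \<in> ?S l. \<bar>X s\<bar>)"
      using close_pmfs.expectation_transfer[of "D l" "D' l" "?S l" _ "?g l" "6 * ?h l" X] h(1)[of l]
      by (meson order.trans)
  qed
  from choose_asymptotic_errors[OF this c] show ?exp by (simp only: ball_UNIV)
  have "\<forall>\<^sub>F l in sequentially. \<forall>X\<in>UNIV. \<exists>d e. \<bar>d\<bar> \<le> ?g l \<and> \<bar>e\<bar> \<le> 48 * ?h l \<and>
      measure_pmf.variance (D l) X = (1 + d) * measure_pmf.variance (D' l) X + e * (MAX s \<in> ?S l. (X s)\<^sup>2)"
    using ev
  proof (eventually_elim, intro ballI)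
    fix l and X :: "(nat \<Rightarrow> nat) \<Rightarrow> real" assume "\<exists>B. ?close l B"
    then show "\<exists>d e. \<bar>d\<bar> \<le> ?g l \<and> \<bar>e\<bar> \<le> 48 * ?h l \<and>
        measure_pmf.variance (D l) X = (1 + d) * measure_pmf.variance (D' l) X + e * (MAX s \<in> ?S l. (X s)\<^sup>2)"
      using close_pmfs.variance_transfer[of "D l" "D' l" "?S l" _ "?g l" "6 * ?h l" X, unfolded h(2)]
      by blast
  qed
  from choose_asymptotic_errors[OF this c] show ?var by (simp only: ball_UNIV)
qed

theorem theorem1p7:
  fixes a b :: real
  assumes "a > 0" and "b > 0" and "a + b < 1/2"
  shows "\<exists>\<epsilon>>0. \<forall>(m :: nat \<Rightarrow> nat) (n :: nat \<Rightarrow> nat) (t :: nat \<Rightarrow> nat \<Rightarrow> nat).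
    (\<forall>l. t l \<in> int_vecs (m l) (n l)) \<and>
    eps_regular \<epsilon> n (\<lambda>l j. real (t l j)) \<and>
    acceptable a \<epsilon> m n (\<lambda>l. edge_density (m l) (n l) (t l)) \<longrightarrow>
    (\<forall>(D :: nat \<Rightarrow> (nat \<Rightarrow> nat) pmf) (D' :: nat \<Rightarrow> (nat \<Rightarrow> nat) pmf).
      (D = (\<lambda>l. G_dist (m l) (n l) (t l)) \<and> D' = (\<lambda>l. B_dist (m l) (n l) (t l))) \<or>
      (m = n \<and> D = (\<lambda>l. G_dist_vec (n l) (t l)) \<and> D' = (\<lambda>l. B_dist_vec (n l) (t l)))
      \<longrightarrow>
      (\<exists>B :: nat \<Rightarrow> (nat \<Rightarrow> nat) set.
         (\<forall>l. B l \<subseteq> int_vecs (n l) (m l)) \<and>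
         otilde n (\<lambda>l. measure_pmf.prob (D l) (B l)) \<and>
         (\<exists>\<delta>. unif_bigo (\<lambda>l. int_vecs (n l) (m l) - B l) \<delta> (\<lambda>l. real (n l) powr (- b)) \<and>
            (\<forall>\<^sub>F l in sequentially. \<forall>s \<in> int_vecs (n l) (m l) - B l.
               pmf (D l) s = (1 + \<delta> l s) * pmf (D' l) s))) \<and>
      (\<exists>\<delta> \<eta>. unif_bigo (\<lambda>l. Pow (int_vecs (n l) (m l))) \<delta> (\<lambda>l. real (n l) powr (- b)) \<and>
         unif_otilde n (\<lambda>l. Pow (int_vecs (n l) (m l))) \<eta> \<and>
         (\<forall>\<^sub>F l in sequentially. \<forall>E \<subseteq> int_vecs (n l) (m l).
            measure_pmf.prob (D l) E = (1 + \<delta> l E) * measure_pmf.prob (D' l) E + \<eta> l E)) \<and>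
      (\<exists>\<delta> \<eta>. unif_bigo (\<lambda>l. UNIV) \<delta> (\<lambda>l. real (n l) powr (- b)) \<and>
         unif_otilde n (\<lambda>l. UNIV) \<eta> \<and>
         (\<forall>\<^sub>F l in sequentially. \<forall>X :: (nat \<Rightarrow> nat) \<Rightarrow> real.
            measure_pmf.expectation (D l) X =
              measure_pmf.expectation (D' l) X
              + \<delta> l X * measure_pmf.expectation (D' l) (\<lambda>s. \<bar>X s\<bar>)
              + \<eta> l X * (MAX s \<in> int_vecs (n l) (m l). \<bar>X s\<bar>))) \<and>
      (\<exists>\<delta> \<eta>. unif_bigo (\<lambda>l. UNIV) \<delta> (\<lambda>l. real (n l) powr (- b)) \<and>
         unif_otilde n (\<lambda>l. UNIV) \<eta> \<and>
         (\<forall>\<^sub>F l in sequentially. \<forall>X :: (nat \<Rightarrow> nat) \<Rightarrow> real.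
            measure_pmf.variance (D l) X =
              (1 + \<delta> l X) * measure_pmf.variance (D' l) X
              + \<eta> l X * (MAX s \<in> int_vecs (n l) (m l). (X s)\<^sup>2))))"
proof -
  \<comment> \<open>The binding condition is 36 * e < 1 - 2 * b: with \<Gamma> = n^(-b) / 5 it gives
    Q^36 at most \<Gamma>^2 * n for large n. Dividing by 200 also ensures
    \<open>e \<le> 1/200\<close>.\<close>
  define e where "e = (1 - 2 * b) / 200"
  have e: "0 < e" "e \<le> 1/200" "36 * e < 1 - 2 * b" using assms by (auto simp: e_def)
  show ?thesis
  proof (rule exI[of _ "e / 4"], rule conjI, goal_cases)
    case 1
    show ?case using e by simp
  next
    case 2
    show ?case
    proof (intro allI impI, goal_cases)
      case (1 m n t D D')
      then have t: "\<And>l. t l \<in> int_vecs (m l) (n l)"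
        and reg: "eps_regular (e / 4) n (\<lambda>l j. real (t l j))"
        and acc: "acceptable a (e / 4) m n (\<lambda>l. edge_density (m l) (n l) (t l))"
        and cases: "(D = (\<lambda>l. G_dist (m l) (n l) (t l)) \<and> D' = (\<lambda>l. B_dist (m l) (n l) (t l))) \<or>
          (m = n \<and> D = (\<lambda>l. G_dist_vec (n l) (t l)) \<and> D' = (\<lambda>l. B_dist_vec (n l) (t l)))" by auto
      \<comment> \<open>Defined as the failure of the first case, so that each value of
        \<open>z\<close> determines the pair of laws, even if both descriptions should
        apply.\<close>
      define z where "z \<longleftrightarrow> \<not> (D = (\<lambda>l. G_dist (m l) (n l) (t l)) \<and> D' = (\<lambda>l. B_dist (m l) (n l) (t l)))"
      have zmn: "z \<Longrightarrow> m = n" using cases by (auto simp: z_def)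
      let ?N = "\<lambda>l. real (n l)" and ?Q = "\<lambda>l. real (n l) powr e"
      have nlim: "filterlim ?N at_top sequentially"
        using acc by (auto simp: acceptable_def intro: filterlim_compose[OF filterlim_real_sequentially])
      have ev: "\<forall>\<^sub>F l in sequentially. P (?N l)" if "\<forall>\<^sub>F x in at_top. P x" for P
        using that nlim by (rule eventually_compose_filterlim)
      have E0: "\<forall>\<^sub>F l in sequentially. regular_columns (m l) (n l) z (t l) (?Q l)"
        by (rule eventually_regular_columns[OF assms(1) e(1,2)]) (use zmn reg acc in auto)
      have E1: "\<forall>\<^sub>F l in sequentially. 25 * ?N l powr (36 * e) \<le> ?N l powr (1 - 2 * b)"
        by (rule ev[OF eventually_mult_powr_le[OF e(3)]])
      have E2: "\<forall>\<^sub>F l in sequentially. 2 * ?N l powr (e / 2) \<le> ?N l powr e"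
        by (rule ev[OF eventually_mult_powr_le]) (use e in auto)
      note E3 = ev[OF eventually_ge_at_top[of 1]]
      have "\<forall>\<^sub>F l in sequentially. \<exists>B. close_pmfs (D l) (D' l) (int_vecs (n l) (m l)) B
          (?N l powr (- b)) (6 * exp (- (?N l powr (e / 2))))"
        using E0 E1 E2 E3
      proof eventually_elim
        case (elim l)
        interpret rc: regular_columns "m l" "n l" z "t l" "?Q l" by (rule elim(1))
        \<comment> \<open>The final error 5 * \<Gamma> is then exactly n^(-b), and the factor 25 in
          \<open>E1\<close> is the square of this 5.\<close>
        define \<Gamma> where "\<Gamma> = ?N l powr (- b) / 5"
        have N: "?N l > 0" using elim by simp
        have le1: "?N l powr (- b) \<le> 1" using powr_mono[of "- b" 0 "?N l"] elim(4) assms by simp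
        have "0 < \<Gamma>" "\<Gamma> \<le> 1/5" using N le1 by (auto simp: \<Gamma>_def)
        moreover have "?Q l ^ 36 \<le> \<Gamma>\<^sup>2 * rc.w\<^sup>2"
        proof -
          have "?Q l ^ 36 = ?N l powr (36 * e)" using N by (simp add: powr_powr mult.commute flip: powr_realpow)
          moreover have "\<Gamma>\<^sup>2 * rc.w\<^sup>2 = ?N l powr (1 - 2 * b) / 25"
          proof -
            have "(?N l powr (- b))\<^sup>2 * ?N l = ?N l powr (- b) * ?N l powr (- b) * ?N l powr 1"
              using N by (simp add: power2_eq_square)
            also have "\<dots> = ?N l powr (1 - 2 * b)" unfolding powr_add[symmetric] by simp
            finally show ?thesis unfolding rc.scale_bounds(5) by (simp add: \<Gamma>_def power_divide)
          qed
          ultimately show ?thesis using elim by simp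
        qed
        ultimately obtain B where "close_pmfs rc.graph_deg rc.unif_deg (int_vecs (n l) (m l)) B (5 * \<Gamma>) (6 * exp (- ?Q l / 2))"
          using rc.close_pmfs_degrees by blast
        moreover have "D l = rc.graph_deg \<and> D' l = rc.unif_deg"
        proof (cases z)
          case True
          then have D: "m = n" "D = (\<lambda>l. G_dist_vec (n l) (t l))" "D' = (\<lambda>l. B_dist_vec (n l) (t l))"
            using cases unfolding z_def by blast+
          have zT: "z = True" using True by simp
          have r: "regular_columns (n l) (n l) True (t l) (?Q l)" using elim(1) unfolding zT D(1) .
          show ?thesis unfolding zT D using G_dist_vec_eq[OF r] B_dist_vec_eq[OF r] by simp
        next
          case False
          then have D: "D = (\<lambda>l. G_dist (m l) (n l) (t l))" "D' = (\<lambda>l. B_dist (m l) (n l) (t l))"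
            unfolding z_def by blast+
          have zF: "z = False" using False by simp
          have r: "regular_columns (m l) (n l) False (t l) (?Q l)" using elim(1) unfolding zF .
          show ?thesis unfolding zF D using G_dist_eq[OF r] B_dist_eq[OF r t] by simp
        qed
        ultimately have cl: "close_pmfs (D l) (D' l) (int_vecs (n l) (m l)) B (?N l powr (- b)) (6 * exp (- ?Q l / 2))"
          by (simp add: \<Gamma>_def)
        \<comment> \<open>Halving the exponent to e / 2 absorbs the division of Q by 2.\<close>
        have "6 * exp (- ?Q l / 2) \<le> 6 * exp (- (?N l powr (e / 2)))" using elim by simp
        with cl have "close_pmfs (D l) (D' l) (int_vecs (n l) (m l)) B (?N l powr (- b)) (6 * exp (- (?N l powr (e / 2))))"
          by (rule close_pmfs_mono)
        then show ?case by blast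
      qed
      then show ?case by (rule asymptotic_transfer[rotated]) (use e in simp)
    qed
  qed
qed

end
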